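(* The PDE system $u_{ij}=0$, $1\le i,j\le n$, has point symmetry algebra $\mathfrak{g}=A_{n+1}$ (i.e. $\mathfrak{sl}_{n+2}(\mathbb{C})$). Its generating functions are spanned by the following, with bigrading components $\mathfrak{g}_{a,b}$ as indicated (indices $i,j$ range over $1,\dots,n$, and repeated indices in $x^ju_j$ are summed): - $\mathfrak{g}_{-2}=\mathfrak{g}_{-1,-1}$: $1$; - $\mathfrak{g}_{-1}=\mathfrak{g}_{-1,0}\oplus\mathfrak{g}_{0,-1}$: $x^i\in\mathfrak{g}_{-1,0}$, $\;u_i\in\mathfrak{g}_{0,-1}$; - $\mathfrak{g}_0=\mathfrak{g}_{0,0}$: $\mathsf{Z}=2u-x^iu_i$, $\;x^iu_j$; - $\mathfrak{g}_1=\mathfrak{g}_{1,0}\oplus\mathfrak{g}_{0,1}$: $uu_i\in\mathfrak{g}_{1,0}$, $\;x^i(u-x^ju_j)\in\mathfrak{g}_{0,1}$; - $\mathfrak{g}_2=\mathfrak{g}_{1,1}$: $u(u-x^ju_j)$. Here $\mathsf{Z}=\mathsf{Z}_1+\mathsf{Z}_{n+1}$, where the bi-grading element $(\mathsf{Z}_1,\mathsf{Z}_{n+1})=(u,\,u-x^iu_i)$ acts as indicated above, i.e. $[\mathsf{Z}_1,g]=a\,g$ and $[\mathsf{Z}_{n+1},g]=b\,g$ for $g\in\mathfrak{g}_{a,b}$.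
   Context: Complex setting; $n\geq 1$ independent variables $x^1,\dots,x^n$, one dependent variable $u$; $u_i,u_{ij}$ are first and second jet variables. On $J^1(\mathbb{C}^n,\mathbb{C})$ with contact distribution $\mathcal{C}=\ker(du-u_idx^i)$, contact vector fields correspond to generating functions $f(x^i,u,u_i)$ via $\mathbf{S}_f=-f_{u_i}\frac{d}{dx^i}+f\partial_u+\frac{df}{dx^i}\partial_{u_i}$, $\frac{d}{dx^i}=\partial_{x^i}+u_i\partial_u$, with $[\mathbf{S}_f,\mathbf{S}_g]=\mathbf{S}_{[f,g]}$ for the Lagrange bracket $[f,g]=fg_u-gf_u+\frac{df}{dx^i}g_{u_i}-\frac{dg}{dx^i}f_{u_i}$. A point symmetry of the PDE system is a contact vector field that preserves the subbundle $\mathrm{span}\{\partial_{u_k}\}$ of $\mathcal{C}$ and whose prolongation to $J^2(\mathbb{C}^n,\mathbb{C})$ is tangent to the submanifold defined by the system. *)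

theory Defs
  imports "HOL-Analysis.Analysis" "HOL-Library.Function_Algebras"
begin

section \<open>Complex vector spaces\<close>

class complex_vector = ab_group_add +
  fixes scaleC :: "complex \<Rightarrow> 'a \<Rightarrow> 'a" (infixr \<open>*\<^sub>C\<close> 75)
  assumes scaleC_add_right: "c *\<^sub>C (x + y) = c *\<^sub>C x + c *\<^sub>C y"
    and scaleC_add_left: "(c + d) *\<^sub>C x = c *\<^sub>C x + d *\<^sub>C x"
    and scaleC_scaleC: "c *\<^sub>C d *\<^sub>C x = (c * d) *\<^sub>C x"
    and scaleC_one: "1 *\<^sub>C x = x"

global_interpretation complex_vector: vector_space "scaleC :: complex \<Rightarrow> 'a \<Rightarrow> 'a::complex_vector"
  by standard (simp_all add: scaleC_add_right scaleC_add_left scaleC_scaleC scaleC_one)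

instantiation complex :: complex_vector
begin
definition scaleC_complex :: "complex \<Rightarrow> complex \<Rightarrow> complex"
  where "scaleC_complex c z = c * z"
instance by standard (simp_all add: scaleC_complex_def algebra_simps)
end

instantiation prod :: (complex_vector, complex_vector) complex_vector
begin
definition scaleC_prod :: "complex \<Rightarrow> 'a \<times> 'b \<Rightarrow> 'a \<times> 'b"
  where "scaleC_prod c z = (c *\<^sub>C fst z, c *\<^sub>C snd z)"
instance by standard
    (simp_all add: scaleC_prod_def prod_eq_iff scaleC_add_right scaleC_add_left scaleC_scaleC
      scaleC_one)
end

instantiation vec :: (complex_vector, finite) complex_vector
begin
definition scaleC_vec :: "complex \<Rightarrow> 'a ^ 'b \<Rightarrow> 'a ^ 'b"
  where "scaleC_vec c z = (\<chi> i. c *\<^sub>C z $ i)"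
instance by standard
    (simp_all add: scaleC_vec_def vec_eq_iff scaleC_add_right scaleC_add_left scaleC_scaleC
      scaleC_one)
end

instantiation "fun" :: (type, complex_vector) complex_vector
begin
definition scaleC_fun :: "complex \<Rightarrow> ('a \<Rightarrow> 'b) \<Rightarrow> 'a \<Rightarrow> 'b"
  where "scaleC_fun c f = (\<lambda>z. c *\<^sub>C f z)"
instance by standard
    (simp_all add: scaleC_fun_def fun_eq_iff scaleC_add_right scaleC_add_left scaleC_scaleC
      scaleC_one)
end

abbreviation cspan :: "'a::complex_vector set \<Rightarrow> 'a set"
  where "cspan \<equiv> complex_vector.span"

section \<open>Lie algebras and bigradings\<close>

definition lie_algebra :: "('a::complex_vector \<Rightarrow> 'a \<Rightarrow> 'a) \<Rightarrow> 'a set \<Rightarrow> bool"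
  where "lie_algebra br L \<longleftrightarrow>
    complex_vector.subspace L \<and>
    (\<forall>x\<in>L. \<forall>y\<in>L. br x y \<in> L) \<and>
    (\<forall>x\<in>L. \<forall>y\<in>L. \<forall>z\<in>L. br (x + y) z = br x z + br y z \<and> br z (x + y) = br z x + br z y) \<and>
    (\<forall>c. \<forall>x\<in>L. \<forall>y\<in>L. br (c *\<^sub>C x) y = c *\<^sub>C br x y \<and> br x (c *\<^sub>C y) = c *\<^sub>C br x y) \<and>
    (\<forall>x\<in>L. br x x = 0) \<and>
    (\<forall>x\<in>L. \<forall>y\<in>L. \<forall>z\<in>L. br x (br y z) + br y (br z x) + br z (br x y) = 0)"

definition lie_isomorphism ::
  "('a::complex_vector \<Rightarrow> 'a \<Rightarrow> 'a) \<Rightarrow> 'a set \<Rightarrow>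
   ('b::complex_vector \<Rightarrow> 'b \<Rightarrow> 'b) \<Rightarrow> 'b set \<Rightarrow> ('a \<Rightarrow> 'b) \<Rightarrow> bool"
  where "lie_isomorphism brL L brM M \<phi> \<longleftrightarrow>
    lie_algebra brL L \<and> lie_algebra brM M \<and> bij_betw \<phi> L M \<and>
    (\<forall>x\<in>L. \<forall>y\<in>L. \<phi> (x + y) = \<phi> x + \<phi> y) \<and>
    (\<forall>c. \<forall>x\<in>L. \<phi> (c *\<^sub>C x) = c *\<^sub>C \<phi> x) \<and>
    (\<forall>x\<in>L. \<forall>y\<in>L. \<phi> (brL x y) = brM (\<phi> x) (\<phi> y))"

definition bigrading ::
  "('a::complex_vector \<Rightarrow> 'a \<Rightarrow> 'a) \<Rightarrow> 'a set \<Rightarrow> (int \<Rightarrow> int \<Rightarrow> 'a set) \<Rightarrow> bool"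
  where "bigrading br L G \<longleftrightarrow>
    (\<forall>a b. complex_vector.subspace (G a b) \<and> G a b \<subseteq> L) \<and>
    (\<forall>x\<in>L. \<exists>!y :: int \<times> int \<Rightarrow> 'a.
       finite {k. y k \<noteq> 0} \<and> (\<forall>a b. y (a, b) \<in> G a b) \<and> x = (\<Sum>k | y k \<noteq> 0. y k)) \<and>
    (\<forall>a b c d. \<forall>x\<in>G a b. \<forall>y\<in>G c d. br x y \<in> G (a + c) (b + d))"

definition is_direct_sum :: "'a::complex_vector set \<Rightarrow> 'a set \<Rightarrow> 'a set \<Rightarrow> bool"
  where "is_direct_sum V A B \<longleftrightarrow> V = {x + y | x y. x \<in> A \<and> y \<in> B} \<and> A \<inter> B = {0}"

definition special_linear :: "(complex ^ 'm ^ 'm) set"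
  where "special_linear = {A. trace A = 0}"

definition commutator :: "complex ^ 'm ^ 'm \<Rightarrow> complex ^ 'm ^ 'm \<Rightarrow> complex ^ 'm ^ 'm"
  where "commutator A B = A ** B - B ** A"

section \<open>Holomorphic vector fields and distributions\<close>

text \<open>
  Manifolds are sets \<open>M\<close> that are relatively open in a complex linear subspace of a
  finite-dimensional complex space. This is needed (rather than just open sets) because the second
  jet space is made of symmetric matrices \<open>(u\<^sub>i\<^sub>j)\<close>. For such \<open>M\<close>,
  holomorphy is Frechet differentiability along \<open>M\<close> with a complex linear derivative.
\<close>

definition holomorphic_map_on ::
  "('a::{real_normed_vector,complex_vector} \<Rightarrow> 'b::{real_normed_vector,complex_vector}) \<Rightarrow> 'a set \<Rightarrow> bool"
  where "holomorphic_map_on F M \<longleftrightarrow>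
    (\<forall>w\<in>M. \<exists>F'. (F has_derivative F') (at w within M) \<and> (\<forall>c v. F' (c *\<^sub>C v) = c *\<^sub>C F' v))"

definition tangent_space :: "'a::real_normed_vector set \<Rightarrow> 'a \<Rightarrow> 'a set"
  where "tangent_space M w =
    {v. \<exists>\<gamma> :: real \<Rightarrow> 'a. \<gamma> 0 = w \<and> (\<forall>\<^sub>F t in nhds 0. \<gamma> t \<in> M) \<and>
          (\<gamma> has_vector_derivative v) (at 0)}"

text \<open>
  Vector fields on \<open>M\<close> are extended by zero outside \<open>M\<close>, so that two of them are equal as
  functions iff they agree on \<open>M\<close>.
\<close>

definition restrict_zero :: "'a set \<Rightarrow> ('a \<Rightarrow> 'b::zero) \<Rightarrow> 'a \<Rightarrow> 'b"
  where "restrict_zero M F z = (if z \<in> M then F z else 0)"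

definition vector_field_on :: "'a::{real_normed_vector,complex_vector} set \<Rightarrow> ('a \<Rightarrow> 'a) \<Rightarrow> bool"
  where "vector_field_on M X \<longleftrightarrow>
    holomorphic_map_on X M \<and> (\<forall>w\<in>M. X w \<in> tangent_space M w) \<and> (\<forall>w. w \<notin> M \<longrightarrow> X w = 0)"

text \<open>
  For holomorphic \<open>F\<close> the derivative along the real line \<open>t \<mapsto> z + t v\<close> is the
  complex directional derivative \<open>dF(z)(v)\<close>. If \<open>v\<close> is tangent to \<open>M\<close> at
  \<open>z\<close>, only the values of \<open>F\<close> on \<open>M\<close> matter.
\<close>

definition dir_deriv :: "('a::real_normed_vector \<Rightarrow> 'b::real_normed_vector) \<Rightarrow> 'a \<Rightarrow> 'a \<Rightarrow> 'b"
  where "dir_deriv F z v = vector_derivative (\<lambda>t :: real. F (z + t *\<^sub>R v)) (at 0)"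

definition vf_bracket :: "('a::real_normed_vector \<Rightarrow> 'a) \<Rightarrow> ('a \<Rightarrow> 'a) \<Rightarrow> 'a \<Rightarrow> 'a"
  where "vf_bracket X Y w = dir_deriv Y w (X w) - dir_deriv X w (Y w)"

text \<open>A distribution on \<open>M\<close> assigns to each point a subspace of the tangent space; \<open>X\<close>
  preserves it if bracketing with \<open>X\<close> maps sections to sections.\<close>

definition preserves ::
  "'a::{real_normed_vector,complex_vector} set \<Rightarrow> ('a \<Rightarrow> 'a set) \<Rightarrow> ('a \<Rightarrow> 'a) \<Rightarrow> bool"
  where "preserves M D X \<longleftrightarrow>
    (\<forall>Y. vector_field_on M Y \<and> (\<forall>w\<in>M. Y w \<in> D w) \<longrightarrow> (\<forall>w\<in>M. vf_bracket X Y w \<in> D w))"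

section \<open>Jet spaces, contact vector fields and point symmetries\<close>

text \<open>
  Points of the first jet space are \<open>(x, u, p)\<close> with \<open>p\<^sub>i = u\<^sub>i\<close>; points
  of the second jet space are \<open>((x, u, p), h)\<close> with \<open>h\<close> the symmetric matrix of the
  \<open>u\<^sub>i\<^sub>j\<close>. Tangent vectors are written in the same coordinates.
\<close>

type_synonym 'n jet1 = "(complex ^ 'n) \<times> complex \<times> (complex ^ 'n)"
type_synonym 'n jet2 = "'n jet1 \<times> (complex ^ 'n ^ 'n)"

text \<open>The second jet space over an open set \<open>U\<close> of first jets.\<close>

definition jet2_over :: "'n::finite jet1 set \<Rightarrow> 'n jet2 set"
  where "jet2_over U = {(z, h). z \<in> U \<and> transpose h = h}"

text \<open>Kernel of \<open>du - u\<^sub>i dx\<^sup>i\<close>.\<close>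

definition contact1 :: "'n::finite jet1 \<Rightarrow> 'n jet1 set"
  where "contact1 = (\<lambda>(x, u, p). {(\<xi>, \<eta>, \<pi>). \<eta> = (\<Sum>i\<in>UNIV. p $ i * \<xi> $ i)})"

text \<open>Common kernel of \<open>du - u\<^sub>i dx\<^sup>i\<close> and \<open>du\<^sub>i - u\<^sub>i\<^sub>j dx\<^sup>j\<close>.\<close>

definition contact2 :: "'n::finite jet2 \<Rightarrow> 'n jet2 set"
  where "contact2 = (\<lambda>((x, u, p), h). {((\<xi>, \<eta>, \<pi>), \<theta>).
    \<eta> = (\<Sum>i\<in>UNIV. p $ i * \<xi> $ i) \<and> (\<forall>i. \<pi> $ i = (\<Sum>j\<in>UNIV. h $ i $ j * \<xi> $ j))})"

text \<open>Span of the \<open>\<partial>/\<partial>u\<^sub>k\<close>.\<close>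

definition vertical :: "'n::finite jet1 \<Rightarrow> 'n jet1 set"
  where "vertical z = {(0, 0, \<pi>) | \<pi>. True}"

definition contact_vector_field :: "'n::finite jet1 set \<Rightarrow> ('n jet1 \<Rightarrow> 'n jet1) \<Rightarrow> bool"
  where "contact_vector_field U X \<longleftrightarrow> vector_field_on U X \<and> preserves U contact1 X"

text \<open>The prolongation is the lift to the second jet space that preserves the contact distribution
  there. It is unique.\<close>

definition prolongation ::
  "'n::finite jet1 set \<Rightarrow> ('n jet1 \<Rightarrow> 'n jet1) \<Rightarrow> ('n jet2 \<Rightarrow> 'n jet2) \<Rightarrow> bool"
  where "prolongation U X X2 \<longleftrightarrow>
    vector_field_on (jet2_over U) X2 \<and>
    (\<forall>w\<in>jet2_over U. fst (X2 w) = X (fst w)) \<and>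
    preserves (jet2_over U) contact2 X2"

text \<open>The PDE system is given as a submanifold \<open>E\<close> of the second jet space over \<open>U\<close>.\<close>

definition point_symmetries ::
  "'n::finite jet1 set \<Rightarrow> 'n jet2 set \<Rightarrow> ('n jet1 \<Rightarrow> 'n jet1) set"
  where "point_symmetries U E =
    {X. contact_vector_field U X \<and> preserves U vertical X \<and>
        (\<exists>X2. prolongation U X X2 \<and> (\<forall>w\<in>E. X2 w \<in> tangent_space E w))}"

definition flat_system :: "'n::finite jet1 set \<Rightarrow> 'n jet2 set"
  where "flat_system U = {w \<in> jet2_over U. \<forall>i j. snd w $ i $ j = 0}"

section \<open>Generating functions\<close>

definition d_u :: "('n::finite jet1 \<Rightarrow> complex) \<Rightarrow> 'n jet1 \<Rightarrow> complex"
  where "d_u f z = dir_deriv f z (0, 1, 0)"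

definition d_p :: "'n \<Rightarrow> ('n::finite jet1 \<Rightarrow> complex) \<Rightarrow> 'n jet1 \<Rightarrow> complex"
  where "d_p i f z = dir_deriv f z (0, 0, axis i 1)"

text \<open>\<open>d/dx\<^sup>i = \<partial>/\<partial>x\<^sup>i + u\<^sub>i \<partial>/\<partial>u\<close>\<close>

definition d_total :: "'n \<Rightarrow> ('n::finite jet1 \<Rightarrow> complex) \<Rightarrow> 'n jet1 \<Rightarrow> complex"
  where "d_total i f = (\<lambda>(x, u, p).
    dir_deriv f (x, u, p) (axis i 1, 0, 0) + p $ i * d_u f (x, u, p))"

text \<open>
  \<open>S\<^sub>f = - f\<^bsub>u\<^sub>i\<^esub> d/dx\<^sup>i + f \<partial>/\<partial>u + (df/dx\<^sup>i) \<partial>/\<partial>u\<^sub>i\<close>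
\<close>

definition generated_field :: "('n::finite jet1 \<Rightarrow> complex) \<Rightarrow> 'n jet1 \<Rightarrow> 'n jet1"
  where "generated_field f = (\<lambda>(x, u, p).
    (\<chi> i. - d_p i f (x, u, p),
     f (x, u, p) - (\<Sum>i\<in>UNIV. p $ i * d_p i f (x, u, p)),
     \<chi> i. d_total i f (x, u, p)))"

definition lagrange_bracket ::
  "('n::finite jet1 \<Rightarrow> complex) \<Rightarrow> ('n jet1 \<Rightarrow> complex) \<Rightarrow> 'n jet1 \<Rightarrow> complex"
  where "lagrange_bracket f g z =
    f z * d_u g z - g z * d_u f z +
    (\<Sum>i\<in>UNIV. d_total i f z * d_p i g z - d_total i g z * d_p i f z)"

definition Z_1 :: "'n::finite jet1 \<Rightarrow> complex"
  where "Z_1 = (\<lambda>(x, u, p). u)"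

definition Z_n1 :: "'n::finite jet1 \<Rightarrow> complex"
  where "Z_n1 = (\<lambda>(x, u, p). u - (\<Sum>i\<in>UNIV. x $ i * p $ i))"

definition Z :: "'n::finite jet1 \<Rightarrow> complex"
  where "Z = (\<lambda>(x, u, p). 2 * u - (\<Sum>i\<in>UNIV. x $ i * p $ i))"

definition generators :: "int \<Rightarrow> int \<Rightarrow> ('n::finite jet1 \<Rightarrow> complex) set"
  where "generators a b =
    (if (a, b) = (-1, -1) then {\<lambda>(x, u, p). 1}
     else if (a, b) = (-1, 0) then {\<lambda>(x, u, p). x $ i | i. True}
     else if (a, b) = (0, -1) then {\<lambda>(x, u, p). p $ i | i. True}
     else if (a, b) = (0, 0) then {Z} \<union> {\<lambda>(x, u, p). x $ i * p $ j | i j. True}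
     else if (a, b) = (1, 0) then {\<lambda>(x, u, p). u * p $ i | i. True}
     else if (a, b) = (0, 1) then
       {\<lambda>(x, u, p). x $ i * (u - (\<Sum>j\<in>UNIV. x $ j * p $ j)) | i. True}
     else if (a, b) = (1, 1) then {\<lambda>(x, u, p). u * (u - (\<Sum>j\<in>UNIV. x $ j * p $ j))}
     else {})"

definition bigraded_part :: "int \<Rightarrow> int \<Rightarrow> ('n::finite jet1 \<Rightarrow> complex) set"
  where "bigraded_part a b = cspan (generators a b)"

definition generator_span :: "('n::finite jet1 \<Rightarrow> complex) set"
  where "generator_span = cspan (\<Union>a b. generators a b)"

text \<open>The grading induced by \<open>Z\<close>, i.e.\ by the eigenvalues of the bracket with \<open>Z\<close>.\<close>

definition graded_part :: "int \<Rightarrow> ('n::finite jet1 \<Rightarrow> complex) set"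
  where "graded_part k = {g \<in> generator_span. lagrange_bracket Z g = of_int k *\<^sub>C g}"

end

theory Submission
  imports Defs "HOL-Complex_Analysis.Conformal_Mappings"
begin

text \<open>
  The solutions of \<open>u\<^sub>i\<^sub>j = 0\<close> are the affine functions, so the system describes the hyperplanes
  of projective space and its point symmetries are the projective vector fields. The proof makes
  this visible in coordinates. A first jet \<open>(x, u, p)\<close> is the point \<open>W = (1, x, u)\<close> together with the
  hyperplane \<open>L = (u - p \<cdot> x, p, - 1)\<close> through it, \<open>L \<cdot> W = 0\<close>. Up to sign, the listed generating
  functions other than \<open>Z\<close> are products \<open>L\<^sub>r W\<^sub>s\<close>, and \<open>Z\<close> is a combination of such products.
  Hence their span consists of the functions \<open>gen M = L M W\<close>. Only scalar matrices
  are mapped to 0, so \<open>gen\<close> is a bijection from the trace-free matrices onto the span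
  (\<open>generator_span_eq\<close>, \<open>gen_eq_zero_imp_zero\<close>).

  The total derivatives annihilate \<open>L\<close> and the derivatives by \<open>u\<^sub>i\<close> annihilate \<open>W\<close>. This turns the
  Lagrange bracket into the commutator (\<open>lagrange_bracket_gen\<close>). The vector field of \<open>gen M\<close> moves
  \<open>W\<close> by \<open>- M W\<close> modulo \<open>W\<close> and \<open>L\<close> by \<open>L M\<close> modulo \<open>L\<close>
  (\<open>d_point_vec_matrix_field\<close>, \<open>d_plane_vec_matrix_field\<close>), from which the bracket of two such fields,
  the invariance of the contact distributions and the prolongation all follow by linear algebra
  (\<open>vf_bracket_matrix_field\<close>, \<open>matrix_field_point_symmetry\<close>). The bigrading is the grading of matrix
  entries by the eigenvalues of the two diagonal matrices that represent \<open>Z_1\<close> and \<open>Z_n1\<close>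
  (\<open>bigrading_generators\<close>, \<open>graded_parts\<close>).

  Conversely, let \<open>X = (\<xi>, \<eta>, \<pi>)\<close> be a point symmetry and \<open>f = \<eta> - p \<cdot> \<xi>\<close>. Bracketing \<open>X\<close> and its
  prolongation with a few explicit sections shows that \<open>\<xi>\<close> and \<open>\<eta>\<close> are locally constant in \<open>p\<close>, that
  \<open>\<pi>\<^sub>i = df/dx\<^sup>i\<close>, and that the \<open>d\<pi>\<^sub>k/dx\<^sup>i\<close> vanish (\<open>point_symmetry_conditions\<close>). So, near a point
  \<open>(x0, u0, p0)\<close>, \<open>f\<close> is affine in \<open>p\<close> and on each hyperplane, \<open>f(x0 + s, u, p) = f(x0, c, p) + s \<cdot> \<pi>(x0, c, p)\<close> with
  \<open>c = u - p \<cdot> s\<close>. For fixed \<open>p\<close> the right side only involves holomorphic functions of the single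
  variable \<open>c\<close>. Replacing \<open>s\<close> by \<open>t s\<close> and comparing the coefficients of \<open>t\<close>, \<open>t\<^sup>2\<close>, \<open>t\<^sup>3\<close> with the fact
  that the left side is affine in \<open>p\<close> forces these functions to be polynomials of degree at most 2
  (\<open>scalar_rigidity\<close>), and \<open>f = gen M\<close> near every point (\<open>local_form\<close>). As a trace-free matrix is
  determined by its function on any nonempty open set, \<open>M\<close> is locally constant, and it is constant because \<open>U\<close> is
  connected (\<open>point_symmetry_global_form\<close>).
\<close>

section \<open>Complex differentiability and directional derivatives\<close>

text \<open>
  The complex bilinear pairing, as opposed to the real inner product of the library. It is real
  bounded bilinear, so the library's derivative rules for products apply to it.
\<close>

definition bil :: "complex ^ 'k::finite \<Rightarrow> complex ^ 'k \<Rightarrow> complex"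
  where "bil x y = (\<Sum>i\<in>UNIV. x $ i * y $ i)"

lemma bounded_bilinear_bil: "bounded_bilinear (bil :: complex ^ 'k::finite \<Rightarrow> _)"
  by (auto simp: bilinear_conv_bounded_bilinear[symmetric] bilinear_def bil_def sum.distrib
      algebra_simps scaleR_sum_right intro!: linearI)

interpretation bil: bounded_bilinear "bil :: complex ^ 'k::finite \<Rightarrow> _"
  by (rule bounded_bilinear_bil)

declare bil.zero_left [simp] bil.zero_right [simp]

lemma scaleC_vec_nth [simp]: "(c *\<^sub>C z) $ i = c *\<^sub>C (z $ i)"
  by (simp add: scaleC_vec_def)

lemma scaleC_complex [simp]: "c *\<^sub>C z = c * (z :: complex)"
  by (simp add: scaleC_complex_def)

lemma scaleC_Pair [simp]: "c *\<^sub>C (x, y) = (c *\<^sub>C x, c *\<^sub>C y)"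
  by (simp add: scaleC_prod_def)

lemma fst_scaleC [simp]: "fst (c *\<^sub>C x) = c *\<^sub>C fst x"
  and snd_scaleC [simp]: "snd (c *\<^sub>C x) = c *\<^sub>C snd x"
  by (simp_all add: scaleC_prod_def)

lemma scaleC_fun_apply [simp]: "(c *\<^sub>C f) z = c *\<^sub>C f z"
  by (simp add: scaleC_fun_def)

lemma bil_scaleC_left [simp]: "bil (c *\<^sub>C x) y = c * bil x y"
  and bil_scaleC_right [simp]: "bil x (c *\<^sub>C y) = c * bil x y"
  by (simp_all add: bil_def sum_distrib_left algebra_simps)

lemma bil_commute: "bil x y = bil y x"
  by (simp add: bil_def mult.commute)

lemma bil_axis [simp]: "bil (axis i c) y = c * y $ i" "bil y (axis i c) = y $ i * c"
  by (simp_all add: bil_def axis_def if_distrib[of "\<lambda>a. a * _"] if_distrib[of "(*) _"] cong: if_cong)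

lemma norm_axis: "norm (axis i x :: 'b::real_normed_vector ^ 'k::finite) = norm x"
  by (simp add: norm_vec_def L2_set_def axis_def if_distrib[of norm] if_distrib[of "\<lambda>a. a\<^sup>2"] cong: if_cong)

lemma has_derivative_vecI:
  assumes "\<And>i. ((\<lambda>z. f z $ i) has_derivative (\<lambda>h. f' h $ i)) F"
  shows "(f has_derivative (f' :: 'a::real_normed_vector \<Rightarrow> 'b::real_normed_vector ^ 'k::finite)) F"
proof -
  have bl: "bounded_linear (axis i :: 'b \<Rightarrow> 'b ^ 'k)" for i
  proof (rule bounded_linear_intro)
    show "norm (axis i x :: 'b ^ 'k) \<le> norm x * 1" for x :: 'b
      by (simp add: norm_axis)
  qed (auto simp: axis_def vec_eq_iff)
  have dec: "v = (\<Sum>i\<in>UNIV. axis i (v $ i))" for v :: "'b ^ 'k"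
    by (simp add: vec_eq_iff axis_def if_distrib cong: if_cong)
  have "((\<lambda>z. \<Sum>i\<in>UNIV. axis i (f z $ i)) has_derivative (\<lambda>h. \<Sum>i\<in>UNIV. axis i (f' h $ i))) F"
    by (intro has_derivative_sum bounded_linear.has_derivative[OF bl] assms)
  then show ?thesis
    by (simp flip: dec)
qed

text \<open>
  Holomorphy at one point. With closure under ring operations, vectors and pairs, polynomial fields
  are holomorphic by inspection of their components.
\<close>

definition cdiff :: "('a::{real_normed_vector,complex_vector} \<Rightarrow> 'b::{real_normed_vector,complex_vector}) \<Rightarrow> 'a \<Rightarrow> 'a set \<Rightarrow> bool"
  where "cdiff F w M \<longleftrightarrow> (\<exists>F'. (F has_derivative F') (at w within M) \<and> (\<forall>c v. F' (c *\<^sub>C v) = c *\<^sub>C F' v))"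

lemma cdiffI:
  "(F has_derivative F') (at w within M) \<Longrightarrow> (\<And>c v. F' (c *\<^sub>C v) = c *\<^sub>C F' v) \<Longrightarrow> cdiff F w M"
  by (auto simp: cdiff_def)

lemma cdiff_const: "cdiff (\<lambda>_. c) w M"
  by (rule cdiffI[where F' = "\<lambda>_. 0"]) auto

lemma cdiff_linear:
  assumes "bounded_linear F" "\<And>c v. F (c *\<^sub>C v) = c *\<^sub>C F v"
  shows "cdiff F w M"
  using assms by (auto intro!: cdiffI bounded_linear_imp_has_derivative)

lemma cdiff_add: "cdiff F w M \<Longrightarrow> cdiff G w M \<Longrightarrow> cdiff (\<lambda>z. F z + G z) w M"
  by (unfold cdiff_def, (elim exE conjE), rule exI, rule conjI, erule (1) has_derivative_add)
     (simp add: scaleC_add_right)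

lemma cdiff_mult:
  fixes F G :: "'a::{real_normed_vector,complex_vector} \<Rightarrow> complex"
  shows "cdiff F w M \<Longrightarrow> cdiff G w M \<Longrightarrow> cdiff (\<lambda>z. F z * G z) w M"
  by (unfold cdiff_def, (elim exE conjE), rule exI, rule conjI, erule (1) has_derivative_mult)
     (simp add: algebra_simps)

lemma cdiff_minus:
  fixes F :: "'a::{real_normed_vector,complex_vector} \<Rightarrow> complex"
  shows "cdiff F w M \<Longrightarrow> cdiff (\<lambda>z. - F z) w M"
  using cdiff_mult[OF cdiff_const[of "-1"], of F] by simp

lemma cdiff_diff:
  fixes F :: "'a::{real_normed_vector,complex_vector} \<Rightarrow> complex"
  shows "cdiff F w M \<Longrightarrow> cdiff G w M \<Longrightarrow> cdiff (\<lambda>z. F z - G z) w M"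
  using cdiff_add[OF _ cdiff_minus, of F _ _ G] by simp

lemma cdiff_sum:
  assumes "\<And>i. i \<in> I \<Longrightarrow> cdiff (F i) w M"
  shows "cdiff (\<lambda>z. \<Sum>i\<in>I. F i z) w M"
  using assms by (induction I rule: infinite_finite_induct) (auto intro: cdiff_const cdiff_add)

lemma cdiff_vec:
  assumes "\<And>i. cdiff (\<lambda>z. F z $ i) w M"
  shows "cdiff (F :: _ \<Rightarrow> 'b::{real_normed_vector,complex_vector} ^ 'k::finite) w M"
proof -
  obtain D where D: "\<And>i. ((\<lambda>z. F z $ i) has_derivative D i) (at w within M)"
      "\<And>i c v. D i (c *\<^sub>C v) = c *\<^sub>C D i v"
    using assms unfolding cdiff_def by metis
  show ?thesis
    by (rule cdiffI[where F' = "\<lambda>v. \<chi> i. D i v"], rule has_derivative_vecI)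
       (use D in \<open>auto simp: vec_eq_iff\<close>)
qed

lemma cdiff_Pair: "cdiff F w M \<Longrightarrow> cdiff G w M \<Longrightarrow> cdiff (\<lambda>z. (F z, G z)) w M"
  by (unfold cdiff_def, (elim exE conjE), rule exI, rule conjI, erule (1) has_derivative_Pair) simp

lemma holomorphic_map_on_iff_cdiff: "holomorphic_map_on F M \<longleftrightarrow> (\<forall>w\<in>M. cdiff F w M)"
  by (simp add: holomorphic_map_on_def cdiff_def)

lemma dir_deriv_eqI: "((\<lambda>t. F (z + t *\<^sub>R v)) has_vector_derivative d) (at 0) \<Longrightarrow> dir_deriv F z v = d"
  by (simp add: dir_deriv_def vector_derivative_at)

text \<open>
  On a manifold the derivative is only taken within \<open>M\<close>, but it can be evaluated in a direction
  \<open>v\<close> as soon as the line through \<open>w\<close> in that direction stays in \<open>M\<close> for a short time. This holds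
  for all directions that occur below, because the manifolds are relatively open in linear spaces.
\<close>

lemma line_has_vector_derivative:
  assumes F: "(F has_derivative F') (at w within M)" and M: "\<forall>\<^sub>F t in nhds (0::real). w + t *\<^sub>R v \<in> M"
  shows "((\<lambda>t. F (w + t *\<^sub>R v)) has_vector_derivative F' v) (at 0)"
proof -
  obtain S where S: "open S" "0 \<in> S" "\<And>t. t \<in> S \<Longrightarrow> w + t *\<^sub>R v \<in> M"
    using M by (auto simp: eventually_nhds)
  have "((\<lambda>t::real. w + t *\<^sub>R v) has_derivative (\<lambda>t. t *\<^sub>R v)) (at 0 within S)"
    by (auto intro!: derivative_eq_intros)
  moreover have "(F has_derivative F') (at (w + 0 *\<^sub>R v) within (\<lambda>t::real. w + t *\<^sub>R v) ` S)"
    using has_derivative_subset[OF F, of "(\<lambda>t::real. w + t *\<^sub>R v) ` S"] S by auto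
  ultimately have "((\<lambda>t. F (w + t *\<^sub>R v)) has_derivative (\<lambda>t. F' (t *\<^sub>R v))) (at 0 within S)"
    by (rule has_derivative_in_compose)
  moreover have "F' (t *\<^sub>R v) = t *\<^sub>R F' v" for t
    using has_derivative_bounded_linear[OF F] by (simp add: bounded_linear.linear linear_scale)
  ultimately show ?thesis
    using S by (simp add: has_vector_derivative_def at_within_open[of 0 S])
qed

lemma dir_deriv_eq:
  assumes "(F has_derivative F') (at w within M)" "\<forall>\<^sub>F t in nhds (0::real). w + t *\<^sub>R v \<in> M"
  shows "dir_deriv F w v = F' v"
  using dir_deriv_eqI line_has_vector_derivative[OF assms] by blast

lemma eventually_line_in_open:
  fixes w :: "'a::real_normed_vector"
  assumes "open U" "w \<in> U" shows "\<forall>\<^sub>F t in nhds (0::real). w + t *\<^sub>R v \<in> U"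
proof -
  have "open ((\<lambda>t::real. w + t *\<^sub>R v) -` U)"
    by (intro open_vimage assms continuous_intros)
  then show ?thesis
    using assms(2) by (auto simp: eventually_nhds)
qed

lemma has_vector_derivative_eventually_zero:
  assumes "(g has_vector_derivative d) (at (0::real))" "\<forall>\<^sub>F t in nhds 0. g t = 0"
  shows "d = 0"
proof -
  have "((\<lambda>_. 0) has_derivative (\<lambda>x. x *\<^sub>R d)) (at (0::real))"
  proof (rule has_derivative_transform_eventually)
    show "(g has_derivative (\<lambda>x. x *\<^sub>R d)) (at 0)"
      using assms(1) by (simp add: has_vector_derivative_def)
    show "\<forall>\<^sub>F x in at 0. g x = 0"
      using assms(2) by (simp add: eventually_at_filter eventually_mono)
    show "g 0 = 0"
      using assms(2) by (rule eventually_nhds_x_imp_x)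
  qed simp
  then have "((\<lambda>_. 0) has_vector_derivative d) (at (0::real))"
    by (simp add: has_vector_derivative_def)
  then show ?thesis
    using vector_derivative_unique_at has_vector_derivative_const by blast
qed

section \<open>Generating functions attached to matrices\<close>

text \<open>
  Homogeneous coordinates. The index type has \<open>Inr 1\<close> for the homogenising coordinate, \<open>Inl i\<close> for
  \<open>x\<^sup>i\<close> and \<open>Inr 2\<close> for \<open>u\<close>. The vector \<open>plane_vec\<close> holds the coefficients of the equation of the
  hyperplane with slopes \<open>p\<close> through the point \<open>(x, u)\<close>, normalised to coefficient \<open>- 1\<close> at \<open>u\<close>.
\<close>

definition point_vec :: "'n::finite jet1 \<Rightarrow> complex ^ ('n + 2)"
  where "point_vec = (\<lambda>(x, u, p). \<chi> r. case r of Inl i \<Rightarrow> x $ i | Inr k \<Rightarrow> if k = 1 then 1 else u)"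

definition plane_vec :: "'n::finite jet1 \<Rightarrow> complex ^ ('n + 2)"
  where "plane_vec = (\<lambda>(x, u, p). \<chi> r. case r of Inl i \<Rightarrow> p $ i | Inr k \<Rightarrow> if k = 1 then u - bil p x else - 1)"

definition d_point_vec :: "'n::finite jet1 \<Rightarrow> complex ^ ('n + 2)"
  where "d_point_vec = (\<lambda>(\<xi>, \<eta>, \<pi>). \<chi> r. case r of Inl i \<Rightarrow> \<xi> $ i | Inr k \<Rightarrow> if k = 1 then 0 else \<eta>)"

definition d_plane_vec :: "'n::finite jet1 \<Rightarrow> 'n jet1 \<Rightarrow> complex ^ ('n + 2)"
  where "d_plane_vec = (\<lambda>(x, u, p) (\<xi>, \<eta>, \<pi>). \<chi> r. case r of Inl i \<Rightarrow> \<pi> $ i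
     | Inr k \<Rightarrow> if k = 1 then \<eta> - (bil p \<xi> + bil \<pi> x) else 0)"

definition gen :: "complex ^ ('n + 2) ^ ('n + 2) \<Rightarrow> 'n::finite jet1 \<Rightarrow> complex"
  where "gen M z = bil (plane_vec z) (M *v point_vec z)"

lemma two_neq_one [simp]: "(2::2) \<noteq> 1" "(1::2) \<noteq> 2"
  by simp_all

lemma point_vec_nth [simp]: "point_vec (x, u, p) $ Inl i = x $ i" "point_vec (x, u, p) $ Inr 1 = 1" "point_vec (x, u, p) $ Inr 2 = u"
  by (simp_all add: point_vec_def)

lemma plane_vec_nth [simp]: "plane_vec (x, u, p) $ Inl i = p $ i" "plane_vec (x, u, p) $ Inr 1 = u - bil p x" "plane_vec (x, u, p) $ Inr 2 = - 1"
  by (simp_all add: plane_vec_def)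

lemma d_point_vec_nth [simp]: "d_point_vec (x, u, p) $ Inl i = x $ i" "d_point_vec (x, u, p) $ Inr 1 = 0" "d_point_vec (x, u, p) $ Inr 2 = u"
  by (simp_all add: d_point_vec_def)

lemma d_plane_vec_nth [simp]: "d_plane_vec (x, u, p) (\<xi>, \<eta>, \<pi>) $ Inl i = \<pi> $ i"
  "d_plane_vec (x, u, p) (\<xi>, \<eta>, \<pi>) $ Inr 1 = \<eta> - (bil p \<xi> + bil \<pi> x)" "d_plane_vec (x, u, p) (\<xi>, \<eta>, \<pi>) $ Inr 2 = 0"
  by (simp_all add: d_plane_vec_def)

text \<open>
  The numeral 2 denotes 0 in the two-element type, so \<open>Inr 1\<close> and \<open>Inr 2\<close> are its two indices.
\<close>

lemma all_index: "(\<forall>r :: 'n + 2. P r) \<longleftrightarrow> P (Inr 1) \<and> (\<forall>i. P (Inl i)) \<and> P (Inr 2)"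
  by (metis exhaust_2 sum.exhaust)

lemma sum_index: "(\<Sum>r\<in>UNIV. g r) = g (Inr 1) + (\<Sum>i\<in>UNIV. g (Inl i)) + g (Inr 2 :: 'n::finite + 2)"
  for g :: "_ \<Rightarrow> 'a::comm_monoid_add"
  by (subst UNIV_Plus_UNIV[symmetric], subst sum.Plus) (simp_all add: sum_2 algebra_simps)

definition middle :: "'a ^ ('n::finite + 2) \<Rightarrow> 'a ^ 'n"
  where "middle a = (\<chi> i. a $ Inl i)"

lemma middle_nth [simp]: "middle a $ i = a $ Inl i"
  by (simp add: middle_def)

lemma middle_simps [simp]: "middle (point_vec (x, u, p)) = x" "middle (plane_vec (x, u, p)) = p"
  "middle (d_point_vec (x, u, p)) = x" "middle (d_plane_vec z (x, u, p)) = p"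
  by (cases z; simp add: vec_eq_iff)+

lemma bil_index: "bil a b = a $ Inr 1 * b $ Inr 1 + bil (middle a) (middle b) + a $ Inr 2 * b $ Inr (2::2)"
  for a :: "complex ^ ('n::finite + 2)"
  by (simp add: bil_def sum_index)

lemma vec_index_eqI:
  "a $ Inr 1 = b $ Inr 1 \<Longrightarrow> (\<And>i. a $ Inl i = b $ Inl i) \<Longrightarrow> a $ Inr 2 = b $ Inr 2 \<Longrightarrow> a = b"
  for a :: "'a ^ ('n::finite + 2)"
  by (simp add: vec_eq_iff all_index)

lemma bounded_linear_d_point_vec: "bounded_linear d_point_vec"
  unfolding linear_conv_bounded_linear[symmetric]
  by (rule linearI) (auto intro!: vec_index_eqI)

lemma bounded_linear_d_plane_vec: "bounded_linear (d_plane_vec z)"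
  unfolding linear_conv_bounded_linear[symmetric]
  by (cases z, rule linearI) (auto intro!: vec_index_eqI simp: bil.add_left bil.add_right bil.scaleR_left bil.scaleR_right algebra_simps)

lemma d_point_vec_scaleC [simp]: "d_point_vec (c *\<^sub>C v) = c *\<^sub>C d_point_vec v"
  by (cases v) (auto intro!: vec_index_eqI)

lemma d_plane_vec_scaleC [simp]: "d_plane_vec z (c *\<^sub>C v) = c *\<^sub>C d_plane_vec z v"
  by (cases z; cases v) (auto intro!: vec_index_eqI simp: algebra_simps)

lemma point_vec_has_derivative: "(point_vec has_derivative d_point_vec) (at z within S)"
proof -
  have eq: "point_vec = (\<lambda>z. point_vec 0 + d_point_vec z)"
    by (auto simp: fun_eq_iff zero_prod_def intro!: vec_index_eqI)
  have "((\<lambda>z. point_vec 0 + d_point_vec z) has_derivative d_point_vec) (at z within S)"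
    using bounded_linear_imp_has_derivative[OF bounded_linear_d_point_vec] by (auto intro!: derivative_eq_intros)
  then show ?thesis by (simp only: eq[symmetric])
qed

lemma plane_vec_has_derivative: "(plane_vec has_derivative d_plane_vec z) (at z within S)"
proof (rule has_derivative_vecI)
  fix r :: "'a + 2"
  have p: "((\<lambda>z. snd (snd z) $ i) has_derivative (\<lambda>h. snd (snd h) $ i)) (at z within S)" for i and z :: "'a jet1"
    by (intro bounded_linear_imp_has_derivative bounded_linear_compose[OF bounded_linear_vec_nth]
        bounded_linear_compose[OF bounded_linear_snd] bounded_linear_snd)
  have b: "((\<lambda>z. fst (snd z) - bil (snd (snd z)) (fst z)) has_derivative
      (\<lambda>h. fst (snd h) - (bil (snd (snd z)) (fst h) + bil (snd (snd h)) (fst z)))) (at z within S)" for z :: "'a jet1"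
    by (auto intro!: derivative_eq_intros bil.FDERIV)
  have "\<forall>r. ((\<lambda>z. plane_vec z $ r) has_derivative (\<lambda>h. d_plane_vec z h $ r)) (at z within S)"
    unfolding all_index using p[of _ z] b[of z] by (simp add: plane_vec_def d_plane_vec_def case_prod_beta)
  then show "((\<lambda>z. plane_vec z $ r) has_derivative (\<lambda>h. d_plane_vec z h $ r)) (at z within S)" by blast
qed

lemma bil_plane_point [simp]: "bil (plane_vec z) (point_vec z) = 0"
  by (cases z) (simp add: bil_index)

lemma bil_plane_d_point: "bil (plane_vec (x, u, p)) (d_point_vec (\<xi>, \<eta>, \<pi>)) = bil p \<xi> - \<eta>"
  by (simp add: bil_index)

lemma bil_matrix: "bil a (M *v b) = bil (a v* M) b"
  unfolding bil_def matrix_vector_mult_def vector_matrix_mult_def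
  by (simp add: sum_distrib_left sum_distrib_right mult.assoc mult.left_commute) (subst sum.swap, simp add: mult_ac)

lemma gen_has_derivative:
  "(gen M has_derivative (\<lambda>v. bil (d_plane_vec z v) (M *v point_vec z) + bil (plane_vec z) (M *v d_point_vec v))) (at z within S)"
proof -
  have "((\<lambda>z. M *v point_vec z) has_derivative (\<lambda>v. M *v d_point_vec v)) (at z within S)"
    by (rule bounded_linear.has_derivative[OF matrix_vector_mul_bounded_linear point_vec_has_derivative])
  from bil.FDERIV[OF plane_vec_has_derivative this] show ?thesis
    unfolding gen_def by (simp add: add.commute)
qed

lemma dir_deriv_gen: "dir_deriv (gen M) z v = bil (d_plane_vec z v) (M *v point_vec z) + bil (plane_vec z) (M *v d_point_vec v)"
  using dir_deriv_eq[OF gen_has_derivative[of M z UNIV]] by simp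

text \<open>
  The \<open>u\<^sub>i\<close>-derivative acts on \<open>L\<close> only, with \<open>\<partial>L/\<partial>u\<^sub>i = (- x\<^sup>i, e\<^sub>i, 0)\<close>.
\<close>

lemma d_p_gen: "d_p i (gen M) (x, u, p) = (M *v point_vec (x, u, p)) $ Inl i - x $ i * (M *v point_vec (x, u, p)) $ Inr 1"
proof -
  have "d_point_vec (0, 0, axis i 1) = 0"
    by (simp add: vec_index_eqI)
  then show ?thesis
    by (simp add: d_p_def dir_deriv_gen matrix_vector_mult_0_right bil_index[of "d_plane_vec _ _"])
qed

lemma d_u_gen: "d_u (gen M) z = (M *v point_vec z) $ Inr 1 + (plane_vec z v* M) $ Inr 2"
proof -
  have "bil a (d_point_vec (0, 1, 0)) = a $ Inr 2" for a :: "complex ^ ('a + 2)"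
    by (simp add: bil_index bil.zero_right)
  moreover have "bil (d_plane_vec z (0, 1, 0)) b = b $ Inr 1" for b
    by (cases z) (simp add: bil_index bil.zero_left bil.zero_right)
  ultimately show ?thesis
    by (simp add: d_u_def dir_deriv_gen bil_matrix[of "plane_vec z"])
qed

text \<open>
  The total derivative acts on \<open>W\<close> only, with \<open>dW/dx\<^sup>i = (0, e\<^sub>i, u\<^sub>i)\<close>: the contributions to
  \<open>u - p \<cdot> x\<close> cancel.
\<close>

lemma d_total_gen: "d_total i (gen M) (x, u, p) = (plane_vec (x, u, p) v* M) $ Inl i + p $ i * (plane_vec (x, u, p) v* M) $ Inr 2"
proof -
  have "bil a (d_point_vec (axis i 1, 0, 0)) = a $ Inl i" for a :: "complex ^ ('a + 2)"
    by (simp add: bil_index)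
  moreover have "bil (d_plane_vec (x, u, p) (axis i 1, 0, 0)) b = - p $ i * b $ Inr 1" for b
    by (simp add: bil_index bil.zero_left bil.zero_right)
  ultimately show ?thesis
    by (simp add: d_total_def d_u_gen dir_deriv_gen bil_matrix[of "plane_vec (x, u, p)"] algebra_simps)
qed

text \<open>
  The velocities of \<open>W\<close> and \<open>L\<close> under the flow of a matrix: the linear flows \<open>- M W\<close> and \<open>L M\<close>,
  corrected by multiples of \<open>W\<close> and \<open>L\<close> that keep the normalisations \<open>W\<^sub>1 = 1\<close> and \<open>L\<^sub>u = - 1\<close>.
\<close>

definition point_velocity :: "complex ^ ('n + 2) ^ ('n + 2) \<Rightarrow> 'n::finite jet1 \<Rightarrow> complex ^ ('n + 2)"
  where "point_velocity M z = (M *v point_vec z) $ Inr 1 *\<^sub>C point_vec z - M *v point_vec z"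

definition plane_velocity :: "complex ^ ('n + 2) ^ ('n + 2) \<Rightarrow> 'n::finite jet1 \<Rightarrow> complex ^ ('n + 2)"
  where "plane_velocity M z = plane_vec z v* M + (plane_vec z v* M) $ Inr 2 *\<^sub>C plane_vec z"

definition matrix_field :: "complex ^ ('n + 2) ^ ('n + 2) \<Rightarrow> 'n::finite jet1 \<Rightarrow> 'n jet1"
  where "matrix_field M z = (middle (point_velocity M z), point_velocity M z $ Inr 2, middle (plane_velocity M z))"

lemma generated_field_gen: "generated_field (gen M) = matrix_field M"
proof
  fix z :: "'a jet1" obtain x u p where z: "z = (x, u, p)" by (cases z)
  let ?b = "M *v point_vec (x, u, p)"
  have "(\<Sum>i\<in>UNIV. p $ i * (?b $ Inl i - x $ i * ?b $ Inr 1)) = bil p (middle ?b) - bil p x * ?b $ Inr 1"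
    by (simp add: bil_def algebra_simps sum_subtractf sum_distrib_left sum_distrib_right)
  then show "generated_field (gen M) z = matrix_field M z"
    by (simp add: z generated_field_def matrix_field_def d_p_gen d_total_gen point_velocity_def plane_velocity_def gen_def vec_eq_iff
        bil_index[of "plane_vec _"] algebra_simps)
qed

lemma d_point_vec_matrix_field: "d_point_vec (matrix_field M z) = point_velocity M z"
  by (cases z) (auto simp: matrix_field_def point_velocity_def intro!: vec_index_eqI)

text \<open>
  All entries but the first agree by the definition of the field. The first one is then determined by
  differentiating \<open>L \<cdot> W = 0\<close>, that is, by \<open>(L M) \<cdot> W = L \<cdot> (M W)\<close>.
\<close>

lemma d_plane_vec_matrix_field: "d_plane_vec z (matrix_field M z) = plane_velocity M z"
proof (cases z)
  case (fields x u p)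
  let ?a = "plane_vec z v* M" and ?b = "M *v point_vec z"
  have m: "middle (c *\<^sub>C v - w) = c *\<^sub>C middle v - middle w" "middle (v + c *\<^sub>C w) = middle v + c *\<^sub>C middle w"
    for c and v w :: "complex ^ ('a + 2)"
    by (simp_all add: vec_eq_iff)
  have "bil ?a (point_vec z) = bil (plane_vec z) ?b" by (simp add: bil_matrix)
  then have "?a $ Inr 1 + bil (middle ?a) x + ?a $ Inr 2 * u = (u - bil p x) * ?b $ Inr 1 + bil p (middle ?b) - ?b $ Inr 2"
    by (simp add: fields bil_index)
  then have "point_velocity M z $ Inr 2 - (bil p (middle (point_velocity M z)) + bil (middle (plane_velocity M z)) x) = plane_velocity M z $ Inr 1"
    by (simp add: point_velocity_def plane_velocity_def fields m bil.diff_right bil.add_left algebra_simps)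
  then show ?thesis
    unfolding fields by (intro vec_index_eqI) (simp_all add: matrix_field_def plane_velocity_def)
qed

lemma matrix_commutator_vec: "commutator M N *v w = M *v (N *v w) - N *v (M *v w)"
  by (simp add: commutator_def matrix_vector_mult_diff_rdistrib matrix_vector_mul_assoc)

lemma vec_commutator_matrix: fixes l :: "complex ^ 'a::finite" shows "l v* commutator M N = l v* M v* N - l v* N v* M"
proof -
  have "l v* (A - B) = l v* A - l v* B" for A B :: "complex ^ 'a ^ 'a"
    by (simp add: vec_eq_iff vector_matrix_mult_def algebra_simps sum_subtractf)
  then show ?thesis
    by (simp add: commutator_def vector_matrix_mul_assoc)
qed

text \<open>
  Put \<open>a = L M\<close> and \<open>b = N W\<close>. The sum \<open>\<Sum>\<^sub>i (df/dx\<^sup>i) g\<^bsub>u\<^sub>i\<^esub>\<close> pairs \<open>a\<close> and \<open>b\<close> through the matrix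
  \<open>\<Sum>\<^sub>i (dW/dx\<^sup>i) (\<partial>L/\<partial>u\<^sub>i)\<close>, which is the identity up to two rank-one terms built from \<open>W\<close> and \<open>L\<close>. The
  identity yields the commutator, the rank-one terms cancel against \<open>f g\<^sub>u - g f\<^sub>u\<close>.
\<close>

lemma lagrange_bracket_gen: "lagrange_bracket (gen M) (gen N) = gen (commutator M N)"
proof
  fix z :: "'a jet1" obtain x u p where z: "z = (x, u, p)" by (cases z)
  \<comment> \<open>The identity matrix contributes \<open>bil a b\<close>, the rank-one terms the two other summands.\<close>
  have key: "(\<Sum>i\<in>UNIV. (a $ Inl i + p $ i * a $ Inr 2) * (b $ Inl i - x $ i * b $ Inr 1))
     = bil a b - b $ Inr 1 * bil a (point_vec z) + a $ Inr 2 * bil (plane_vec z) b" for a b :: "complex ^ ('a + 2)"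
  proof -
    have "(\<Sum>i\<in>UNIV. (a $ Inl i + p $ i * a $ Inr 2) * (b $ Inl i - x $ i * b $ Inr 1))
      = bil (middle a) (middle b) - bil (middle a) x * b $ Inr 1 + a $ Inr 2 * bil p (middle b) - a $ Inr 2 * bil p x * b $ Inr 1"
      by (simp add: bil_def algebra_simps sum_subtractf sum.distrib sum_distrib_left)
    then show ?thesis
      by (simp add: z bil_index algebra_simps)
  qed
  let ?a = "\<lambda>M. plane_vec z v* M" and ?b = "\<lambda>M. M *v point_vec z"
  have com: "gen (commutator M N) z = bil (?a M) (?b N) - bil (?a N) (?b M)"
    by (simp add: gen_def matrix_commutator_vec bil.diff_right bil_matrix)
  have "lagrange_bracket (gen M) (gen N) z =
     gen M z * (?b N $ Inr 1 + ?a N $ Inr 2) - gen N z * (?b M $ Inr 1 + ?a M $ Inr 2)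
     + ((\<Sum>i\<in>UNIV. (?a M $ Inl i + p $ i * ?a M $ Inr 2) * (?b N $ Inl i - x $ i * ?b N $ Inr 1))
       - (\<Sum>i\<in>UNIV. (?a N $ Inl i + p $ i * ?a N $ Inr 2) * (?b M $ Inl i - x $ i * ?b M $ Inr 1)))"
    by (simp add: z lagrange_bracket_def d_u_gen d_total_gen d_p_gen sum_subtractf)
  moreover have "gen A z = bil (plane_vec z) (?b A)" "gen A z = bil (?a A) (point_vec z)" for A
    by (simp_all add: gen_def bil_matrix)
  ultimately have "lagrange_bracket (gen M) (gen N) z = bil (?a M) (?b N) - bil (?a N) (?b M)"
    unfolding key by (simp add: algebra_simps)
  with com show "lagrange_bracket (gen M) (gen N) z = gen (commutator M N) z"
    by simp
qed

section \<open>Transport of Lie algebra structures\<close>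

text \<open>
  The image of a Lie algebra under an injective map that respects the operations inherits all
  axioms. Thus the axioms have to be checked for trace-free matrices only, not for generating functions or
  vector fields.
\<close>

lemma lie_isomorphism_image:
  assumes L: "lie_algebra brL L" and inj: "inj_on \<phi> L"
    and add: "\<And>x y. x \<in> L \<Longrightarrow> y \<in> L \<Longrightarrow> \<phi> (x + y) = \<phi> x + \<phi> y"
    and scale: "\<And>c x. x \<in> L \<Longrightarrow> \<phi> (c *\<^sub>C x) = c *\<^sub>C \<phi> x"
    and br: "\<And>x y. x \<in> L \<Longrightarrow> y \<in> L \<Longrightarrow> \<phi> (brL x y) = brM (\<phi> x) (\<phi> y)"
  shows "lie_isomorphism brL L brM (\<phi> ` L) \<phi>"
proof -
  note L' = L[unfolded lie_algebra_def complex_vector.subspace_def]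
  have z: "0 \<in> L" "\<phi> 0 = 0"
    using L' scale[of 0 0] by auto
  have mem: "\<And>x y. x \<in> L \<Longrightarrow> y \<in> L \<Longrightarrow> x + y \<in> L" "\<And>c x. x \<in> L \<Longrightarrow> c *\<^sub>C x \<in> L"
    "\<And>x y. x \<in> L \<Longrightarrow> y \<in> L \<Longrightarrow> brL x y \<in> L"
    using L' by blast+
  have "lie_algebra brM (\<phi> ` L)"
    unfolding lie_algebra_def complex_vector.subspace_def
  proof (intro conjI)
    show "0 \<in> \<phi> ` L" using z by (metis imageI)
    show "\<forall>x\<in>\<phi> ` L. \<forall>y\<in>\<phi> ` L. x + y \<in> \<phi> ` L"
      by (auto simp: add[symmetric] mem)
    show "\<forall>c. \<forall>x\<in>\<phi> ` L. c *\<^sub>C x \<in> \<phi> ` L"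
      by (auto simp: scale[symmetric] mem)
    show "\<forall>x\<in>\<phi> ` L. \<forall>y\<in>\<phi> ` L. brM x y \<in> \<phi> ` L"
      by (auto simp: br[symmetric] mem)
    show "\<forall>x\<in>\<phi> ` L. \<forall>y\<in>\<phi> ` L. \<forall>z\<in>\<phi> ` L. brM (x + y) z = brM x z + brM y z \<and> brM z (x + y) = brM z x + brM z y"
      using L' by (simp add: add[symmetric] br[symmetric] mem)
    show "\<forall>c. \<forall>x\<in>\<phi> ` L. \<forall>y\<in>\<phi> ` L. brM (c *\<^sub>C x) y = c *\<^sub>C brM x y \<and> brM x (c *\<^sub>C y) = c *\<^sub>C brM x y"
      using L' by (simp add: scale[symmetric] br[symmetric] mem)
    show "\<forall>x\<in>\<phi> ` L. brM x x = 0"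
      using L' by (auto simp: br[symmetric] z)
    show "\<forall>x\<in>\<phi> ` L. \<forall>y\<in>\<phi> ` L. \<forall>z\<in>\<phi> ` L. brM x (brM y z) + brM y (brM z x) + brM z (brM x y) = 0"
      using L' by (simp add: add[symmetric] br[symmetric] mem z)
  qed
  then show ?thesis
    using assms by (auto simp: lie_isomorphism_def bij_betw_def)
qed

lemma lie_isomorphism_inv:
  assumes "lie_isomorphism brL L brM M \<phi>"
  shows "lie_isomorphism brM M brL L (inv_into L \<phi>)"
proof -
  have L: "lie_algebra brL L" "lie_algebra brM M" and bij: "bij_betw \<phi> L M"
    and hom: "\<And>x y. x \<in> L \<Longrightarrow> y \<in> L \<Longrightarrow> \<phi> (x + y) = \<phi> x + \<phi> y" "\<And>c x. x \<in> L \<Longrightarrow> \<phi> (c *\<^sub>C x) = c *\<^sub>C \<phi> x"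
    "\<And>x y. x \<in> L \<Longrightarrow> y \<in> L \<Longrightarrow> \<phi> (brL x y) = brM (\<phi> x) (\<phi> y)"
    using assms by (auto simp: lie_isomorphism_def)
  have M: "M = \<phi> ` L" and inj: "inj_on \<phi> L"
    using bij by (auto simp: bij_betw_def)
  have mem: "\<And>x y. x \<in> L \<Longrightarrow> y \<in> L \<Longrightarrow> x + y \<in> L" "\<And>c x. x \<in> L \<Longrightarrow> c *\<^sub>C x \<in> L"
    "\<And>x y. x \<in> L \<Longrightarrow> y \<in> L \<Longrightarrow> brL x y \<in> L"
    using L(1)[unfolded lie_algebra_def complex_vector.subspace_def] by blast+
  have inv: "inv_into L \<phi> (\<phi> x) = x" if "x \<in> L" for x
    using inj that by simp
  show ?thesis
    unfolding lie_isomorphism_def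
  proof (intro conjI)
    show "bij_betw (inv_into L \<phi>) M L" using bij by (rule bij_betw_inv_into)
  qed (use L in \<open>auto simp: M hom[symmetric] inv mem\<close>)
qed

lemma commutator_nth: "commutator A B $ r $ s = (\<Sum>k\<in>UNIV. A $ r $ k * B $ k $ s) - (\<Sum>k\<in>UNIV. B $ r $ k * A $ k $ s)"
  by (simp add: commutator_def matrix_matrix_mult_def)

lemma subspace_special_linear: "complex_vector.subspace special_linear"
  by (auto simp: complex_vector.subspace_def special_linear_def trace_def sum.distrib sum_distrib_left[symmetric])

lemma lie_algebra_special_linear: "lie_algebra commutator (special_linear :: (complex ^ 'm::finite ^ 'm) set)"
  unfolding lie_algebra_def
proof (intro conjI ballI allI)
  have distrib: "(A + B) ** C = A ** C + B ** C" "C ** (A + B) = C ** A + C ** B" for A B C :: "complex ^ 'm ^ 'm"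
    by (simp_all add: vec_eq_iff matrix_matrix_mult_def algebra_simps sum.distrib)
  have sc: "(c *\<^sub>C A) ** B = c *\<^sub>C (A ** B)" "A ** (c *\<^sub>C B) = c *\<^sub>C (A ** B)" for c and A B :: "complex ^ 'm ^ 'm"
    by (simp_all add: vec_eq_iff matrix_matrix_mult_def sum_distrib_left mult_ac)
  have dl: "(A - B) ** C = A ** C - B ** C" "C ** (A - B) = C ** A - C ** B" for A B C :: "complex ^ 'm ^ 'm"
    by (simp_all add: vec_eq_iff matrix_matrix_mult_def algebra_simps sum_subtractf)
  show "complex_vector.subspace (special_linear :: (complex ^ 'm ^ 'm) set)"
    by (rule subspace_special_linear)
  fix A B C :: "complex ^ 'm ^ 'm"
  have "trace (A ** B) = trace (B ** A)"
    by (rule trace_mul_sym)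
  then show "commutator A B \<in> special_linear"
    by (simp add: commutator_def trace_sub special_linear_def)
  show "commutator (A + B) C = commutator A C + commutator B C" "commutator C (A + B) = commutator C A + commutator C B"
    by (simp_all only: commutator_def distrib) simp_all
  show "commutator (c *\<^sub>C A) B = c *\<^sub>C commutator A B" "commutator A (c *\<^sub>C B) = c *\<^sub>C commutator A B" for c
    by (simp_all only: commutator_def sc complex_vector.scale_right_diff_distrib)
  show "commutator A A = 0"
    by (simp add: commutator_def)
  show "commutator A (commutator B C) + commutator B (commutator C A) + commutator C (commutator A B) = 0"
    by (simp only: commutator_def dl matrix_mul_assoc) simp
qed

section \<open>The span of the generators\<close>

lemma gen_entries: "gen M z = (\<Sum>r\<in>UNIV. \<Sum>s\<in>UNIV. M $ r $ s * (plane_vec z $ r * point_vec z $ s))"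
  by (simp add: gen_def bil_def matrix_vector_mult_def sum_distrib_left mult_ac)

lemma gen_add: "gen (M + N) = gen M + gen N"
  by (simp add: fun_eq_iff gen_def matrix_vector_mult_add_rdistrib bil.add_right)

lemma gen_scaleC: "gen (c *\<^sub>C M) = c *\<^sub>C gen M"
  by (simp add: fun_eq_iff gen_entries sum_distrib_left mult_ac)

lemma gen_zero [simp]: "gen 0 = 0"
  by (simp add: fun_eq_iff gen_def)

lemma gen_diff: "gen (M - N) = gen M - gen N"
  by (simp add: fun_eq_iff gen_def matrix_vector_mult_diff_rdistrib bil.diff_right)

lemma gen_sum: "gen (\<Sum>k\<in>K. f k) = (\<Sum>k\<in>K. gen (f k))"
  by (induction K rule: infinite_finite_induct) (simp_all add: gen_add)

lemma subspace_gen_image: "complex_vector.subspace S \<Longrightarrow> complex_vector.subspace (gen ` S)"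
  unfolding complex_vector.subspace_def
  by (auto simp flip: gen_add gen_scaleC gen_zero)

text \<open>
  Subtracting a scalar matrix does not change \<open>gen\<close>, because \<open>L \<cdot> W = 0\<close>. So every matrix may be
  replaced by a trace-free one.
\<close>

definition tracefree :: "complex ^ ('n + 2) ^ ('n + 2) \<Rightarrow> complex ^ ('n::finite + 2) ^ ('n + 2)"
  where "tracefree M = M - mat (trace M / of_nat CARD('n + 2))"

lemma two_plus_nat_neq_zero: "(2 :: complex) + of_nat n \<noteq> 0"
  by (metis add.commute add_2_eq_Suc of_nat_Suc of_nat_add of_nat_eq_0_iff of_nat_numeral nat.distinct(1))

lemma tracefree_in: "tracefree (M :: complex ^ ('a::finite + 2) ^ ('a + 2)) \<in> special_linear"
  using two_plus_nat_neq_zero[of "CARD('a)"]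
  by (simp add: tracefree_def special_linear_def trace_sub, simp add: trace_def mat_def)

lemma gen_tracefree [simp]: "gen (tracefree M) = gen M"
proof -
  have "mat c *v w = c *\<^sub>C w" for c :: complex and w :: "complex ^ ('a + 2)"
    by (simp add: vec_eq_iff matrix_vector_mult_def mat_def if_distrib[of "\<lambda>a. a * _"] cong: if_cong)
  then have "gen (mat c) = (0 :: 'a jet1 \<Rightarrow> _)" for c
    by (simp add: fun_eq_iff gen_def)
  then show ?thesis by (simp add: tracefree_def gen_diff)
qed

text \<open>
  The bidegree of the matrix entry \<open>(r, s)\<close>, hence of the function \<open>L\<^sub>r W\<^sub>s\<close>. Its values
  are exactly the seven bidegrees for which there are generators.
\<close>

definition deg :: "'n + 2 \<Rightarrow> 'n + 2 \<Rightarrow> int \<times> int"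
  where "deg r s = (of_bool (s = Inr 2) - of_bool (r = Inr 2), of_bool (r = Inr 1) - of_bool (s = Inr 1))"

definition supported :: "(int \<times> int) set \<Rightarrow> (complex ^ ('n::finite + 2) ^ ('n + 2)) set"
  where "supported K = {M. \<forall>r s. M $ r $ s \<noteq> 0 \<longrightarrow> deg r s \<in> K}"

lemma supportedD: "M \<in> supported K \<Longrightarrow> deg r s \<notin> K \<Longrightarrow> M $ r $ s = 0"
  by (auto simp: supported_def)

lemma supported_alt: "supported K = {M. \<forall>r s. deg r s \<notin> K \<longrightarrow> M $ r $ s = 0}"
  unfolding supported_def by blast

lemma subspace_supported: "complex_vector.subspace (supported K)"
  by (simp add: supported_alt complex_vector.subspace_def)

definition unit_mat :: "'m \<Rightarrow> 'm \<Rightarrow> complex ^ 'm::finite ^ 'm"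
  where "unit_mat r s = axis r (axis s 1)"

lemma gen_unit_mat: "gen (unit_mat r s) z = plane_vec z $ r * point_vec z $ s"
proof -
  have "unit_mat r s $ r' $ s' = (if r' = r then if s' = s then 1 else 0 else 0)" for r' s'
    by (simp add: unit_mat_def axis_def)
  then have "gen (unit_mat r s) z = (\<Sum>r'\<in>UNIV. if r' = r then (\<Sum>s'\<in>UNIV. if s' = s then plane_vec z $ r' * point_vec z $ s' else 0) else 0)"
    unfolding gen_entries by (intro sum.cong refl) (simp add: if_distrib[of "\<lambda>a. a * _"] cong: if_cong)
  then show ?thesis by simp
qed

lemma unit_mat_supported: "deg r s \<in> K \<Longrightarrow> unit_mat r s \<in> supported K"
  by (auto simp: supported_def unit_mat_def axis_def split: if_splits)

lemma supported_closed: "M \<in> supported K \<Longrightarrow> N \<in> supported K \<Longrightarrow> M + N \<in> supported K"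
   "M \<in> supported K \<Longrightarrow> c *\<^sub>C M \<in> supported K"
  using subspace_supported[of K] by (auto simp: complex_vector.subspace_def)

lemma generators_subset: "generators a b \<subseteq> gen ` supported {(a, b)}"
proof -
  have u: "(\<lambda>(x, u, p). 1) = gen ((-1) *\<^sub>C unit_mat (Inr 2) (Inr 1))"
    "(\<lambda>(x, u, p). x $ i) = gen ((-1) *\<^sub>C unit_mat (Inr 2) (Inl i))"
    "(\<lambda>(x, u, p). p $ i) = gen (unit_mat (Inl i) (Inr 1))"
    "(\<lambda>(x, u, p). x $ j * p $ i) = gen (unit_mat (Inl i) (Inl j))"
    "(\<lambda>(x, u, p). u * p $ i) = gen (unit_mat (Inl i) (Inr 2))"
    "(\<lambda>(x, u, p). x $ i * (u - (\<Sum>j\<in>UNIV. x $ j * p $ j))) = gen (unit_mat (Inr 1) (Inl i))"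
    "(\<lambda>(x, u, p). u * (u - (\<Sum>j\<in>UNIV. x $ j * p $ j))) = gen (unit_mat (Inr 1) (Inr 2))"
    "Z = gen (unit_mat (Inr 1) (Inr 1) + (-1) *\<^sub>C unit_mat (Inr 2) (Inr 2))"
    for i j :: 'a
    unfolding gen_add gen_scaleC by (auto simp: fun_eq_iff gen_unit_mat bil_def mult_ac Z_def)
  have imgI: "f = gen M \<Longrightarrow> M \<in> supported K \<Longrightarrow> f \<in> gen ` supported K"
    for M :: "complex ^ ('a + 2) ^ ('a + 2)" and f K by blast
  have m1: "((\<lambda>(x, u, p). 1) :: 'a jet1 \<Rightarrow> complex) \<in> gen ` supported {(-1, -1)}"
    by (rule imgI[OF u(1)]) (intro supported_closed unit_mat_supported; simp add: deg_def)
  have m2: "((\<lambda>(x, u, p). x $ i) :: 'a jet1 \<Rightarrow> complex) \<in> gen ` supported {(-1, 0)}" for i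
    by (rule imgI[OF u(2)]) (intro supported_closed unit_mat_supported; simp add: deg_def)
  have m3: "((\<lambda>(x, u, p). p $ i) :: 'a jet1 \<Rightarrow> complex) \<in> gen ` supported {(0, -1)}" for i
    by (rule imgI[OF u(3)]) (intro supported_closed unit_mat_supported; simp add: deg_def)
  have m4: "((\<lambda>(x, u, p). x $ j * p $ i) :: 'a jet1 \<Rightarrow> complex) \<in> gen ` supported {(0, 0)}" for i j
    by (rule imgI[OF u(4)]) (intro supported_closed unit_mat_supported; simp add: deg_def)
  have m5: "((\<lambda>(x, u, p). u * p $ i) :: 'a jet1 \<Rightarrow> complex) \<in> gen ` supported {(1, 0)}" for i
    by (rule imgI[OF u(5)]) (intro supported_closed unit_mat_supported; simp add: deg_def)
  have m6: "((\<lambda>(x, u, p). x $ i * (u - (\<Sum>j\<in>UNIV. x $ j * p $ j))) :: 'a jet1 \<Rightarrow> complex) \<in> gen ` supported {(0, 1)}" for i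
    by (rule imgI[OF u(6)]) (intro supported_closed unit_mat_supported; simp add: deg_def)
  have m7: "((\<lambda>(x, u, p). u * (u - (\<Sum>j\<in>UNIV. x $ j * p $ j))) :: 'a jet1 \<Rightarrow> complex) \<in> gen ` supported {(1, 1)}"
    by (rule imgI[OF u(7)]) (intro supported_closed unit_mat_supported; simp add: deg_def)
  have m8: "(Z :: 'a jet1 \<Rightarrow> _) \<in> gen ` supported {(0, 0)}"
    by (rule imgI[OF u(8)]) (intro supported_closed unit_mat_supported; simp add: deg_def)
  show ?thesis
  proof
    fix f :: "'a jet1 \<Rightarrow> complex" assume "f \<in> generators a b"
    then show "f \<in> gen ` supported {(a, b)}"
      using m1 m2 m3 m4 m5 m6 m7 m8 by (simp add: generators_def split: if_split_asm) auto
  qed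
qed

lemma sum_fun_eval: "(\<Sum>k\<in>K. f k) z = (\<Sum>k\<in>K. f k z)"
  by (induction K rule: infinite_finite_induct) simp_all

text \<open>
  All these functions are generators except for the last two, which are
  \<open>(Z + x\<^sup>j u\<^sub>j) / 2\<close> and \<open>(Z - x\<^sup>j u\<^sub>j) / 2\<close>.
\<close>

lemma coordinates_in_span:
  fixes i j :: "'n::finite"
  shows "(\<lambda>(x, u, p). 1) \<in> cspan (generators (-1) (-1) :: ('n jet1 \<Rightarrow> complex) set)"
    and "(\<lambda>(x, u, p). x $ i) \<in> cspan (generators (-1) 0)"
    and "(\<lambda>(x, u, p). p $ i) \<in> cspan (generators 0 (-1))"
    and "(\<lambda>(x, u, p). x $ i * p $ j) \<in> cspan (generators 0 0)"
    and "(\<lambda>(x, u, p). u * p $ i) \<in> cspan (generators 1 0)"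
    and "(\<lambda>(x, u, p). x $ i * (u - (\<Sum>j\<in>UNIV. x $ j * p $ j))) \<in> cspan (generators 0 1)"
    and "(\<lambda>(x, u, p). u * (u - (\<Sum>j\<in>UNIV. x $ j * p $ j))) \<in> cspan (generators 1 1 :: ('n jet1 \<Rightarrow> complex) set)"
    and "(\<lambda>(x, u, p). u) \<in> cspan (generators 0 0 :: ('n jet1 \<Rightarrow> complex) set)"
    and "(\<lambda>(x, u, p). u - (\<Sum>j\<in>UNIV. x $ j * p $ j)) \<in> cspan (generators 0 0 :: ('n jet1 \<Rightarrow> complex) set)"
proof -
  have xp: "(\<lambda>(x, u, p). x $ i * p $ j) \<in> cspan (generators 0 0)" for i j :: 'n
    by (rule complex_vector.span_base) (auto simp: generators_def)
  have "Z \<in> cspan (generators 0 0 :: ('n jet1 \<Rightarrow> complex) set)"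
    by (rule complex_vector.span_base) (auto simp: generators_def)
  then have memb: "(1/2) *\<^sub>C (Z + (\<Sum>j\<in>UNIV. (\<lambda>(x, u, p). x $ j * p $ j))) \<in> cspan (generators 0 0 :: ('n jet1 \<Rightarrow> complex) set)"
    "(1/2) *\<^sub>C (Z + (\<Sum>j\<in>UNIV. (\<lambda>(x, u, p). x $ j * p $ j))) - (\<Sum>j\<in>UNIV. (\<lambda>(x, u, p). x $ j * p $ j)) \<in> cspan (generators 0 0 :: ('n jet1 \<Rightarrow> complex) set)"
    by (intro complex_vector.span_scale complex_vector.span_add complex_vector.span_diff complex_vector.span_sum xp; assumption)+
  have sum_apply: "(\<Sum>j\<in>UNIV. (\<lambda>(x, u, p). x $ j * p $ j)) z = (\<Sum>j\<in>UNIV. fst z $ j * snd (snd z) $ j)"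
    for z :: "'n jet1"
    by (subst sum_fun_eval) (simp add: case_prod_beta)
  have "(1/2) *\<^sub>C (Z + (\<Sum>j\<in>UNIV. (\<lambda>(x, u, p). x $ j * p $ j))) = (\<lambda>(x, u, p :: complex ^ 'n). u)"
    "(1/2) *\<^sub>C (Z + (\<Sum>j\<in>UNIV. (\<lambda>(x, u, p). x $ j * p $ j))) - (\<Sum>j\<in>UNIV. (\<lambda>(x, u, p). x $ j * p $ j))
      = (\<lambda>(x, u, p :: complex ^ 'n). u - (\<Sum>j\<in>UNIV. x $ j * p $ j))"
    by (auto simp: fun_eq_iff Z_def sum_apply)
  with memb show "(\<lambda>(x, u, p). u) \<in> cspan (generators 0 0 :: ('n jet1 \<Rightarrow> complex) set)"
    "(\<lambda>(x, u, p). u - (\<Sum>j\<in>UNIV. x $ j * p $ j)) \<in> cspan (generators 0 0 :: ('n jet1 \<Rightarrow> complex) set)"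
    by simp_all
qed (rule complex_vector.span_base, force simp: generators_def)+

text \<open>
  The nine kinds of entries, by the position of row and column, give the nine functions of the
  previous lemma; entries in the row \<open>Inr 2\<close> carry the sign of \<open>L\<^sub>u = - 1\<close>.
\<close>

lemma entry_in_span:
  assumes "deg r s = (a, b)"
  shows "(\<lambda>z :: 'n::finite jet1. plane_vec z $ r * point_vec z $ s) \<in> cspan (generators a b)"
proof -
  have mem: "g \<in> cspan G" if "f \<in> cspan G" "\<And>x u p. g (x, u, p) = c * f (x, u, p)" for f g :: "'n jet1 \<Rightarrow> complex" and G c
  proof -
    have "g = c *\<^sub>C f" using that(2) by (auto simp: fun_eq_iff)
    then show ?thesis using complex_vector.span_scale[OF that(1)] by simp
  qed
  note gen_span = coordinates_in_span[where 'n = 'n]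
  have e0: "(\<lambda>z :: 'n jet1. plane_vec z $ Inr 1 * point_vec z $ Inr 1) \<in> cspan (generators 0 0)"
    by (rule mem[where c = "1", OF gen_span(9)]) (simp add: bil_def mult_ac)
  have e1: "(\<lambda>z :: 'n jet1. plane_vec z $ Inr 1 * point_vec z $ Inl j) \<in> cspan (generators 0 1)" for j
    by (rule mem[where c = "1", OF gen_span(6)[where i = j]]) (simp add: bil_def mult_ac)
  have e2: "(\<lambda>z :: 'n jet1. plane_vec z $ Inr 1 * point_vec z $ Inr 2) \<in> cspan (generators 1 1)"
    by (rule mem[where c = "1", OF gen_span(7)]) (simp add: bil_def mult_ac)
  have e3: "(\<lambda>z :: 'n jet1. plane_vec z $ Inl i * point_vec z $ Inr 1) \<in> cspan (generators 0 (-1))" for i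
    by (rule mem[where c = "1", OF gen_span(3)[where i = i]]) (simp add: bil_def mult_ac)
  have e4: "(\<lambda>z :: 'n jet1. plane_vec z $ Inl i * point_vec z $ Inl j) \<in> cspan (generators 0 0)" for i j
    by (rule mem[where c = "1", OF gen_span(4)[where i = j and j = i]]) (simp add: bil_def mult_ac)
  have e5: "(\<lambda>z :: 'n jet1. plane_vec z $ Inl i * point_vec z $ Inr 2) \<in> cspan (generators 1 0)" for i
    by (rule mem[where c = "1", OF gen_span(5)[where i = i]]) (simp add: bil_def mult_ac)
  have e6: "(\<lambda>z :: 'n jet1. plane_vec z $ Inr 2 * point_vec z $ Inr 1) \<in> cspan (generators (-1) (-1))"
    by (rule mem[where c = "-1", OF gen_span(1)]) (simp add: bil_def mult_ac)
  have e7: "(\<lambda>z :: 'n jet1. plane_vec z $ Inr 2 * point_vec z $ Inl j) \<in> cspan (generators (-1) 0)" for j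
    by (rule mem[where c = "-1", OF gen_span(2)[where i = j]]) (simp add: bil_def mult_ac)
  have e8: "(\<lambda>z :: 'n jet1. plane_vec z $ Inr 2 * point_vec z $ Inr 2) \<in> cspan (generators 0 0)"
    by (rule mem[where c = "-1", OF gen_span(8)]) (simp add: bil_def mult_ac)
  have d: "deg (Inr 1) (Inr 1) = (0, 0)" "deg (Inr 1) (Inl j) = (0, 1)" "deg (Inr 1) (Inr 2) = (1, 1)"
    "deg (Inl i) (Inr 1) = (0, -1)" "deg (Inl i) (Inl j) = (0, 0)" "deg (Inl i) (Inr 2) = (1, 0)"
    "deg (Inr 2) (Inr 1) = (-1, -1)" "deg (Inr 2) (Inl j) = (-1, 0)" "deg (Inr 2) (Inr 2) = (0, 0)" for i j :: 'n
    by (simp_all add: deg_def)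
  have "\<forall>r s. (\<lambda>z :: 'n jet1. plane_vec z $ r * point_vec z $ s) \<in> cspan (generators (fst (deg r s)) (snd (deg r s)))"
    unfolding all_index d fst_conv snd_conv by (intro conjI allI e0 e1 e2 e3 e4 e5 e6 e7 e8)
  from this[rule_format, of r s] show ?thesis by (simp add: assms)
qed

lemma gen_in_span:
  assumes "\<And>r s. M $ r $ s \<noteq> 0 \<Longrightarrow> (\<lambda>z. plane_vec z $ r * point_vec z $ s) \<in> cspan G"
  shows "gen M \<in> cspan G"
proof -
  have "gen M = (\<Sum>r\<in>UNIV. \<Sum>s\<in>UNIV. M $ r $ s *\<^sub>C (\<lambda>z. plane_vec z $ r * point_vec z $ s))"
    by (simp add: fun_eq_iff gen_entries sum_fun_eval)
  also have "\<dots> \<in> cspan G"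
  proof (intro complex_vector.span_sum)
    fix r s show "M $ r $ s *\<^sub>C (\<lambda>z. plane_vec z $ r * point_vec z $ s) \<in> cspan G"
    proof (cases "M $ r $ s = 0")
      case True then show ?thesis by (simp add: complex_vector.span_zero)
    next
      case False then show ?thesis by (intro complex_vector.span_scale assms)
    qed
  qed
  finally show ?thesis .
qed

lemma deg_diag [simp]: "deg r r = (0, 0)"
  by (simp add: deg_def)

lemma tracefree_supported:
  assumes "M \<in> supported K" shows "tracefree M \<in> supported K"
proof (cases "(0, 0) \<in> K")
  case True
  have "mat c \<in> supported K" for c
    using True by (auto simp: supported_def mat_def)
  then show ?thesis
    unfolding tracefree_def by (intro complex_vector.subspace_diff subspace_supported assms)
next
  case False
  then have "trace M = 0"
    using supportedD[OF assms] by (simp add: trace_def)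
  then have "tracefree M = M" by (simp add: tracefree_def mat_def vec_eq_iff)
  then show ?thesis using assms by simp
qed

lemma bigraded_part_eq: "(bigraded_part a b :: ('a::finite jet1 \<Rightarrow> complex) set) = gen ` (supported {(a, b)} \<inter> special_linear)" (is "?A = ?B")
proof
  have "cspan (generators a b :: ('a jet1 \<Rightarrow> complex) set) \<subseteq> gen ` supported {(a, b)}"
    by (intro complex_vector.span_minimal generators_subset subspace_gen_image subspace_supported)
  also have "\<dots> \<subseteq> gen ` (supported {(a, b)} \<inter> special_linear)"
  proof safe
    fix M :: "complex ^ ('a + 2) ^ ('a + 2)" assume "M \<in> supported {(a, b)}"
    then have "tracefree M \<in> supported {(a, b)} \<inter> special_linear"
      by (simp add: tracefree_supported tracefree_in)
    from imageI[OF this, of gen] show "gen M \<in> gen ` (supported {(a, b)} \<inter> special_linear)"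
      by simp
  qed
  finally show "?A \<subseteq> ?B"
    by (simp add: bigraded_part_def)
  show "?B \<subseteq> ?A"
  proof (rule image_subsetI)
    fix M :: "complex ^ ('a + 2) ^ ('a + 2)" assume "M \<in> supported {(a, b)} \<inter> special_linear"
    then show "gen M \<in> bigraded_part a b"
      unfolding bigraded_part_def by (intro gen_in_span entry_in_span) (simp add: supported_def)
  qed
qed

lemma gen_in_special_linear: "gen M \<in> gen ` special_linear"
  using imageI[OF tracefree_in, of gen M] by simp

lemma generator_span_eq: "(generator_span :: ('a::finite jet1 \<Rightarrow> complex) set) = gen ` special_linear" (is "?A = ?B")
proof
  have "(generators a b :: ('a jet1 \<Rightarrow> complex) set) \<subseteq> gen ` special_linear" for a b
  proof
    fix f :: "'a jet1 \<Rightarrow> complex" assume "f \<in> generators a b"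
    then obtain M where "f = gen M" using generators_subset[of a b] by blast
    then show "f \<in> gen ` special_linear" by (simp add: gen_in_special_linear)
  qed
  then have "(\<Union>a b. generators a b :: ('a jet1 \<Rightarrow> complex) set) \<subseteq> gen ` special_linear"
    by blast
  then show "?A \<subseteq> ?B"
    unfolding generator_span_def by (intro complex_vector.span_minimal subspace_gen_image subspace_special_linear)
  have entry: "(\<lambda>z :: 'a jet1. plane_vec z $ r * point_vec z $ s) \<in> cspan (\<Union>a b. generators a b)" for r s :: "'a + 2"
  proof (rule subsetD[OF complex_vector.span_mono])
    show "(\<lambda>z :: 'a jet1. plane_vec z $ r * point_vec z $ s) \<in> cspan (generators (fst (deg r s)) (snd (deg r s)))"
      by (rule entry_in_span) simp
  qed blast
  show "?B \<subseteq> ?A"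
    unfolding generator_span_def by (rule image_subsetI, rule gen_in_span, rule entry)
qed

lemma gen_in_generator_span: "gen M \<in> generator_span"
  unfolding generator_span_eq by (rule gen_in_special_linear)

section \<open>Functions determine trace-free matrices\<close>

text \<open>
  If \<open>L M W\<close> vanishes for all \<open>x, u, p\<close>, evaluation at multiples of basis vectors kills every
  off-diagonal entry of \<open>M\<close> and equates the diagonal ones. So \<open>M\<close> is scalar.
\<close>

lemma gen_eq_zero_imp_zero:
  assumes "gen M = 0" "M \<in> special_linear" shows "M = 0"
proof -
  have g: "bil (plane_vec (x, u, p)) (M *v point_vec (x, u, p)) = 0" for x u p
    using fun_cong[OF assms(1), of "(x, u, p)"] by (simp add: gen_def)
  have mv: "(M *v point_vec (x, u, p)) $ r = M $ r $ Inr 1 + (\<Sum>j\<in>UNIV. M $ r $ Inl j * x $ j) + M $ r $ Inr 2 * u" for x u p r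
    by (simp add: matrix_vector_mult_def sum_index)
  have g1: "(u - bil p x) * (M $ Inr 1 $ Inr 1 + (\<Sum>j\<in>UNIV. M $ Inr 1 $ Inl j * x $ j) + M $ Inr 1 $ Inr 2 * u)
     + (\<Sum>i\<in>UNIV. p $ i * (M $ Inl i $ Inr 1 + (\<Sum>j\<in>UNIV. M $ Inl i $ Inl j * x $ j) + M $ Inl i $ Inr 2 * u))
     + (- 1) * (M $ Inr 2 $ Inr 1 + (\<Sum>j\<in>UNIV. M $ Inr 2 $ Inl j * x $ j) + M $ Inr 2 $ Inr 2 * u) = 0" for x u p
    using g[of x u p] by (simp only: bil_index plane_vec_nth point_vec_nth middle_simps bil_def middle_nth mv)
  note g = g1[unfolded mult_minus1 add_uminus_conv_diff right_minus_eq]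
  have ax: "(\<Sum>j\<in>UNIV. h j * axis i c $ j) = h i * c" "(\<Sum>j\<in>UNIV. axis i c $ j * h j) = c * h i"
    for h i and c :: complex
    using bil_axis(2)[of "vec_lambda h" i c] bil_axis(1)[of i c "vec_lambda h"] by (simp_all add: bil_def)
  note g0 = g[of _ 0 0] and gp = g[of _ "axis _ _" 0] and gx = g[of _ 0 "axis _ _"] and gg = g[of 0 "axis _ 1" "axis _ 1"]
  have a: "M $ Inr 2 $ Inr 1 = 0" using g0[of 0] by simp
  have b: "M $ Inr 1 $ Inr 1 = M $ Inr 2 $ Inr 2" and c: "M $ Inr 1 $ Inr 2 = 0"
  proof -
    have eqs: "M $ Inr 1 $ Inr 1 + M $ Inr 1 $ Inr 2 = M $ Inr 2 $ Inr 2"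
      "M $ Inr 1 $ Inr 2 - M $ Inr 1 $ Inr 1 = - M $ Inr 2 $ Inr 2"
      using g0[of 1] g0[of "-1"] a by (simp_all add: algebra_simps)
    have "2 * M $ Inr 1 $ Inr 2 = (M $ Inr 1 $ Inr 1 + M $ Inr 1 $ Inr 2) + (M $ Inr 1 $ Inr 2 - M $ Inr 1 $ Inr 1)"
      by simp
    then show "M $ Inr 1 $ Inr 2 = 0" unfolding eqs by simp
    with eqs show "M $ Inr 1 $ Inr 1 = M $ Inr 2 $ Inr 2" by simp
  qed
  have d: "M $ Inr 2 $ Inl j = 0" for j
    using gx[of 0 j 1] a by (simp add: ax)
  have e: "M $ Inr 1 $ Inl j = 0" for j
    using gx[of 1 j 1] a b c d by (simp add: ax algebra_simps)
  have f: "M $ Inl i $ Inr 1 = 0" for i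
    using gp[of 0 i 1] a by (simp add: ax)
  have h: "M $ Inl i $ Inr 2 = 0" for i
    using gp[of 1 i 1] a b c f by (simp add: ax algebra_simps)
  have i: "M $ Inl i $ Inl j = (if i = j then M $ Inr 1 $ Inr 1 else 0)" for i j
    using gg[of i j] a c d e f by (simp add: ax algebra_simps) (simp add: axis_def)
  have "trace M = (2 + of_nat CARD('a)) * M $ Inr 1 $ Inr 1"
    by (simp add: trace_def sum_index i b algebra_simps)
  then have "M $ Inr 1 $ Inr 1 = 0"
    using assms(2) two_plus_nat_neq_zero by (simp add: special_linear_def)
  then show "M = 0"
    by (intro vec_index_eqI) (simp_all add: a b[symmetric] c d e f h i)
qed

text \<open>
  On a complex line through a point of \<open>N\<close>, \<open>gen M\<close> is an entire function that vanishes near that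
  point, so it vanishes on the whole line. Every jet lies on such a line.
\<close>

lemma gen_zero_on_open:
  assumes "open N" "w \<in> N" "\<And>z. z \<in> N \<Longrightarrow> gen M z = 0"
  shows "gen M = 0"
proof
  fix z :: "'a jet1"
  obtain x u p where w: "w = (x, u, p)" by (cases w)
  obtain a b c where v: "z - w = (a, b, c)" by (cases "z - w")
  define l where "l t = (x + t *\<^sub>C a, u + t * b, p + t *\<^sub>C c)" for t
  have "\<forall>r. (\<lambda>t. plane_vec (l t) $ r) holomorphic_on UNIV"
    unfolding all_index by (simp add: l_def bil_def) (intro conjI allI holomorphic_intros)
  moreover have "\<forall>r. (\<lambda>t. point_vec (l t) $ r) holomorphic_on UNIV"
    unfolding all_index by (simp add: l_def) (intro conjI allI holomorphic_intros)
  ultimately have hol: "(\<lambda>t. gen M (l t)) holomorphic_on UNIV"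
    unfolding gen_entries by (intro holomorphic_intros) auto
  have l: "continuous_on UNIV l"
    unfolding l_def scaleC_vec_def scaleC_complex by (intro continuous_intros)
  have "gen M (l 1) = 0"
  proof (rule analytic_continuation_open[where s = "l -` N" and s' = UNIV and f = "\<lambda>t. gen M (l t)" and g = "\<lambda>_. 0"])
    show "open (l -` N)" using assms(1) l by (rule open_vimage)
    have "0 \<in> l -` N" using assms(2) by (simp add: l_def w)
    then show "l -` N \<noteq> {}" by blast
  qed (use assms(3) hol in auto)
  moreover have "l 1 = z"
    using v unfolding w diff_eq_eq by (simp add: l_def scaleC_one add.commute)
  ultimately show "gen M z = 0 z" by simp
qed

lemma gen_eq_on_open:
  assumes "open N" "w \<in> N" "\<And>z. z \<in> N \<Longrightarrow> gen M z = gen M' z" "M \<in> special_linear" "M' \<in> special_linear"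
  shows "M = M'"
proof -
  have "gen (M - M') = 0"
    by (rule gen_zero_on_open[OF assms(1,2)]) (simp add: gen_diff assms(3))
  moreover have "M - M' \<in> special_linear"
    using assms by (intro complex_vector.subspace_diff subspace_special_linear)
  ultimately show ?thesis using gen_eq_zero_imp_zero[of "M - M'"] by simp
qed

lemma gen_inj: "gen M = gen M' \<Longrightarrow> M \<in> special_linear \<Longrightarrow> M' \<in> special_linear \<Longrightarrow> M = M'"
  by (rule gen_eq_on_open[OF open_UNIV UNIV_I]) simp_all

section \<open>The bigrading\<close>

definition diag_mat :: "('m \<Rightarrow> complex) \<Rightarrow> complex ^ 'm ^ 'm::finite"
  where "diag_mat d = (\<chi> r s. if r = s then d r else 0)"

text \<open>
  The matrix entries are simultaneous eigenvectors of all diagonal matrices, and \<open>Z_1\<close> and \<open>Z_n1\<close> are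
  represented by diagonal matrices. This is the source of the bigrading.
\<close>

lemma commutator_diag_mat: "commutator (diag_mat d) M $ r $ s = (d r - d s) * M $ r $ s"
  by (simp add: commutator_nth diag_mat_def if_distrib[of "\<lambda>a. a * _"] if_distrib[of "(*) _"] algebra_simps cong: if_cong)

abbreviation weight_1 :: "'n + 2 \<Rightarrow> complex" where "weight_1 r \<equiv> - of_bool (r = Inr 2)"
abbreviation weight_n1 :: "'n + 2 \<Rightarrow> complex" where "weight_n1 r \<equiv> of_bool (r = Inr 1)"

lemma gen_diag_mat: "gen (diag_mat d) z = (\<Sum>r\<in>UNIV. d r * (plane_vec z $ r * point_vec z $ r))"
  by (simp add: gen_entries diag_mat_def if_distrib[of "\<lambda>a. a * _"] cong: if_cong)

lemma Z_eq_gen: "Z_1 = gen (diag_mat weight_1)" "Z_n1 = gen (diag_mat weight_n1)" "Z = gen (diag_mat (\<lambda>r. weight_1 r + weight_n1 r))"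
  by (simp_all add: fun_eq_iff gen_diag_mat sum_index Z_1_def Z_n1_def Z_def bil_def mult_ac)

lemma of_int_deg: "of_int (fst (deg r s)) = weight_1 r - weight_1 s" "of_int (snd (deg r s)) = weight_n1 r - weight_n1 s"
  by (simp_all add: deg_def)

lemma commutator_weights:
  assumes "M \<in> supported {(a, b)}"
  shows "commutator (diag_mat weight_1) M = of_int a *\<^sub>C M" "commutator (diag_mat weight_n1) M = of_int b *\<^sub>C M"
proof -
  have "(weight_1 r - weight_1 s) * M $ r $ s = of_int a * M $ r $ s \<and> (weight_n1 r - weight_n1 s) * M $ r $ s = of_int b * M $ r $ s" for r s
  proof (cases "M $ r $ s = 0")
    case False
    then have "deg r s = (a, b)"
      using supportedD[OF assms] by blast
    then show ?thesis
      using of_int_deg[of r s] by simp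
  qed simp
  then show "commutator (diag_mat weight_1) M = of_int a *\<^sub>C M" "commutator (diag_mat weight_n1) M = of_int b *\<^sub>C M"
    by (simp_all add: vec_eq_iff commutator_diag_mat del: of_bool_eq)
qed

text \<open>
  The bracket with \<open>Z\<close> multiplies the entry of bidegree \<open>(a, b)\<close> by \<open>a + b\<close>. By injectivity of
  \<open>gen\<close> the eigenvalue equation can be read off from the entries.
\<close>

lemma graded_part_eq: "(graded_part k :: ('n::finite jet1 \<Rightarrow> complex) set) = gen ` (supported {(a, b). a + b = k} \<inter> special_linear)"
proof -
  have "lagrange_bracket Z (gen M) = of_int k *\<^sub>C gen M \<longleftrightarrow> M \<in> supported {(a, b). a + b = k}"
    if M: "M \<in> special_linear" for M :: "complex ^ ('n + 2) ^ ('n + 2)"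
  proof -
    let ?C = "commutator (diag_mat (\<lambda>r. weight_1 r + weight_n1 r)) M"
    have "?C \<in> special_linear"
      by (simp add: special_linear_def trace_def commutator_diag_mat)
    then have "lagrange_bracket Z (gen M) = of_int k *\<^sub>C gen M \<longleftrightarrow> ?C = of_int k *\<^sub>C M"
      unfolding Z_eq_gen lagrange_bracket_gen gen_scaleC[symmetric]
      by (intro iffI gen_inj complex_vector.subspace_scale[OF subspace_special_linear M]) simp_all
    also have "\<dots> \<longleftrightarrow> (\<forall>r s. (of_int (fst (deg r s) + snd (deg r s)) - of_int k) * M $ r $ s = 0)"
      unfolding of_int_add of_int_deg by (simp add: vec_eq_iff commutator_diag_mat algebra_simps)
    also have "\<dots> \<longleftrightarrow> M \<in> supported {(a, b). a + b = k}"
      unfolding supported_def mult_eq_0_iff right_minus_eq of_int_eq_iff by (auto simp: case_prod_beta)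
    finally show ?thesis .
  qed
  then show ?thesis
    unfolding graded_part_def generator_span_eq by blast
qed

definition mask :: "(int \<times> int) set \<Rightarrow> complex ^ ('n + 2) ^ ('n + 2) \<Rightarrow> complex ^ ('n::finite + 2) ^ ('n + 2)"
  where "mask K M = (\<chi> r s. if deg r s \<in> K then M $ r $ s else 0)"

lemma mask_supported: "mask K M \<in> supported K"
  by (simp add: mask_def supported_def)

lemma mask_special_linear: "M \<in> special_linear \<Longrightarrow> mask K M \<in> special_linear"
  by (cases "(0, 0) \<in> K") (simp_all add: mask_def special_linear_def trace_def)

lemma supported_cong:
  assumes "\<forall>r s. deg r s \<in> K \<longleftrightarrow> deg (r :: 'n::finite + 2) s \<in> K'"
  shows "(supported K :: (complex ^ ('n + 2) ^ ('n + 2)) set) = supported K'"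
  using assms by (simp add: supported_def)

lemma is_direct_sum_supported:
  assumes "K1 \<inter> K2 = {}"
  shows "is_direct_sum (gen ` (supported (K1 \<union> K2) \<inter> special_linear) :: ('n::finite jet1 \<Rightarrow> complex) set)
    (gen ` (supported K1 \<inter> special_linear)) (gen ` (supported K2 \<inter> special_linear))"
  unfolding is_direct_sum_def
proof (intro conjI set_eqI iffI)
  fix f :: "'n jet1 \<Rightarrow> complex"
  assume "f \<in> gen ` (supported (K1 \<union> K2) \<inter> special_linear)"
  then obtain M where M: "f = gen M" "M \<in> supported (K1 \<union> K2)" "M \<in> special_linear" by blast
  have "M = mask K1 M + mask K2 M"
    using supportedD[OF M(2)] assms by (auto simp: vec_eq_iff mask_def)
  then have "f = gen (mask K1 M) + gen (mask K2 M)"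
    by (simp only: gen_add[symmetric] M(1))
  then show "f \<in> {x + y | x y. x \<in> gen ` (supported K1 \<inter> special_linear) \<and> y \<in> gen ` (supported K2 \<inter> special_linear)}"
    using mask_supported mask_special_linear[OF M(3)] by blast
next
  fix f :: "'n jet1 \<Rightarrow> complex"
  assume "f \<in> {x + y | x y. x \<in> gen ` (supported K1 \<inter> special_linear) \<and> y \<in> gen ` (supported K2 \<inter> special_linear)}"
  then obtain M N where *: "f = gen (M + N)" "M \<in> supported K1" "N \<in> supported K2" "M \<in> special_linear" "N \<in> special_linear"
    by (auto simp: gen_add)
  then have "M \<in> supported (K1 \<union> K2)" "N \<in> supported (K1 \<union> K2)"
    by (auto simp: supported_def)
  with * show "f \<in> gen ` (supported (K1 \<union> K2) \<inter> special_linear)"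
    by (auto intro!: imageI supported_closed complex_vector.subspace_add subspace_special_linear)
next
  fix f :: "'n jet1 \<Rightarrow> complex"
  assume "f \<in> gen ` (supported K1 \<inter> special_linear) \<inter> gen ` (supported K2 \<inter> special_linear)"
  then obtain M M' where M: "f = gen M" "M \<in> supported K1" "M \<in> special_linear"
      "f = gen M'" "M' \<in> supported K2" "M' \<in> special_linear"
    by blast
  then have "M' = M"
    using gen_inj[of M' M] by simp
  with M have "f = gen M" "M \<in> supported K1" "M \<in> supported K2" by simp_all
  moreover from this have "M $ r $ s = 0" for r s
    using assms unfolding supported_def by blast
  then have "M = 0" by (simp add: vec_eq_iff)
  ultimately show "f \<in> {0}" by simp
next
  fix f :: "'n jet1 \<Rightarrow> complex" assume "f \<in> {0}"
  moreover have "(0 :: 'n jet1 \<Rightarrow> complex) \<in> gen ` (supported K \<inter> special_linear)" for K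
    by (rule image_eqI[of _ _ "0 :: complex ^ ('n + 2) ^ ('n + 2)"]) (simp_all add: supported_def special_linear_def trace_def)
  ultimately show "f \<in> gen ` (supported K1 \<inter> special_linear) \<inter> gen ` (supported K2 \<inter> special_linear)"
    by simp
qed

text \<open>
  The bidegree of \<open>(r, s)\<close> is a difference of weights of \<open>s\<close> and \<open>r\<close>, so it is additive along
  \<open>(r, k)\<close>, \<open>(k, s)\<close> in a matrix product.
\<close>

lemma commutator_supported:
  assumes M: "M \<in> supported {(a, b)}" and N: "N \<in> supported {(c, d)}"
  shows "commutator M N \<in> supported {(a + c, b + d)}"
proof -
  have prod: "(A ** B) $ r $ s = 0" if "A \<in> supported {(a, b)}" "B \<in> supported {(c, d)}" "deg r s \<noteq> (a + c, b + d)"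
    for A B :: "complex ^ ('a + 2) ^ ('a + 2)" and a b c d r s
  proof -
    have "A $ r $ k * B $ k $ s = 0" for k
    proof -
      have "deg r k \<noteq> (a, b) \<or> deg k s \<noteq> (c, d)"
        using that(3) by (auto simp: deg_def)
      then show ?thesis
        using supportedD[OF that(1), of r k] supportedD[OF that(2), of k s] by auto
    qed
    then have "(\<Sum>k\<in>UNIV. A $ r $ k * B $ k $ s) = 0" by (intro sum.neutral) blast
    then show ?thesis by (simp add: matrix_matrix_mult_def)
  qed
  have "commutator M N $ r $ s = 0" if "deg r s \<noteq> (a + c, b + d)" for r s
    using prod[OF M N that] prod[OF N M, of r s] that by (simp add: commutator_def add.commute)
  then show ?thesis
    by (auto simp: supported_def)
qed

text \<open>
  The component of bidegree \<open>k\<close> of \<open>gen M\<close> is \<open>gen\<close> of the entries of \<open>M\<close> of bidegree \<open>k\<close>. Any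
  other decomposition lifts to trace-free matrices and there must consist of the same entries.
\<close>

lemma bigrading_generators: "bigrading lagrange_bracket (generator_span :: ('n::finite jet1 \<Rightarrow> complex) set) bigraded_part"
  unfolding bigrading_def
proof (intro conjI allI ballI)
  fix a b c d
  show "complex_vector.subspace (bigraded_part a b :: ('n jet1 \<Rightarrow> complex) set)"
    unfolding bigraded_part_def by (rule complex_vector.subspace_span)
  show "(bigraded_part a b :: ('n jet1 \<Rightarrow> complex) set) \<subseteq> generator_span"
    unfolding bigraded_part_eq generator_span_eq by blast
  fix f g :: "'n jet1 \<Rightarrow> complex" assume "f \<in> bigraded_part a b" "g \<in> bigraded_part c d"
  then obtain M N where "f = gen M" "g = gen N" "M \<in> supported {(a, b)}" "N \<in> supported {(c, d)}"
    unfolding bigraded_part_eq by blast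
  moreover have "commutator M N \<in> special_linear"
    using trace_mul_sym[of M N] by (simp add: special_linear_def commutator_def trace_sub)
  ultimately show "lagrange_bracket f g \<in> bigraded_part (a + c) (b + d)"
    unfolding bigraded_part_eq by (auto simp: lagrange_bracket_gen intro!: imageI commutator_supported)
next
  fix f :: "'n jet1 \<Rightarrow> complex" assume "f \<in> generator_span"
  then obtain M where M: "f = gen M" "M \<in> special_linear"
    unfolding generator_span_eq by blast
  define y where "y k = gen (mask {k} M)" for k
  define D where "D = (\<lambda>(r, s). deg r (s :: 'n + 2)) ` UNIV"
  have D: "finite D" "deg r s \<in> D" for r s :: "'n + 2"
    by (auto simp: D_def)
  have mask0: "mask {k} M = 0" if "k \<notin> D" for k
    using D(2) that by (auto simp: mask_def vec_eq_iff)
  have sub: "{k. y k \<noteq> 0} \<subseteq> D"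
    using mask0 by (auto simp: y_def)
  show "\<exists>!y :: int \<times> int \<Rightarrow> 'n jet1 \<Rightarrow> complex.
    finite {k. y k \<noteq> 0} \<and> (\<forall>a b. y (a, b) \<in> bigraded_part a b) \<and> f = (\<Sum>k | y k \<noteq> 0. y k)"
  proof (intro ex1I[of _ y] conjI allI)
    show "finite {k. y k \<noteq> 0}"
      using sub D(1) by (rule finite_subset)
    show "y (a, b) \<in> bigraded_part a b" for a b
      unfolding bigraded_part_eq y_def by (auto intro: imageI mask_supported mask_special_linear M)
    have "(\<Sum>k | y k \<noteq> 0. y k) = (\<Sum>k\<in>D. y k)"
      by (rule sum.mono_neutral_left[OF D(1) sub]) auto
    also have "\<dots> = gen (\<Sum>k\<in>D. mask {k} M)"
      by (simp add: y_def gen_sum)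
    also have "(\<Sum>k\<in>D. mask {k} M) = M"
      by (simp add: vec_eq_iff mask_def D)
    finally show "f = (\<Sum>k | y k \<noteq> 0. y k)" unfolding M(1) ..
  next
    fix y' :: "int \<times> int \<Rightarrow> 'n jet1 \<Rightarrow> complex"
    assume y': "finite {k. y' k \<noteq> 0} \<and> (\<forall>a b. y' (a, b) \<in> bigraded_part a b) \<and> f = (\<Sum>k | y' k \<noteq> 0. y' k)"
    have "\<exists>N. y' k = gen N \<and> N \<in> supported {k} \<and> N \<in> special_linear" for k
      using y' unfolding bigraded_part_eq by (cases k) blast
    then obtain N where N: "\<And>k. y' k = gen (N k)" "\<And>k. N k \<in> supported {k}" "\<And>k. N k \<in> special_linear"
      by metis
    let ?K = "{k. y' k \<noteq> 0}"
    have "gen M = gen (\<Sum>k\<in>?K. N k)"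
      using y' M(1) by (simp add: gen_sum N(1))
    then have MN: "M = (\<Sum>k\<in>?K. N k)"
      by (rule gen_inj[OF _ M(2)]) (intro complex_vector.subspace_sum subspace_special_linear N)
    have N0: "N k = 0" if "k \<notin> ?K" for k
      using that gen_eq_zero_imp_zero[OF _ N(3), of k] N(1)[of k] by simp
    show "y' = y"
    proof
      fix k
      have "N k $ r $ s = mask {k} M $ r $ s" for r s
      proof (cases "deg r s = k")
        case True
        have "M $ r $ s = (\<Sum>k'\<in>?K. if k' = k then N k $ r $ s else 0)"
          unfolding MN sum_component using supportedD[OF N(2)] True by (intro sum.cong) auto
        also have "\<dots> = N k $ r $ s"
          using y' N0[of k] by auto
        finally show ?thesis using True by (simp add: mask_def)
      next
        case False
        then show ?thesis using supportedD[OF N(2), of r s k] by (simp add: mask_def)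
      qed
      then have "N k = mask {k} M" by (simp add: vec_eq_iff)
      then show "y' k = y k" by (simp add: y_def N(1))
    qed
  qed
qed

lemma Z_action:
  assumes "g \<in> bigraded_part a b"
  shows "lagrange_bracket Z_1 g = of_int a *\<^sub>C g" "lagrange_bracket Z_n1 g = of_int b *\<^sub>C g"
  using assms unfolding bigraded_part_eq
  by (auto simp: Z_eq_gen lagrange_bracket_gen commutator_weights gen_scaleC)

lemma graded_parts:
  shows "is_direct_sum (graded_part (-1) :: ('n::finite jet1 \<Rightarrow> complex) set) (bigraded_part (-1) 0) (bigraded_part 0 (-1))"
    and "is_direct_sum (graded_part 1 :: ('n jet1 \<Rightarrow> complex) set) (bigraded_part 1 0) (bigraded_part 0 1)"
    and "(graded_part (-2) :: ('n jet1 \<Rightarrow> complex) set) = bigraded_part (-1) (-1)"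
    and "(graded_part 0 :: ('n jet1 \<Rightarrow> complex) set) = bigraded_part 0 0"
    and "(graded_part 2 :: ('n jet1 \<Rightarrow> complex) set) = bigraded_part 1 1"
proof -
  note sc = supported_cong[where 'n = 'n, unfolded all_index]
  have "(supported {(a, b). a + b = -1} :: (complex ^ ('n + 2) ^ ('n + 2)) set) = supported ({(-1, 0)} \<union> {(0, -1)})"
    "(supported {(a, b). a + b = 1} :: (complex ^ ('n + 2) ^ ('n + 2)) set) = supported ({(1, 0)} \<union> {(0, 1)})"
    by (rule sc; simp add: deg_def)+
  then show "is_direct_sum (graded_part (-1) :: ('n jet1 \<Rightarrow> complex) set) (bigraded_part (-1) 0) (bigraded_part 0 (-1))"
    "is_direct_sum (graded_part 1 :: ('n jet1 \<Rightarrow> complex) set) (bigraded_part 1 0) (bigraded_part 0 1)"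
    unfolding graded_part_eq bigraded_part_eq by (simp_all only:) (rule is_direct_sum_supported; simp)+
  have "(supported {(a, b). a + b = -2} :: (complex ^ ('n + 2) ^ ('n + 2)) set) = supported {(-1, -1)}"
    "(supported {(a, b). a + b = 0} :: (complex ^ ('n + 2) ^ ('n + 2)) set) = supported {(0, 0)}"
    "(supported {(a, b). a + b = 2} :: (complex ^ ('n + 2) ^ ('n + 2)) set) = supported {(1, 1)}"
    by (rule sc; simp add: deg_def)+
  then show "(graded_part (-2) :: ('n jet1 \<Rightarrow> complex) set) = bigraded_part (-1) (-1)"
    "(graded_part 0 :: ('n jet1 \<Rightarrow> complex) set) = bigraded_part 0 0"
    "(graded_part 2 :: ('n jet1 \<Rightarrow> complex) set) = bigraded_part 1 1"
    unfolding graded_part_eq bigraded_part_eq by (simp_all only:)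
qed

section \<open>Matrices give point symmetries\<close>

lemma matrix_vector_scaleC: "M *v (c *\<^sub>C x) = c *\<^sub>C (M *v x)" for M :: "complex ^ 'k::finite ^ 'm::finite"
  by (simp add: vec_eq_iff matrix_vector_mult_def sum_distrib_left mult_ac)

lemma vector_matrix_scaleC: "(c *\<^sub>C x) v* M = c *\<^sub>C (x v* M)" for M :: "complex ^ 'k::finite ^ 'm::finite"
  by (simp add: vec_eq_iff vector_matrix_mult_def sum_distrib_left mult_ac)

lemma vector_matrix_add: "(x + y) v* M = x v* M + y v* M" for M :: "complex ^ 'k::finite ^ 'm::finite"
  by (simp add: vec_eq_iff vector_matrix_mult_def sum.distrib algebra_simps)

lemma bounded_bilinear_scaleC: "bounded_bilinear (scaleC :: complex \<Rightarrow> complex ^ 'k::finite \<Rightarrow> _)"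
  by (auto simp: bilinear_conv_bounded_bilinear[symmetric] bilinear_def vec_eq_iff algebra_simps intro!: linearI)

lemma bounded_linear_vector_matrix: "bounded_linear (\<lambda>x. x v* (M :: complex ^ 'k::finite ^ 'm::finite))"
  unfolding linear_conv_bounded_linear[symmetric]
  by (rule linearI, rule vector_matrix_add) (simp add: vec_eq_iff vector_matrix_mult_def scaleR_sum_right)

lemma bounded_linear_middle: "bounded_linear (middle :: complex ^ ('n::finite + 2) \<Rightarrow> _)"
  unfolding linear_conv_bounded_linear[symmetric] by (rule linearI) (simp_all add: vec_eq_iff)

lemma middle_linear [simp]: "middle (c *\<^sub>C v) = c *\<^sub>C middle v" "middle (v + w) = middle v + middle w" "middle (v - w) = middle v - middle w"
  for v w :: "complex ^ ('n::finite + 2)"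
  by (simp_all add: vec_eq_iff)

definition d_point_velocity :: "complex ^ ('n + 2) ^ ('n + 2) \<Rightarrow> 'n::finite jet1 \<Rightarrow> 'n jet1 \<Rightarrow> complex ^ ('n + 2)"
  where "d_point_velocity M z v = (M *v d_point_vec v) $ Inr 1 *\<^sub>C point_vec z + (M *v point_vec z) $ Inr 1 *\<^sub>C d_point_vec v - M *v d_point_vec v"

definition d_plane_velocity :: "complex ^ ('n + 2) ^ ('n + 2) \<Rightarrow> 'n::finite jet1 \<Rightarrow> 'n jet1 \<Rightarrow> complex ^ ('n + 2)"
  where "d_plane_velocity M z v = d_plane_vec z v v* M + (d_plane_vec z v v* M) $ Inr 2 *\<^sub>C plane_vec z + (plane_vec z v* M) $ Inr 2 *\<^sub>C d_plane_vec z v"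

definition d_matrix_field :: "complex ^ ('n + 2) ^ ('n + 2) \<Rightarrow> 'n::finite jet1 \<Rightarrow> 'n jet1 \<Rightarrow> 'n jet1"
  where "d_matrix_field M z v = (middle (d_point_velocity M z v), d_point_velocity M z v $ Inr 2, middle (d_plane_velocity M z v))"

lemma d_matrix_field_scaleC: "d_matrix_field M z (c *\<^sub>C v) = c *\<^sub>C d_matrix_field M z v"
proof -
  have "d_point_velocity M z (c *\<^sub>C v) = c *\<^sub>C d_point_velocity M z v" "d_plane_velocity M z (c *\<^sub>C v) = c *\<^sub>C d_plane_velocity M z v"
    by (simp_all add: d_point_velocity_def d_plane_velocity_def matrix_vector_scaleC vector_matrix_scaleC vec_eq_iff algebra_simps)
  then show ?thesis by (simp add: d_matrix_field_def)
qed

lemma matrix_field_has_derivative: "(matrix_field M has_derivative d_matrix_field M z) (at z within S)"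
proof -
  have b: "((\<lambda>z. M *v point_vec z) has_derivative (\<lambda>v. M *v d_point_vec v)) (at z within S)"
    by (rule bounded_linear.has_derivative[OF matrix_vector_mul_bounded_linear point_vec_has_derivative])
  have a: "((\<lambda>z. plane_vec z v* M) has_derivative (\<lambda>v. d_plane_vec z v v* M)) (at z within S)"
    by (rule bounded_linear.has_derivative[OF bounded_linear_vector_matrix plane_vec_has_derivative])
  note nth = bounded_linear.has_derivative[OF bounded_linear_vec_nth]
    and middle = bounded_linear.has_derivative[OF bounded_linear_middle]
  have point_velocity: "(point_velocity M has_derivative d_point_velocity M z) (at z within S)"
    unfolding point_velocity_def d_point_velocity_def
    by (rule has_derivative_eq_rhs, rule has_derivative_diff, rule bounded_bilinear.FDERIV[OF bounded_bilinear_scaleC],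
        rule nth, rule b, rule point_vec_has_derivative, rule b) (simp add: fun_eq_iff add.commute)
  have plane_velocity: "(plane_velocity M has_derivative d_plane_velocity M z) (at z within S)"
    unfolding plane_velocity_def d_plane_velocity_def
    by (rule has_derivative_eq_rhs, rule has_derivative_add, rule a, rule bounded_bilinear.FDERIV[OF bounded_bilinear_scaleC],
        rule nth, rule a, rule plane_vec_has_derivative) (simp add: fun_eq_iff algebra_simps)
  show ?thesis
    unfolding matrix_field_def d_matrix_field_def by (intro has_derivative_Pair middle nth point_velocity plane_velocity)
qed

lemma d_point_vec_d_matrix_field: "d_point_vec (d_matrix_field M z v) = d_point_velocity M z v"
  by (cases z; cases v) (auto simp: d_matrix_field_def d_point_velocity_def intro!: vec_index_eqI)

text \<open>
  The components of the field are entries of the velocities of \<open>W\<close> and \<open>L\<close>, so it suffices to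
  differentiate these velocities along each other. In the velocity of \<open>W\<close> along \<open>N\<close>, moving \<open>W\<close> along \<open>M\<close>
  gives \<open>N M W\<close> modulo \<open>W\<close> and terms symmetric in \<open>M\<close> and \<open>N\<close>, which the bracket removes.
\<close>

lemma vf_bracket_matrix_field: "vf_bracket (matrix_field M) (matrix_field N) z = matrix_field (commutator M N) z"
proof -
  have dir: "dir_deriv (matrix_field M) z v = d_matrix_field M z v" for M v
    using dir_deriv_eq[OF matrix_field_has_derivative[of M z UNIV]] by simp
  have "d_point_velocity N z (matrix_field M z) - d_point_velocity M z (matrix_field N z) = point_velocity (commutator M N) z"
    by (simp add: d_point_velocity_def d_point_vec_matrix_field point_velocity_def matrix_vector_mult_diff_distrib matrix_vector_scaleC matrix_commutator_vec
        vec_eq_iff algebra_simps)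
  moreover have "d_plane_velocity N z (matrix_field M z) - d_plane_velocity M z (matrix_field N z) = plane_velocity (commutator M N) z"
    by (simp add: d_plane_velocity_def d_plane_vec_matrix_field plane_velocity_def vector_matrix_add vector_matrix_scaleC vec_commutator_matrix
        vec_eq_iff algebra_simps)
  ultimately show ?thesis
    unfolding vf_bracket_def dir by (simp add: d_matrix_field_def matrix_field_def flip: middle_linear vector_minus_component)
qed

lemma restrict_zero_has_derivative:
  assumes "(F has_derivative F') (at w within M)" "w \<in> M"
  shows "(restrict_zero M F has_derivative F') (at w within M)"
  by (rule has_derivative_transform[OF assms(2) _ assms(1)]) (simp add: restrict_zero_def)

lemma cdiff_restrict_zero: "cdiff F w M \<Longrightarrow> w \<in> M \<Longrightarrow> cdiff (restrict_zero M F) w M"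
  unfolding cdiff_def using restrict_zero_has_derivative by blast

lemma vf_bracket_restrict_zero:
  fixes F G :: "'a::real_normed_vector \<Rightarrow> 'a"
  assumes "open U" "\<And>w. (F has_derivative F' w) (at w)" "\<And>w. (G has_derivative G' w) (at w)"
  shows "vf_bracket (restrict_zero U F) (restrict_zero U G) = restrict_zero U (vf_bracket F G)"
proof
  fix w :: 'a
  have zero: "dir_deriv H w 0 = 0" for H :: "'a \<Rightarrow> 'a"
    by (rule dir_deriv_eqI) simp
  show "vf_bracket (restrict_zero U F) (restrict_zero U G) w = restrict_zero U (vf_bracket F G) w"
  proof (cases "w \<in> U")
    case True
    have *: "dir_deriv (restrict_zero U H) w v = H' v \<and> dir_deriv H w v = H' v"
      if "(H has_derivative H') (at w)" for H H' v
      using dir_deriv_eq[OF restrict_zero_has_derivative[OF has_derivative_at_withinI[OF that] True]]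
        dir_deriv_eq[OF that] eventually_line_in_open[OF assms(1) True] by simp
    show ?thesis
      using *[OF assms(2)] *[OF assms(3)] True by (simp add: vf_bracket_def restrict_zero_def)
  next
    case False
    then have "restrict_zero U F w = 0" "restrict_zero U G w = 0" "restrict_zero U (vf_bracket F G) w = 0"
      by (simp_all add: restrict_zero_def)
    then show ?thesis by (simp add: vf_bracket_def zero)
  qed
qed

lemma tangent_spaceI:
  assumes "\<forall>\<^sub>F t in nhds (0::real). w + t *\<^sub>R v \<in> M" shows "v \<in> tangent_space M w"
proof -
  have "((\<lambda>t::real. w + t *\<^sub>R v) has_vector_derivative v) (at 0)"
    by (auto intro!: derivative_eq_intros)
  then show ?thesis
    unfolding tangent_space_def using assms by (intro CollectI exI[of _ "\<lambda>t. w + t *\<^sub>R v"]) simp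
qed

lemma tangent_space_linear:
  assumes "v \<in> tangent_space M w" "bounded_linear \<Lambda>" "\<And>z. z \<in> M \<Longrightarrow> \<Lambda> z = 0"
  shows "\<Lambda> v = 0"
proof -
  obtain \<gamma> where \<gamma>: "\<forall>\<^sub>F t in nhds (0::real). \<gamma> t \<in> M" "(\<gamma> has_vector_derivative v) (at 0)"
    using assms(1) unfolding tangent_space_def by blast
  have "((\<lambda>t. \<Lambda> (\<gamma> t)) has_vector_derivative \<Lambda> v) (at 0)"
    by (rule bounded_linear.has_vector_derivative[OF assms(2) \<gamma>(2)])
  then show ?thesis
    by (rule has_vector_derivative_eventually_zero) (rule eventually_mono[OF \<gamma>(1) assms(3)])
qed

text \<open>
  Infinitesimally moving the point \<open>W\<close> within the hyperplane \<open>L\<close> is the contact condition.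
\<close>

lemma contact1_iff: "y \<in> contact1 z \<longleftrightarrow> bil (plane_vec z) (d_point_vec y) = 0"
  by (cases z; cases y) (simp add: contact1_def bil_plane_d_point, auto simp: bil_def)

lemma contact2_iff: "w' \<in> contact2 w \<longleftrightarrow>
    bil (plane_vec (fst w)) (d_point_vec (fst w')) = 0 \<and> snd (snd (fst w')) = snd w *v fst (fst w')"
  by (cases w; cases w'; cases "fst w"; cases "fst w'")
     (simp add: contact2_def bil_plane_d_point, auto simp: bil_def vec_eq_iff matrix_vector_mult_def)

lemma section_derivative:
  assumes "(G has_derivative G') (at w within M)" "\<And>z. z \<in> M \<Longrightarrow> G z = 0" "\<forall>\<^sub>F t in nhds (0::real). w + t *\<^sub>R v \<in> M"
  shows "G' v = 0"
  using line_has_vector_derivative[OF assms(1,3)]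
  by (rule has_vector_derivative_eventually_zero) (rule eventually_mono[OF assms(3,2)])

text \<open>
  Here \<open>y\<close> is the value at \<open>z\<close> of a section of the contact distribution and \<open>y'\<close> its derivative along the
  field of \<open>M\<close>; the second premise is the derivative of the contact condition along that field. Both \<open>L \<cdot> dW y'\<close>
  and the contribution of the derivative of the field equal \<open>- (L M) \<cdot> dW y\<close>, so they cancel in the bracket.
\<close>

lemma contact_bracket:
  assumes "bil (plane_vec z) (d_point_vec y) = 0" "bil (plane_vec z) (d_point_vec y') + bil (d_plane_vec z (matrix_field M z)) (d_point_vec y) = 0"
  shows "bil (plane_vec z) (d_point_vec (y' - d_matrix_field M z y)) = 0"
proof -
  have "d_point_vec (y' - d_matrix_field M z y) = d_point_vec y' - d_point_velocity M z y"
    by (simp add: linear_diff[OF bounded_linear.linear[OF bounded_linear_d_point_vec]] d_point_vec_d_matrix_field)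
  moreover have "bil (plane_vec z) (d_point_velocity M z y) = - bil (plane_vec z v* M) (d_point_vec y)"
    using assms(1) by (simp add: d_point_velocity_def bil.add_right bil.diff_right bil_matrix[of "plane_vec z"])
  moreover have "bil (plane_vec z) (d_point_vec y') = - bil (plane_vec z v* M) (d_point_vec y)"
    using assms by (simp add: d_plane_vec_matrix_field plane_velocity_def bil.add_left add_eq_0_iff)
  ultimately show ?thesis
    by (simp add: bil.diff_right)
qed

lemma matrix_field_preserves_contact1:
  assumes "open U" shows "preserves U contact1 (restrict_zero U (matrix_field M))"
  unfolding preserves_def
proof (intro allI impI ballI, elim conjE)
  fix Y w assume Y: "vector_field_on U Y" "\<forall>w\<in>U. Y w \<in> contact1 w" and w: "w \<in> U"
  obtain Y' where Y': "(Y has_derivative Y') (at w within U)"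
    using Y(1) w by (auto simp: vector_field_on_def holomorphic_map_on_def)
  note ev = eventually_line_in_open[OF assms w]
  have "bil (plane_vec w) (d_point_vec (Y' (matrix_field M w))) + bil (d_plane_vec w (matrix_field M w)) (d_point_vec (Y w)) = 0"
    by (rule section_derivative[OF bil.FDERIV[OF plane_vec_has_derivative bounded_linear.has_derivative[OF bounded_linear_d_point_vec Y']] _ ev])
       (use Y(2) in \<open>simp add: contact1_iff\<close>)
  then have "bil (plane_vec w) (d_point_vec (Y' (matrix_field M w) - d_matrix_field M w (Y w))) = 0"
    using Y(2) w by (intro contact_bracket) (simp_all add: contact1_iff)
  moreover have "vf_bracket (restrict_zero U (matrix_field M)) Y w = Y' (matrix_field M w) - d_matrix_field M w (Y w)"
    using w dir_deriv_eq[OF Y' ev] dir_deriv_eq[OF restrict_zero_has_derivative[OF matrix_field_has_derivative w] ev]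
    by (simp add: vf_bracket_def) (simp add: restrict_zero_def)
  ultimately show "vf_bracket (restrict_zero U (matrix_field M)) Y w \<in> contact1 w"
    by (simp add: contact1_iff)
qed

lemma matrix_field_preserves_vertical:
  assumes "open U" shows "preserves U vertical (restrict_zero U (matrix_field M))"
  unfolding preserves_def
proof (intro allI impI ballI, elim conjE)
  fix Y w assume Y: "vector_field_on U Y" "\<forall>w\<in>U. Y w \<in> vertical w" and w: "w \<in> U"
  have vert: "y \<in> vertical z \<longleftrightarrow> d_point_vec y = 0" for y and z :: "'a jet1"
    by (cases y) (auto simp: vertical_def d_point_vec_def vec_eq_iff all_index)
  obtain Y' where Y': "(Y has_derivative Y') (at w within U)"
    using Y(1) w by (auto simp: vector_field_on_def holomorphic_map_on_def)
  note ev = eventually_line_in_open[OF assms w]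
  have "d_point_vec (Y' (matrix_field M w)) = 0"
    by (rule section_derivative[OF bounded_linear.has_derivative[OF bounded_linear_d_point_vec Y'] _ ev])
       (use Y(2) in \<open>simp add: vert\<close>)
  moreover have "d_point_vec (d_matrix_field M w (Y w)) = 0"
    using Y(2) w by (simp add: d_point_vec_d_matrix_field d_point_velocity_def vert)
  moreover have "vf_bracket (restrict_zero U (matrix_field M)) Y w = Y' (matrix_field M w) - d_matrix_field M w (Y w)"
    using w dir_deriv_eq[OF Y' ev] dir_deriv_eq[OF restrict_zero_has_derivative[OF matrix_field_has_derivative w] ev]
    by (simp add: vf_bracket_def) (simp add: restrict_zero_def)
  ultimately show "vf_bracket (restrict_zero U (matrix_field M)) Y w \<in> vertical w"
    by (simp add: vert linear_diff[OF bounded_linear.linear[OF bounded_linear_d_point_vec]])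
qed

lemma vector_field_restrict_zero:
  assumes "open U" "\<And>w. w \<in> U \<Longrightarrow> cdiff F w U"
  shows "vector_field_on U (restrict_zero U F)"
  unfolding vector_field_on_def holomorphic_map_on_iff_cdiff
proof (intro conjI ballI allI impI)
  fix w assume w: "w \<in> U"
  show "cdiff (restrict_zero U F) w U" by (rule cdiff_restrict_zero[OF assms(2)[OF w] w])
  show "restrict_zero U F w \<in> tangent_space U w"
    by (rule tangent_spaceI[OF eventually_line_in_open[OF assms(1) w]])
qed (simp add: restrict_zero_def)

lemma matrix_field_vector_field:
  assumes "open U" shows "vector_field_on U (restrict_zero U (matrix_field M))"
  by (rule vector_field_restrict_zero[OF assms cdiffI[OF matrix_field_has_derivative]]) (rule d_matrix_field_scaleC)

lemma eventually_line_in_jet2: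
  fixes z x :: "'n::finite jet1"
  assumes "open U" "z \<in> U" "transpose h = h" "transpose \<theta> = \<theta>"
  shows "\<forall>\<^sub>F t in nhds (0::real). (z, h) + t *\<^sub>R (x, \<theta>) \<in> jet2_over U"
  using eventually_line_in_open[OF assms(1,2), of x]
proof (rule eventually_mono)
  fix t assume "z + t *\<^sub>R x \<in> U"
  moreover have "transpose (h + t *\<^sub>R \<theta>) = h + t *\<^sub>R \<theta>"
    using assms(3,4) by (simp add: vec_eq_iff transpose_def)
  ultimately show "(z, h) + t *\<^sub>R (x, \<theta>) \<in> jet2_over U"
    by (simp add: jet2_over_def)
qed

lemma tangent_space_jet2:
  assumes "v \<in> tangent_space (jet2_over U) w" shows "transpose (snd v) = snd v"
proof -
  have "snd v $ i $ j - snd v $ j $ i = 0" for i j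
  proof (rule tangent_space_linear[OF assms])
    show "bounded_linear (\<lambda>v :: 'a jet2. snd v $ i $ j - snd v $ j $ i)"
      by (intro bounded_linear_sub bounded_linear_compose[OF bounded_linear_vec_nth]
          bounded_linear_compose[OF bounded_linear_vec_nth bounded_linear_snd])
    fix w :: "'a jet2" assume "w \<in> jet2_over U"
    then have "transpose (snd w) = snd w" by (auto simp: jet2_over_def)
    then have "transpose (snd w) $ j $ i = snd w $ j $ i" by simp
    then show "snd w $ i $ j - snd w $ j $ i = 0" by (simp add: transpose_def)
  qed
  then show ?thesis by (simp add: vec_eq_iff transpose_def)
qed

text \<open>
  The derivative \<open>(\<partial>L/\<partial>u\<^sub>j) M (dW/dx\<^sup>k)\<close>, which is the common source of the derivatives
  of \<open>\<xi>\<close> and \<open>\<pi>\<close> along the contact distribution; see \<open>affine_block_derivatives\<close>.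
\<close>

definition affine_block :: "complex ^ ('n + 2) ^ ('n + 2) \<Rightarrow> 'n::finite jet1 \<Rightarrow> complex ^ 'n ^ 'n"
  where "affine_block M = (\<lambda>(x, u, p). \<chi> j k. M $ Inl j $ Inl k + p $ k * M $ Inl j $ Inr 2
     - x $ j * (M $ Inr 1 $ Inl k + p $ k * M $ Inr 1 $ Inr 2))"

text \<open>
  The coefficient of \<open>\<partial>/\<partial>u\<^sub>i\<^sub>j\<close> in the prolongation, \<open>D\<^sub>i \<pi>\<^sub>k - u\<^sub>k\<^sub>j D\<^sub>i \<xi>\<^sup>j\<close> with the second-order total
  derivative \<open>D\<^sub>i\<close>. It is linear in \<open>h = (u\<^sub>i\<^sub>j)\<close>, so the prolonged field is tangent to \<open>h = 0\<close>.
\<close>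

definition prolongation_part :: "complex ^ ('n + 2) ^ ('n + 2) \<Rightarrow> 'n::finite jet1 \<Rightarrow> complex ^ 'n ^ 'n \<Rightarrow> complex ^ 'n ^ 'n"
  where "prolongation_part M z h = transpose (h ** affine_block M z) + h ** affine_block M z
     + ((plane_vec z v* M) $ Inr 2 - (M *v point_vec z) $ Inr 1) *\<^sub>C h"

definition matrix_field2 :: "complex ^ ('n + 2) ^ ('n + 2) \<Rightarrow> 'n::finite jet2 \<Rightarrow> 'n jet2"
  where "matrix_field2 M w = (matrix_field M (fst w), prolongation_part M (fst w) (snd w))"

lemma transpose_add: "transpose (A + B) = transpose A + transpose B"
  by (simp add: vec_eq_iff transpose_def)

lemma transpose_scaleC: "transpose (c *\<^sub>C A) = c *\<^sub>C transpose A"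
  by (simp add: vec_eq_iff transpose_def)

lemma transpose_prolongation_part: "transpose h = h \<Longrightarrow> transpose (prolongation_part M z h) = prolongation_part M z h"
  by (simp add: prolongation_part_def transpose_add transpose_scaleC add.commute)

lemma prolongation_part_vector: "transpose h = h \<Longrightarrow> prolongation_part M z h *v y = transpose (affine_block M z) *v (h *v y) + h *v (affine_block M z *v y)
    + ((plane_vec z v* M) $ Inr 2 - (M *v point_vec z) $ Inr 1) *\<^sub>C (h *v y)"
proof -
  have "(c *\<^sub>C h) *v y = c *\<^sub>C (h *v y)" for c
    by (simp add: vec_eq_iff matrix_vector_mult_def sum_distrib_left mult_ac)
  then show "transpose h = h \<Longrightarrow> ?thesis"
    unfolding prolongation_part_def matrix_vector_mult_add_rdistrib by (simp add: matrix_transpose_mul matrix_vector_mul_assoc)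
qed

lemma affine_block_derivatives:
  assumes "bil (plane_vec z) (d_point_vec (\<xi>, \<eta>, \<pi>)) = 0"
  shows "middle (d_point_velocity M z (\<xi>, \<eta>, \<pi>)) = (M *v point_vec z) $ Inr 1 *\<^sub>C \<xi> - affine_block M z *v \<xi>"
    and "middle (d_plane_velocity M z (\<xi>, \<eta>, \<pi>)) = transpose (affine_block M z) *v \<pi> + (plane_vec z v* M) $ Inr 2 *\<^sub>C \<pi>"
proof -
  obtain x u p where z: "z = (x, u, p)" by (cases z)
  have \<eta>: "\<eta> = bil p \<xi>" using assms by (simp add: z bil_plane_d_point)
  have "(M *v d_point_vec (\<xi>, \<eta>, \<pi>)) $ r = (\<Sum>i\<in>UNIV. (M $ r $ Inl i + p $ i * M $ r $ Inr 2) * \<xi> $ i)" for r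
    by (simp add: matrix_vector_mult_def sum_index \<eta> bil_def sum_distrib_left sum.distrib algebra_simps)
  moreover have "(affine_block M z *v \<xi>) $ j = (\<Sum>k\<in>UNIV. (M $ Inl j $ Inl k + p $ k * M $ Inl j $ Inr 2
     - x $ j * (M $ Inr 1 $ Inl k + p $ k * M $ Inr 1 $ Inr 2)) * \<xi> $ k)" for j
    by (simp add: matrix_vector_mult_def affine_block_def z)
  ultimately show "middle (d_point_velocity M z (\<xi>, \<eta>, \<pi>)) = (M *v point_vec z) $ Inr 1 *\<^sub>C \<xi> - affine_block M z *v \<xi>"
    unfolding d_point_velocity_def
    by (simp add: z vec_eq_iff
        sum_distrib_left sum_distrib_right sum_subtractf sum.distrib algebra_simps)
  have d: "(d_plane_vec z (\<xi>, \<eta>, \<pi>) v* M) $ s = (\<Sum>j\<in>UNIV. (M $ Inl j $ s - x $ j * M $ Inr 1 $ s) * \<pi> $ j)" for s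
    by (simp add: vector_matrix_mult_def sum_index z \<eta>, simp add: bil_def sum_distrib_left sum_subtractf algebra_simps)
  have t: "(transpose (affine_block M z) *v \<pi>) $ k = (\<Sum>j\<in>UNIV. (M $ Inl j $ Inl k + p $ k * M $ Inl j $ Inr 2
     - x $ j * (M $ Inr 1 $ Inl k + p $ k * M $ Inr 1 $ Inr 2)) * \<pi> $ j)" for k
    by (simp add: matrix_vector_mult_def transpose_def affine_block_def z del: transpose_matrix_vector)
  have "(d_plane_vec z (\<xi>, \<eta>, \<pi>) v* M) $ Inl k + p $ k * (d_plane_vec z (\<xi>, \<eta>, \<pi>) v* M) $ Inr 2 = (transpose (affine_block M z) *v \<pi>) $ k" for k
    unfolding d t by (simp add: sum_distrib_left sum_subtractf sum.distrib algebra_simps)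
  then show "middle (d_plane_velocity M z (\<xi>, \<eta>, \<pi>)) = transpose (affine_block M z) *v \<pi> + (plane_vec z v* M) $ Inr 2 *\<^sub>C \<pi>"
    by (simp add: d_plane_velocity_def z vec_eq_iff mult.commute del: transpose_matrix_vector)
qed

lemma cdiff_matrix_field2: "cdiff (matrix_field2 M) w S"
proof -
  have lin: "cdiff (\<lambda>w :: 'a jet2. fst (fst w) $ i) w S" "cdiff (\<lambda>w :: 'a jet2. fst (snd (fst w))) w S"
    "cdiff (\<lambda>w :: 'a jet2. snd (snd (fst w)) $ i) w S" "cdiff (\<lambda>w :: 'a jet2. snd w $ i $ j) w S" for i j
    by (intro cdiff_linear; simp add: bounded_linear_compose[OF bounded_linear_vec_nth] bounded_linear_compose[OF bounded_linear_fst]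
        bounded_linear_compose[OF bounded_linear_snd] bounded_linear_fst bounded_linear_snd)+
  have "\<forall>r. cdiff (\<lambda>w :: 'a jet2. point_vec (fst w) $ r) w S"
    unfolding all_index by (simp add: point_vec_def case_prod_beta cdiff_const lin)
  then have b: "cdiff (\<lambda>w :: 'a jet2. (M *v point_vec (fst w)) $ r) w S" for r
    unfolding matrix_vector_mult_def by (simp, intro cdiff_sum cdiff_mult cdiff_const) simp
  have "\<forall>r. cdiff (\<lambda>w :: 'a jet2. plane_vec (fst w) $ r) w S"
    unfolding all_index by (simp add: plane_vec_def case_prod_beta bil_def lin) (intro conjI cdiff_diff cdiff_sum cdiff_mult cdiff_const lin)
  then have a: "cdiff (\<lambda>w :: 'a jet2. (plane_vec (fst w) v* M) $ r) w S" for r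
    unfolding vector_matrix_mult_def by (simp, intro cdiff_sum cdiff_mult cdiff_const) simp
  have "cdiff (\<lambda>w. matrix_field M (fst w)) w S"
    by (rule cdiffI[OF has_derivative_compose[OF has_derivative_fst[OF has_derivative_ident] matrix_field_has_derivative]])
       (simp add: d_matrix_field_scaleC)
  moreover have "cdiff (\<lambda>w. prolongation_part M (fst w) (snd w)) w S"
    by (intro cdiff_vec)
       (simp add: prolongation_part_def affine_block_def transpose_def matrix_matrix_mult_def case_prod_beta,
        intro cdiff_add cdiff_sum cdiff_mult cdiff_diff cdiff_const lin a b)
  ultimately show ?thesis
    unfolding matrix_field2_def by (rule cdiff_Pair)
qed

lemma matrix_field2_line:
  assumes "open U" "w \<in> jet2_over U"
  shows "\<forall>\<^sub>F t in nhds (0::real). w + t *\<^sub>R matrix_field2 M w \<in> jet2_over U"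
proof (cases w)
  case (Pair z h)
  then have "z \<in> U" "transpose h = h" using assms(2) by (auto simp: jet2_over_def)
  then show ?thesis
    unfolding matrix_field2_def Pair fst_conv snd_conv by (intro eventually_line_in_jet2 assms(1) transpose_prolongation_part)
qed

text \<open>
  The first contact condition is treated as on first jets. The second one, \<open>\<pi> = h \<xi>\<close>, is
  differentiated along the prolonged field; the derivative of \<open>h\<close> contributes \<open>prolongation_part\<close>,
  which is made to compensate the derivatives of the \<open>\<xi>\<close> and \<open>\<pi>\<close> components of the field.
\<close>

lemma matrix_field2_preserves_contact2:
  assumes "open U" shows "preserves (jet2_over U) contact2 (restrict_zero (jet2_over U) (matrix_field2 M))"
  unfolding preserves_def
proof (intro allI impI ballI, elim conjE)
  let ?J = "jet2_over U" and ?X = "restrict_zero (jet2_over U) (matrix_field2 M)"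
  fix Y :: "'a jet2 \<Rightarrow> 'a jet2" and w assume Y: "vector_field_on ?J Y" "\<forall>w\<in>?J. Y w \<in> contact2 w" and w: "w \<in> ?J"
  obtain z h where zh: "w = (z, h)" by (cases w)
  have z: "z \<in> U" and h: "transpose h = h" using w by (auto simp: zh jet2_over_def)
  obtain \<xi> \<eta> \<pi> \<kappa> where y: "Y w = ((\<xi>, \<eta>, \<pi>), \<kappa>)" by (metis surj_pair)
  obtain Y' where Y': "(Y has_derivative Y') (at w within ?J)"
    using Y(1) w by (auto simp: vector_field_on_def holomorphic_map_on_def)
  obtain \<xi>' \<eta>' \<pi>' \<kappa>' where y': "Y' (matrix_field2 M w) = ((\<xi>', \<eta>', \<pi>'), \<kappa>')" by (metis surj_pair)
  have sec: "bil (plane_vec z) (d_point_vec (\<xi>, \<eta>, \<pi>)) = 0" "\<pi> = h *v \<xi>"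
    using Y(2) w y by (force simp: contact2_iff zh)+
  note ev = matrix_field2_line[OF assms w, of M]
  have "Y w \<in> tangent_space ?J w"
    using Y(1) w by (auto simp: vector_field_on_def)
  then have \<kappa>: "transpose \<kappa> = \<kappa>" using tangent_space_jet2 y by fastforce
  have evY: "\<forall>\<^sub>F t in nhds (0::real). w + t *\<^sub>R Y w \<in> ?J"
    unfolding y unfolding zh by (rule eventually_line_in_jet2[OF assms z h \<kappa>])
  obtain X' where X': "(matrix_field2 M has_derivative X') (at w within ?J)"
    using cdiff_matrix_field2[of M w ?J] unfolding cdiff_def by blast
  have d1: "((\<lambda>w. matrix_field M (fst w)) has_derivative (\<lambda>v. fst (X' v))) (at w within ?J)"
    using has_derivative_fst[OF X'] by (simp add: matrix_field2_def)
  have d2: "((\<lambda>w. matrix_field M (fst w)) has_derivative (\<lambda>v. d_matrix_field M z (fst v))) (at w within ?J)"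
    using has_derivative_compose[OF has_derivative_fst[OF has_derivative_ident] matrix_field_has_derivative, of M w ?J] by (simp add: zh)
  have "fst (X' (Y w)) = d_matrix_field M z (fst (Y w))"
    by (rule vector_derivative_unique_at[OF line_has_vector_derivative[OF d1 evY] line_has_vector_derivative[OF d2 evY]])
  then have X'Y: "fst (X' (Y w)) = d_matrix_field M z (\<xi>, \<eta>, \<pi>)" by (simp add: y)
  have br: "vf_bracket ?X Y w = Y' (matrix_field2 M w) - X' (Y w)"
    using w dir_deriv_eq[OF Y' ev] dir_deriv_eq[OF restrict_zero_has_derivative[OF X' w] evY]
    by (simp add: vf_bracket_def) (simp add: restrict_zero_def)
  have "bil (plane_vec (fst w)) (d_point_vec (fst (Y' (matrix_field2 M w)))) + bil (d_plane_vec (fst w) (fst (matrix_field2 M w))) (d_point_vec (fst (Y w))) = 0"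
    by (rule section_derivative[OF bil.FDERIV[OF has_derivative_compose[OF has_derivative_fst[OF has_derivative_ident] plane_vec_has_derivative]
          bounded_linear.has_derivative[OF bounded_linear_d_point_vec has_derivative_fst[OF Y']]] _ ev])
       (use Y(2) in \<open>simp add: contact2_iff\<close>)
  then have c1: "bil (plane_vec z) (d_point_vec ((\<xi>', \<eta>', \<pi>') - d_matrix_field M z (\<xi>, \<eta>, \<pi>))) = 0"
    unfolding y y' by (intro contact_bracket sec) (simp add: zh matrix_field2_def)
  have mvd: "((\<lambda>w. snd w *v fst (fst (Y w))) has_derivative (\<lambda>v. snd w *v fst (fst (Y' v)) + snd v *v fst (fst (Y w)))) (at w within ?J)"
    by (rule bounded_bilinear.FDERIV[of "\<lambda>A x. A *v x", OF _ has_derivative_snd[OF has_derivative_ident] has_derivative_fst[OF has_derivative_fst[OF Y']]])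
       (auto simp: bilinear_conv_bounded_bilinear[symmetric] bilinear_def vec_eq_iff matrix_vector_mult_def sum.distrib algebra_simps scaleR_sum_right intro!: linearI)
  have "snd (snd (fst (Y' (matrix_field2 M w)))) - (snd w *v fst (fst (Y' (matrix_field2 M w))) + snd (matrix_field2 M w) *v fst (fst (Y w))) = 0"
    by (rule section_derivative[OF has_derivative_diff[OF has_derivative_snd[OF has_derivative_snd[OF has_derivative_fst[OF Y']]] mvd] _ ev])
       (use Y(2) in \<open>simp add: contact2_iff\<close>)
  then have "\<pi>' = h *v \<xi>' + prolongation_part M z h *v \<xi>"
    unfolding y y' by (simp add: zh matrix_field2_def)
  then have "\<pi>' - middle (d_plane_velocity M z (\<xi>, \<eta>, \<pi>)) = h *v (\<xi>' - middle (d_point_velocity M z (\<xi>, \<eta>, \<pi>)))"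
    unfolding affine_block_derivatives[OF sec(1)] prolongation_part_vector[OF h] matrix_vector_mult_diff_distrib matrix_vector_scaleC sec(2)[symmetric]
    by (simp add: vec_eq_iff algebra_simps)
  moreover have fstbr: "fst (vf_bracket ?X Y w) = (\<xi>', \<eta>', \<pi>') - d_matrix_field M z (\<xi>, \<eta>, \<pi>)"
    unfolding br by (simp add: y' X'Y)
  ultimately show "vf_bracket ?X Y w \<in> contact2 w"
    unfolding contact2_iff fstbr using c1 by (simp add: zh) (simp add: d_matrix_field_def)
qed

lemma prolongation_matrix_field:
  assumes "open U"
  shows "prolongation U (restrict_zero U (matrix_field M)) (restrict_zero (jet2_over U) (matrix_field2 M))"
  unfolding prolongation_def vector_field_on_def holomorphic_map_on_iff_cdiff
proof (intro conjI ballI allI impI matrix_field2_preserves_contact2[OF assms])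
  fix w assume w: "w \<in> jet2_over U"
  then show "cdiff (restrict_zero (jet2_over U) (matrix_field2 M)) w (jet2_over U)"
    by (intro cdiff_restrict_zero cdiff_matrix_field2)
  show "restrict_zero (jet2_over U) (matrix_field2 M) w \<in> tangent_space (jet2_over U) w"
    using w matrix_field2_line[OF assms w] by (intro tangent_spaceI) (simp add: restrict_zero_def)
  show "fst (restrict_zero (jet2_over U) (matrix_field2 M) w) = restrict_zero U (matrix_field M) (fst w)"
    using w by (auto simp: restrict_zero_def matrix_field2_def jet2_over_def)
qed (simp add: restrict_zero_def)

lemma flat_system_iff: "w \<in> flat_system U \<longleftrightarrow> fst w \<in> U \<and> snd w = 0"
  by (cases w) (auto simp: flat_system_def jet2_over_def vec_eq_iff transpose_def)

lemma matrix_field_point_symmetry: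
  assumes "open U"
  shows "restrict_zero U (matrix_field M) \<in> point_symmetries U (flat_system U)"
  unfolding point_symmetries_def contact_vector_field_def
proof (intro CollectI conjI exI[of _ "restrict_zero (jet2_over U) (matrix_field2 M)"] ballI
    matrix_field_vector_field matrix_field_preserves_contact1 matrix_field_preserves_vertical prolongation_matrix_field assms)
  fix w assume w: "w \<in> flat_system U"
  have z: "prolongation_part M (fst w) 0 = 0"
    by (simp add: prolongation_part_def vec_eq_iff transpose_def)
  have "w \<in> jet2_over U" using w by (auto simp: flat_system_def)
  then have "restrict_zero (jet2_over U) (matrix_field2 M) w = (matrix_field M (fst w), 0)"
    using w z by (simp add: restrict_zero_def matrix_field2_def flat_system_iff)
  then show "restrict_zero (jet2_over U) (matrix_field2 M) w \<in> tangent_space (flat_system U) w"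
    using w eventually_line_in_open[OF assms, of "fst w" "matrix_field M (fst w)"]
    by (intro tangent_spaceI) (auto simp: flat_system_iff)
qed

section \<open>Rigidity of one-variable families\<close>

text \<open>
  Used to differentiate an identity in \<open>t\<close> that only holds near 0, several times.
\<close>

lemma eventually_deriv_zero:
  fixes g g' :: "complex \<Rightarrow> complex"
  assumes "\<forall>\<^sub>F t in nhds 0. g t = 0" "\<forall>\<^sub>F t in nhds 0. (g has_field_derivative g' t) (at t)"
  shows "\<forall>\<^sub>F t in nhds 0. g' t = 0"
proof -
  obtain S where S: "open S" "0 \<in> S" "\<And>t. t \<in> S \<Longrightarrow> g t = 0" "\<And>t. t \<in> S \<Longrightarrow> (g has_field_derivative g' t) (at t)"
    using eventually_conj[OF assms] unfolding eventually_nhds by blast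
  have "g' t = 0" if "t \<in> S" for t
  proof -
    have "((\<lambda>_. 0) has_field_derivative g' t) (at t)"
      by (rule has_field_derivative_transform_within_open[OF S(4)[OF that] S(1) that S(3)])
    then show ?thesis using DERIV_unique[OF _ DERIV_const] by blast
  qed
  then show ?thesis using S(1,2) eventually_nhds by blast
qed

lemma deriv_eq_on_open:
  assumes "open S" "\<And>c. c \<in> S \<Longrightarrow> f c = g c" "c \<in> S"
  shows "deriv f c = deriv (g :: complex \<Rightarrow> complex) c"
  using assms by (intro deriv_cong_ev eventually_nhds[THEN iffD2]) auto

lemma deriv_eq_0_const:
  assumes "open S" "convex S" "f holomorphic_on S" "\<And>c. c \<in> S \<Longrightarrow> deriv f c = 0"
  shows "\<exists>k. \<forall>c\<in>S. f c = k"
proof (rule has_field_derivative_zero_constant[OF assms(2)])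
  fix c assume "c \<in> S"
  then show "(f has_field_derivative 0) (at c within S)"
    using holomorphic_derivI[OF assms(3,1), of c S] assms(4) by simp
qed

lemma deriv2_eq_0_affine:
  assumes "open S" "convex S" "f holomorphic_on S" "\<And>c. c \<in> S \<Longrightarrow> deriv (deriv f) c = 0"
  shows "\<exists>a b. \<forall>c\<in>S. f c = a + b * c"
proof -
  obtain b where b: "\<And>c. c \<in> S \<Longrightarrow> deriv f c = b"
    using deriv_eq_0_const[OF assms(1,2) holomorphic_deriv[OF assms(3,1)]] assms(4) by blast
  have d: "((\<lambda>c. f c - b * c) has_field_derivative 0) (at c)" if "c \<in> S" for c
    using holomorphic_derivI[OF assms(3,1) that] b[OF that] by (auto intro!: derivative_eq_intros)
  have "\<exists>a. \<forall>c\<in>S. f c - b * c = a"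
    using d by (intro has_field_derivative_zero_constant assms(2)) (auto intro: has_field_derivative_at_within)
  then show ?thesis by (metis diff_add_cancel)
qed

lemma deriv3_eq_0_quadratic:
  assumes "open S" "convex S" "f holomorphic_on S" "\<And>c. c \<in> S \<Longrightarrow> deriv (deriv (deriv f)) c = 0" "u \<in> S"
  shows "\<exists>a b. \<forall>c\<in>S. f c = a + b * c + deriv (deriv f) u / 2 * c\<^sup>2"
proof -
  obtain k where k: "\<And>c. c \<in> S \<Longrightarrow> deriv (deriv f) c = k"
    using deriv_eq_0_const[OF assms(1,2) holomorphic_deriv[OF holomorphic_deriv[OF assms(3,1)] assms(1)]] assms(4) by blast
  let ?g = "\<lambda>c. f c - k / 2 * c\<^sup>2"
  have d: "(?g has_field_derivative deriv f c - k * c) (at c)" if "c \<in> S" for c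
    using holomorphic_derivI[OF assms(3,1) that] by (auto intro!: derivative_eq_intros)
  have "\<exists>a b. \<forall>c\<in>S. ?g c = a + b * c"
  proof (rule deriv2_eq_0_affine[OF assms(1,2)])
    show "?g holomorphic_on S" by (intro holomorphic_intros assms(3))
    fix c assume c: "c \<in> S"
    have "deriv (deriv ?g) c = deriv (\<lambda>c. deriv f c - k * c) c"
      by (rule deriv_eq_on_open[OF assms(1) DERIV_imp_deriv[OF d] c])
    also have "\<dots> = deriv (deriv f) c - k"
      using holomorphic_derivI[OF holomorphic_deriv[OF assms(3,1)] assms(1) c]
      by (intro DERIV_imp_deriv) (auto intro!: derivative_eq_intros)
    finally show "deriv (deriv ?g) c = 0" using k[OF c] by simp
  qed
  then obtain a b where "\<And>c. c \<in> S \<Longrightarrow> ?g c = a + b * c" by blast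
  then have "\<And>c. c \<in> S \<Longrightarrow> f c = a + b * c + k / 2 * c\<^sup>2" by (simp add: diff_eq_eq)
  then show ?thesis using k[OF assms(5)] by blast
qed

text \<open>
  The one-variable core. For a parameter \<open>m\<close> let \<open>A = A0 + m A1\<close>, \<open>R = R0 + m R1\<close>, \<open>q = q0 + m q1\<close>
  and \<open>c = u - t q\<close>. The function \<open>h = A(c) + t (R(c) + q A'(c))\<close> is assumed to have vanishing second
  differences on \<open>m = 0, 1, 2\<close> and on \<open>m = 1, 2, 3\<close>. At \<open>t = 0\<close> its derivatives are
  \<open>\<partial>\<^sub>t\<^sup>2 h = - 2 q R' - q\<^sup>2 A''\<close> and \<open>\<partial>\<^sub>t\<^sup>3 h = 3 q\<^sup>2 R'' + 2 q\<^sup>3 A'''\<close>. The first one is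
  a cubic polynomial in \<open>m\<close> with vanishing second differences, so its coefficients of \<open>m\<^sup>3\<close> and
  \<open>m\<^sup>2\<close> are zero: \<open>A1'' = 0\<close> and \<open>R1' = - q1 A0'' / 2\<close>. Inserting the derivatives of these relations makes
  the second one cubic as well, and its coefficients give \<open>A0''' = 0\<close> and \<open>R0'' = 0\<close>.
\<close>

lemma scalar_rigidity:
  fixes A0 A1 R0 R1 :: "complex \<Rightarrow> complex" and q0 q1 :: complex
  assumes S: "open S" and hol: "A0 holomorphic_on S" "A1 holomorphic_on S" "R0 holomorphic_on S" "R1 holomorphic_on S"
    and q1: "q1 \<noteq> 0"
  defines "h \<equiv> \<lambda>m t u. A0 (u - t * (q0 + m * q1)) + m * A1 (u - t * (q0 + m * q1))
      + t * (R0 (u - t * (q0 + m * q1)) + m * R1 (u - t * (q0 + m * q1))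
        + (q0 + m * q1) * (deriv A0 (u - t * (q0 + m * q1)) + m * deriv A1 (u - t * (q0 + m * q1))))"
  assumes h: "\<And>u. u \<in> S \<Longrightarrow> \<forall>\<^sub>F t in nhds 0. h 0 t u - 2 * h 1 t u + h 2 t u = 0"
    "\<And>u. u \<in> S \<Longrightarrow> \<forall>\<^sub>F t in nhds 0. h 1 t u - 2 * h 2 t u + h 3 t u = 0"
  shows "\<And>u. u \<in> S \<Longrightarrow> deriv (deriv A1) u = 0"
    and "\<And>u. u \<in> S \<Longrightarrow> deriv R1 u = - q1 * deriv (deriv A0) u / 2"
    and "\<And>u. u \<in> S \<Longrightarrow> deriv (deriv (deriv A0)) u = 0"
    and "\<And>u. u \<in> S \<Longrightarrow> deriv (deriv R0) u = 0"
proof -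
  define A where "A m k c = (deriv ^^ k) A0 c + m * (deriv ^^ k) A1 c" for m k c
  define R where "R m k c = (deriv ^^ k) R0 c + m * (deriv ^^ k) R1 c" for m k c
  have hd: "((deriv ^^ k) f has_field_derivative (deriv ^^ Suc k) f c) (at c)"
    if "f holomorphic_on S" "c \<in> S" for f k c
    using holomorphic_derivI[OF holomorphic_higher_deriv[OF that(1) S] S that(2), of k UNIV] by simp
  have A': "(A m k has_field_derivative A m (Suc k) c) (at c)"
    and R': "(R m k has_field_derivative R m (Suc k) c) (at c)" if "c \<in> S" for m k c
    unfolding A_def R_def using hd[OF hol(1) that, of k] hd[OF hol(2) that, of k] hd[OF hol(3) that, of k] hd[OF hol(4) that, of k]
    by (auto intro!: derivative_eq_intros simp del: funpow.simps)
  define q where "q m = q0 + m * q1" for m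
  define H1 where "H1 u m t = R m 0 (u - t * q m) - t * q m * (R m 1 (u - t * q m) + q m * A m 2 (u - t * q m))" for u m t
  define H2 where "H2 u m t = - 2 * q m * R m 1 (u - t * q m) - (q m)\<^sup>2 * A m 2 (u - t * q m)
    + t * (q m)\<^sup>2 * (R m 2 (u - t * q m) + q m * A m 3 (u - t * q m))" for u m t
  define H3 where "H3 u m t = 3 * (q m)\<^sup>2 * R m 2 (u - t * q m) + 2 * (q m)^3 * A m 3 (u - t * q m)
    - t * (q m)^3 * (R m 3 (u - t * q m) + q m * A m 4 (u - t * q m))" for u m t
  have h_alt: "h m t u = A m 0 (u - t * q m) + t * (R m 0 (u - t * q m) + q m * A m 1 (u - t * q m))" for m t u
    by (simp add: h_def A_def R_def q_def)
  have ev: "\<forall>\<^sub>F t in nhds 0. u - t * q m \<in> S" if "u \<in> S" for u m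
  proof -
    have "open ((\<lambda>t. u - t * q m) -` S)" by (intro open_vimage S continuous_intros)
    then show ?thesis unfolding eventually_nhds using that by (intro exI[of _ "(\<lambda>t. u - t * q m) -` S"]) auto
  qed
  have chain: "((\<lambda>t. A m k (u - t * q m)) has_field_derivative - q m * A m (Suc k) (u - t * q m)) (at t)"
    "((\<lambda>t. R m k (u - t * q m)) has_field_derivative - q m * R m (Suc k) (u - t * q m)) (at t)"
    if "u - t * q m \<in> S" for m k u t
  proof -
    have l: "((\<lambda>t. u - t * q m) has_field_derivative - q m) (at t)"
      by (auto intro!: derivative_eq_intros)
    show "((\<lambda>t. A m k (u - t * q m)) has_field_derivative - q m * A m (Suc k) (u - t * q m)) (at t)"
      "((\<lambda>t. R m k (u - t * q m)) has_field_derivative - q m * R m (Suc k) (u - t * q m)) (at t)"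
      using DERIV_chain2[OF A'[OF that] l] DERIV_chain2[OF R'[OF that] l] by (simp_all add: mult.commute)
  qed
  note num = numeral_2_eq_2 numeral_3_eq_3
  have d1: "((\<lambda>t. h m t u) has_field_derivative H1 u m t) (at t)"
    and d2: "(H1 u m has_field_derivative H2 u m t) (at t)"
    and d3: "(H2 u m has_field_derivative H3 u m t) (at t)" if "u - t * q m \<in> S" for m t u
  proof -
    have s: "Suc 0 = 1" "Suc 1 = 2" "Suc 2 = 3" "Suc 3 = 4" by simp_all
    note cs = chain(1)[OF that, of 0, unfolded s] chain(1)[OF that, of 1, unfolded s] chain(1)[OF that, of 2, unfolded s]
      chain(1)[OF that, of 3, unfolded s] chain(2)[OF that, of 0, unfolded s] chain(2)[OF that, of 1, unfolded s]
      chain(2)[OF that, of 2, unfolded s]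
    show "((\<lambda>t. h m t u) has_field_derivative H1 u m t) (at t)"
      unfolding h_alt H1_def
      by (rule DERIV_cong, rule DERIV_add, rule cs(1), rule DERIV_mult, rule DERIV_ident, rule DERIV_add, rule cs(5), rule DERIV_mult, rule DERIV_const, rule cs(2))
        (simp add: algebra_simps power2_eq_square power3_eq_cube)
    show "(H1 u m has_field_derivative H2 u m t) (at t)"
      unfolding H1_def[abs_def] H2_def
      by (rule DERIV_cong, rule DERIV_diff, rule cs(5), rule DERIV_mult, rule DERIV_mult, rule DERIV_ident, rule DERIV_const, rule DERIV_add, rule cs(6), rule DERIV_mult, rule DERIV_const, rule cs(3))
        (simp add: algebra_simps power2_eq_square power3_eq_cube)
    show "(H2 u m has_field_derivative H3 u m t) (at t)"
      unfolding H2_def[abs_def] H3_def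
      by (rule DERIV_cong, rule DERIV_add, rule DERIV_diff, rule DERIV_mult, rule DERIV_const, rule cs(6), rule DERIV_mult, rule DERIV_const, rule cs(3), rule DERIV_mult, rule DERIV_mult, rule DERIV_ident, rule DERIV_const, rule DERIV_add, rule cs(7), rule DERIV_mult, rule DERIV_const, rule cs(4))
        (simp add: algebra_simps power2_eq_square power3_eq_cube)
  qed
  have comb: "\<forall>\<^sub>F t in nhds 0. K' a t - 2 * K' b t + K' c t = 0"
    if u: "u \<in> S" and K: "\<forall>\<^sub>F t in nhds 0. K a t - 2 * K b t + K c t = 0"
      and d: "\<And>m t. u - t * q m \<in> S \<Longrightarrow> (K m has_field_derivative K' m t) (at t)" for u K K' a b c
  proof (rule eventually_deriv_zero[OF K])
    show "\<forall>\<^sub>F t in nhds 0. ((\<lambda>t. K a t - 2 * K b t + K c t) has_field_derivative K' a t - 2 * K' b t + K' c t) (at t)"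
      using ev[OF u, of a] ev[OF u, of b] ev[OF u, of c]
      by eventually_elim (auto intro!: derivative_eq_intros d)
  qed
  have E: "H2 u a 0 - 2 * H2 u b 0 + H2 u c 0 = 0" "H3 u a 0 - 2 * H3 u b 0 + H3 u c 0 = 0"
    if u: "u \<in> S" and k: "\<forall>\<^sub>F t in nhds 0. h a t u - 2 * h b t u + h c t u = 0" for u a b c
  proof -
    note e2 = comb[OF u comb[OF u k d1] d2]
    show "H2 u a 0 - 2 * H2 u b 0 + H2 u c 0 = 0" "H3 u a 0 - 2 * H3 u b 0 + H3 u c 0 = 0"
      using eventually_nhds_x_imp_x[OF e2] eventually_nhds_x_imp_x[OF comb[OF u e2 d3]] by simp_all
  qed
  show b: "deriv (deriv A1) u = 0" and s: "deriv R1 u = - q1 * deriv (deriv A0) u / 2" if u: "u \<in> S" for u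
  proof -
    let ?a = "deriv (deriv A0) u" and ?b = "deriv (deriv A1) u" and ?r = "deriv R0 u" and ?s = "deriv R1 u"
    have H: "H2 u m 0 = - 2 * (q0 + m * q1) * (?r + m * ?s) - (q0 + m * q1)\<^sup>2 * (?a + m * ?b)" for m
      by (simp add: H2_def A_def R_def q_def num)
    note D = E(1)[OF u h(1)[OF u]] E(1)[OF u h(2)[OF u]]
    \<comment> \<open>The third difference isolates the coefficient of \<open>m\<^sup>3\<close>, then a second difference that of \<open>m\<^sup>2\<close>.\<close>
    have "(H2 u 1 0 - 2 * H2 u 2 0 + H2 u 3 0) - (H2 u 0 0 - 2 * H2 u 1 0 + H2 u 2 0) = - 6 * q1\<^sup>2 * ?b"
      unfolding H by algebra
    then show b: "?b = 0" unfolding D using q1 by simp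
    have "H2 u 0 0 - 2 * H2 u 1 0 + H2 u 2 0 = - 2 * q1 * (2 * ?s + q1 * ?a)"
      unfolding H b by algebra
    then have "2 * ?s + q1 * ?a = 0" unfolding D using q1 by simp
    then show "?s = - q1 * ?a / 2" by (simp add: add_eq_0_iff2 field_simps)
  qed
  have b': "deriv (deriv (deriv A1)) u = 0" if u: "u \<in> S" for u
    using deriv_eq_on_open[OF S b u] by simp
  have s': "deriv (deriv R1) u = - q1 * deriv (deriv (deriv A0)) u / 2" if u: "u \<in> S" for u
  proof -
    have "deriv (deriv R1) u = deriv (\<lambda>u. - q1 * deriv (deriv A0) u / 2) u"
      by (rule deriv_eq_on_open[OF S s u])
    also have "\<dots> = - q1 * deriv (deriv (deriv A0)) u / 2"
      using hd[OF hol(1) u, of 2] by (intro DERIV_imp_deriv) (auto intro!: derivative_eq_intros simp: num)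
    finally show ?thesis .
  qed
  show "deriv (deriv (deriv A0)) u = 0" "deriv (deriv R0) u = 0" if u: "u \<in> S" for u
  proof -
    let ?a = "deriv (deriv (deriv A0)) u" and ?r = "deriv (deriv R0) u"
    have H: "H3 u m 0 = 3 * (q0 + m * q1)\<^sup>2 * (?r - m * q1 * ?a / 2) + 2 * (q0 + m * q1)^3 * ?a" for m
      by (simp add: H3_def A_def R_def q_def num b'[OF u] s'[OF u] power3_eq_cube)
    note D = E(2)[OF u h(1)[OF u]] E(2)[OF u h(2)[OF u]]
    have "2 * ((H3 u 1 0 - 2 * H3 u 2 0 + H3 u 3 0) - (H3 u 0 0 - 2 * H3 u 1 0 + H3 u 2 0)) = 6 * q1^3 * ?a"
      unfolding H by (simp add: field_simps power2_eq_square power3_eq_cube)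
    then show a: "?a = 0" unfolding D using q1 by simp
    have "H3 u 0 0 - 2 * H3 u 1 0 + H3 u 2 0 = 6 * q1\<^sup>2 * ?r"
      unfolding H a by (simp add: algebra_simps power2_eq_square)
    then show "?r = 0" unfolding D using q1 by simp
  qed
qed

section \<open>Local form of a point symmetry\<close>

lemma deriv2_cmult:
  assumes "open S" "f holomorphic_on S" "c \<in> S"
  shows "deriv (deriv (\<lambda>c. k * f c)) c = k * deriv (deriv f) c"
proof -
  have d: "deriv (\<lambda>c. k * g c) c = k * deriv g c" if "g holomorphic_on S" "c \<in> S" for g c
    using holomorphic_derivI[OF that(1) assms(1) that(2), of UNIV] by (intro DERIV_imp_deriv DERIV_cmult) simp
  have "deriv (deriv (\<lambda>c. k * f c)) c = deriv (\<lambda>c. k * deriv f c) c"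
    by (rule deriv_eq_on_open[OF assms(1) d[OF assms(2)] assms(3)])
  also have "\<dots> = k * deriv (deriv f) c"
    by (rule d[OF holomorphic_deriv[OF assms(2,1)] assms(3)])
  finally show ?thesis .
qed

text \<open>
  Coefficients of the function \<open>a + v \<cdot> x + b u\<close> of the point \<open>W\<close>, or of
  \<open>a (u - p \<cdot> x) + v \<cdot> p - b\<close> of the hyperplane \<open>L\<close>.
\<close>

definition vec3 :: "complex \<Rightarrow> complex ^ 'n \<Rightarrow> complex \<Rightarrow> complex ^ ('n::finite + 2)"
  where "vec3 a v b = (\<chi> r. case r of Inl i \<Rightarrow> v $ i | Inr k \<Rightarrow> if k = 1 then a else b)"

definition outer :: "complex ^ 'm \<Rightarrow> complex ^ 'm \<Rightarrow> complex ^ 'm ^ 'm::finite"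
  where "outer a b = (\<chi> r s. a $ r * b $ s)"

lemma gen_outer: "gen (outer a b) z = bil (plane_vec z) a * bil (point_vec z) b"
  by (simp add: gen_entries outer_def bil_def sum_product mult_ac)

lemma bil_vec3: "bil (plane_vec (x, u, p)) (vec3 a v b) = (u - bil p x) * a + bil p v - b"
  "bil (point_vec (x, u, p)) (vec3 a v b) = a + bil x v + u * b"
proof -
  have "vec3 a v b $ Inr 1 = a" "middle (vec3 a v b) = v" "vec3 a v b $ Inr 2 = b"
    by (simp_all add: vec3_def vec_eq_iff)
  then show "bil (plane_vec (x, u, p)) (vec3 a v b) = (u - bil p x) * a + bil p v - b"
    "bil (point_vec (x, u, p)) (vec3 a v b) = a + bil x v + u * b"
    by (simp_all add: bil_index)
qed

text \<open>
  The shape in which the local analysis around \<open>(x0, u0, p0)\<close> delivers the generating function. Every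
  summand is a product of a linear function of \<open>L\<close> and a linear function of \<open>W\<close>; such a product is
  \<open>gen\<close> of a matrix of rank at most one.
\<close>

lemma normal_form_is_gen:
  fixes x0 p0 \<beta>0 \<beta>1 \<rho>0 \<rho>1 :: "complex ^ 'n::finite" and \<delta> :: "'n \<Rightarrow> complex ^ 'n"
  shows "\<exists>M. \<forall>x u p. gen M (x, u, p) = a0 + a1 * u - bil (p - p0) \<beta>0 - u * bil (p - p0) \<beta>1
    + bil (x - x0) \<rho>0 - (\<Sum>i\<in>UNIV. (x - x0) $ i * bil (p - p0) (\<delta> i))
    + (u - bil p (x - x0)) * (bil (x - x0) \<rho>1 + k * (u + bil p0 (x - x0)))"
proof -
  \<comment> \<open>The last product uses \<open>u - p \<cdot> (x - x0) = (u - p \<cdot> x) + p \<cdot> x0\<close>, a linear function of \<open>L\<close>.\<close>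
  let ?M = "outer (vec3 0 0 (-1)) (vec3 (a0 - bil x0 \<rho>0) \<rho>0 a1)
    + outer (vec3 0 \<beta>0 (bil p0 \<beta>0)) (vec3 (-1) 0 0) + outer (vec3 0 \<beta>1 (bil p0 \<beta>1)) (vec3 0 0 (-1))
    + (\<Sum>i\<in>UNIV. outer (vec3 0 (\<delta> i) (bil p0 (\<delta> i))) (vec3 (x0 $ i) (axis i (-1)) 0))
    + outer (vec3 1 x0 0) (vec3 (- bil x0 \<rho>1 - k * bil p0 x0) (\<rho>1 + k *\<^sub>C p0) k)"
  have "gen ?M (x, u, p) = a0 + a1 * u - bil (p - p0) \<beta>0 - u * bil (p - p0) \<beta>1
    + bil (x - x0) \<rho>0 - (\<Sum>i\<in>UNIV. (x - x0) $ i * bil (p - p0) (\<delta> i))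
    + (u - bil p (x - x0)) * (bil (x - x0) \<rho>1 + k * (u + bil p0 (x - x0)))" for x u p
  proof -
    have "(\<Sum>i\<in>UNIV. (bil p (\<delta> i) - bil p0 (\<delta> i)) * (x0 $ i - x $ i))
        = - (\<Sum>i\<in>UNIV. (x - x0) $ i * bil (p - p0) (\<delta> i))"
      unfolding sum_negf[symmetric] by (intro sum.cong) (simp_all add: bil.diff_left algebra_simps)
    then show ?thesis
      by (simp add: gen_add gen_sum sum_fun_eval gen_outer bil_vec3 bil.diff_left bil.diff_right bil.add_right
          bil_commute[of x p0] algebra_simps)
  qed
  then show ?thesis by blast
qed

text \<open>
  What is known of a point symmetry near a point: \<open>\<xi>\<close> and \<open>\<eta>\<close> have no derivative in the directions
  of \<open>p\<close>; the component \<open>\<pi>\<close> consists of the total derivatives of the generating function; the total derivatives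
  of \<open>\<pi>\<close> vanish. The vector \<open>(s, bil p s, 0)\<close> is \<open>s\<^sup>i d/dx\<^sup>i\<close>.
\<close>

locale local_symmetry =
  fixes X :: "'n::finite jet1 \<Rightarrow> 'n jet1" and X' :: "'n jet1 \<Rightarrow> 'n jet1 \<Rightarrow> 'n jet1"
    and x0 :: "complex ^ 'n" and u0 :: complex and p0 :: "complex ^ 'n" and e :: real
  assumes e: "e > 0"
    and X': "\<And>x u p. x \<in> ball x0 e \<Longrightarrow> u \<in> ball u0 e \<Longrightarrow> p \<in> ball p0 e \<Longrightarrow> (X has_derivative X' (x, u, p)) (at (x, u, p))"
    and X'_scaleC: "\<And>x u p c v. x \<in> ball x0 e \<Longrightarrow> u \<in> ball u0 e \<Longrightarrow> p \<in> ball p0 e \<Longrightarrow>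
      X' (x, u, p) (c *\<^sub>C v) = c *\<^sub>C X' (x, u, p) v"
    and point: "\<And>x u p \<pi>. x \<in> ball x0 e \<Longrightarrow> u \<in> ball u0 e \<Longrightarrow> p \<in> ball p0 e \<Longrightarrow>
      fst (X' (x, u, p) (0, 0, \<pi>)) = 0 \<and> fst (snd (X' (x, u, p) (0, 0, \<pi>))) = 0"
    and contact: "\<And>x u p s. x \<in> ball x0 e \<Longrightarrow> u \<in> ball u0 e \<Longrightarrow> p \<in> ball p0 e \<Longrightarrow>
      bil (snd (snd (X (x, u, p)))) s = fst (snd (X' (x, u, p) (s, bil p s, 0))) - bil p (fst (X' (x, u, p) (s, bil p s, 0)))"
    and flat: "\<And>x u p s. x \<in> ball x0 e \<Longrightarrow> u \<in> ball u0 e \<Longrightarrow> p \<in> ball p0 e \<Longrightarrow>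
      snd (snd (X' (x, u, p) (s, bil p s, 0))) = 0"
begin

definition f :: "'n jet1 \<Rightarrow> complex" where "f z = fst (snd (X z)) - bil (snd (snd z)) (fst (X z))"

abbreviation "\<xi> x u \<equiv> fst (X (x, u, p0))"
abbreviation "\<eta> x u \<equiv> fst (snd (X (x, u, p0)))"
abbreviation "P x u p \<equiv> snd (snd (X (x, u, p)))"

text \<open>
  Since \<open>\<xi>\<close> and \<open>\<eta>\<close> are constant in \<open>p\<close> on the ball, the abbreviations evaluate them at \<open>p0\<close>.
\<close>

lemma p_independent:
  assumes "x \<in> ball x0 e" "u \<in> ball u0 e" "p \<in> ball p0 e"
  shows "fst (X (x, u, p)) = \<xi> x u" "fst (snd (X (x, u, p))) = \<eta> x u"
proof -
  have "((\<lambda>p. (fst (X (x, u, p)), fst (snd (X (x, u, p))))) has_derivative (\<lambda>_. 0)) (at p within ball p0 e)"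
    if p: "p \<in> ball p0 e" for p
  proof -
    have "((\<lambda>p. (x, u, p)) has_derivative (\<lambda>\<pi>. (0, 0, \<pi>))) (at p within ball p0 e)"
      by (auto intro!: derivative_eq_intros)
    from has_derivative_compose[OF this X'[OF assms(1,2) p]]
    have "((\<lambda>p. X (x, u, p)) has_derivative (\<lambda>\<pi>. X' (x, u, p) (0, 0, \<pi>))) (at p within ball p0 e)" .
    from has_derivative_Pair[OF has_derivative_fst[OF this] has_derivative_fst[OF has_derivative_snd[OF this]]]
    show ?thesis using point[OF assms(1,2) p] by (simp add: zero_prod_def)
  qed
  then have "\<exists>c. \<forall>p\<in>ball p0 e. (fst (X (x, u, p)), fst (snd (X (x, u, p)))) = c"
    by (intro has_derivative_zero_constant convex_ball)
  then obtain c where "\<And>p. p \<in> ball p0 e \<Longrightarrow> (fst (X (x, u, p)), fst (snd (X (x, u, p)))) = c"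
    by blast
  from this[OF assms(3)] this[of p0] e show "fst (X (x, u, p)) = \<xi> x u" "fst (snd (X (x, u, p))) = \<eta> x u"
    by auto
qed

lemma f_eq: "x \<in> ball x0 e \<Longrightarrow> u \<in> ball u0 e \<Longrightarrow> p \<in> ball p0 e \<Longrightarrow> f (x, u, p) = \<eta> x u - bil p (\<xi> x u)"
  by (simp add: f_def p_independent)

lemma X'_add: "x \<in> ball x0 e \<Longrightarrow> u \<in> ball u0 e \<Longrightarrow> p \<in> ball p0 e \<Longrightarrow> X' (x, u, p) (v + w) = X' (x, u, p) v + X' (x, u, p) w"
  using linear_add[OF has_derivative_linear[OF X']] by blast

lemma X'_p_independent:
  assumes x: "x \<in> ball x0 e" and u: "u \<in> ball u0 e" and p: "p \<in> ball p0 e"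
  shows "fst (X' (x, u, p) (s, t, 0)) = fst (X' (x, u, p0) (s, t, 0))"
    "fst (snd (X' (x, u, p) (s, t, 0))) = fst (snd (X' (x, u, p0) (s, t, 0)))"
proof -
  have p0: "p0 \<in> ball p0 e" using e by simp
  have l: "((\<lambda>\<tau>. X ((x, u, p) + \<tau> *\<^sub>R (s, t, 0))) has_vector_derivative X' (x, u, p) (s, t, 0)) (at 0)"
    if "p \<in> ball p0 e" for p
    by (rule line_has_vector_derivative[OF X'[OF x u that]]) simp
  have fst: "((\<lambda>\<tau>. fst (g \<tau>)) has_vector_derivative fst d) (at 0)" and snd: "((\<lambda>\<tau>. snd (g \<tau>)) has_vector_derivative snd d) (at 0)"
    if "(g has_vector_derivative d) (at 0)" for g :: "real \<Rightarrow> 'y::real_normed_vector \<times> 'z::real_normed_vector" and d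
    using bounded_linear.has_vector_derivative[OF bounded_linear_fst that] bounded_linear.has_vector_derivative[OF bounded_linear_snd that]
    by simp_all
  have box: "open (ball x0 e \<times> ball u0 e)" "(x, u) \<in> ball x0 e \<times> ball u0 e"
    using x u by (auto intro: open_Times)
  have ev: "\<forall>\<^sub>F \<tau> in nhds (0::real). (x, u) + \<tau> *\<^sub>R (s, t) \<in> ball x0 e \<times> ball u0 e"
    by (rule eventually_line_in_open[OF box])
  have "fst (X' (x, u, p) (s, t, 0)) - fst (X' (x, u, p0) (s, t, 0)) = 0"
    by (rule has_vector_derivative_eventually_zero[OF has_vector_derivative_diff[OF fst[OF l[OF p]] fst[OF l[OF p0]]]])
       (rule eventually_mono[OF ev], use p p_independent(1) in simp)
  moreover have "fst (snd (X' (x, u, p) (s, t, 0))) - fst (snd (X' (x, u, p0) (s, t, 0))) = 0"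
    by (rule has_vector_derivative_eventually_zero[OF has_vector_derivative_diff[OF fst[OF snd[OF l[OF p]]] fst[OF snd[OF l[OF p0]]]]])
       (rule eventually_mono[OF ev], use p p_independent(2) in simp)
  ultimately show "fst (X' (x, u, p) (s, t, 0)) = fst (X' (x, u, p0) (s, t, 0))"
    "fst (snd (X' (x, u, p) (s, t, 0))) = fst (snd (X' (x, u, p0) (s, t, 0)))" by simp_all
qed

text \<open>
  The segment from \<open>(x0, c, p)\<close> to \<open>(x0 + s, u, p)\<close> is an integral curve of \<open>s\<^sup>i d/dx\<^sup>i\<close>. Along it \<open>\<pi>\<close> is
  constant and \<open>f\<close> has derivative \<open>s \<cdot> \<pi>\<close>.
\<close>

lemma affine_on_planes:
  assumes "x0 + s \<in> ball x0 e" "u \<in> ball u0 e" "u - bil p s \<in> ball u0 e" and p: "p \<in> ball p0 e"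
  shows "f (x0 + s, u, p) = f (x0, u - bil p s, p) + bil (P x0 (u - bil p s) p) s"
proof -
  let ?c = "u - bil p s"
  define l where "l \<tau> = (x0 + \<tau> *\<^sub>R s, ?c + \<tau> *\<^sub>R bil p s, p)" for \<tau> :: real
  have in_box: "x0 + \<tau> *\<^sub>R s \<in> ball x0 e" "?c + \<tau> *\<^sub>R bil p s \<in> ball u0 e" if "\<tau> \<in> {0..1}" for \<tau>
  proof -
    have "(1 - \<tau>) *\<^sub>R x0 + \<tau> *\<^sub>R (x0 + s) \<in> ball x0 e"
      using that e assms(1) by (intro convexD[OF convex_ball]) auto
    then show "x0 + \<tau> *\<^sub>R s \<in> ball x0 e" by (simp add: algebra_simps)
    have "(1 - \<tau>) *\<^sub>R ?c + \<tau> *\<^sub>R u \<in> ball u0 e"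
      using that assms by (intro convexD[OF convex_ball]) auto
    then show "?c + \<tau> *\<^sub>R bil p s \<in> ball u0 e" by (simp add: algebra_simps)
  qed
  \<comment> \<open>With the factor \<open>\<tau> - 1\<close> the values at the two ends are the two sides of the claim, with \<open>\<pi>\<close>
  evaluated at the base point.\<close>
  let ?\<chi> = "\<lambda>\<tau>. fst (snd (X (l \<tau>))) - bil p (fst (X (l \<tau>))) - (\<tau> - 1) *\<^sub>R bil (snd (snd (X (l \<tau>)))) s"
  have d: "(?\<chi> has_vector_derivative 0) (at \<tau> within {0..1})" if \<tau>: "\<tau> \<in> {0..1}" for \<tau>
  proof -
    let ?v = "(s, bil p s, 0) :: 'n jet1"
    note X\<tau> = X'[OF in_box[OF \<tau>] p, folded l_def]
    let ?D = "X' (l \<tau>) ?v"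
    have "(l has_derivative (\<lambda>h. h *\<^sub>R ?v)) (at \<tau> within {0..1})"
      unfolding l_def by (auto intro!: derivative_eq_intros)
    from has_derivative_compose[OF this X\<tau>]
    have "((\<lambda>\<tau>. X (l \<tau>)) has_vector_derivative ?D) (at \<tau> within {0..1})"
      by (simp only: has_vector_derivative_def linear_scale[OF has_derivative_linear[OF X\<tau>]])
    note D = this
    note D2 = bounded_linear.has_vector_derivative[OF bounded_linear_snd D]
    note Dx = bounded_linear.has_vector_derivative[OF bounded_linear_fst D]
      and Du = bounded_linear.has_vector_derivative[OF bounded_linear_fst D2]
      and Dp = bounded_linear.has_vector_derivative[OF bounded_linear_snd D2]
    have "(?\<chi> has_vector_derivative fst (snd ?D) - bil p (fst ?D)
       - ((\<tau> - 1) *\<^sub>R bil (snd (snd ?D)) s + 1 *\<^sub>R bil (snd (snd (X (l \<tau>)))) s)) (at \<tau> within {0..1})"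
      by (intro has_vector_derivative_diff Du bounded_linear.has_vector_derivative[OF bil.bounded_linear_right Dx]
          has_vector_derivative_scaleR bounded_linear.has_vector_derivative[OF bil.bounded_linear_left Dp]) (auto intro!: derivative_eq_intros)
    moreover have "bil (snd (snd (X (l \<tau>)))) s = fst (snd ?D) - bil p (fst ?D)" "snd (snd ?D) = 0"
      unfolding l_def by (rule contact[OF in_box[OF \<tau>] p], rule flat[OF in_box[OF \<tau>] p])
    ultimately show ?thesis by simp
  qed
  have "\<exists>k. \<forall>\<tau>\<in>{0..1}. ?\<chi> \<tau> = k"
    by (rule has_derivative_zero_constant) (use d in \<open>simp_all add: has_vector_derivative_def\<close>)
  then obtain k where k: "\<And>\<tau>. \<tau> \<in> {0..1} \<Longrightarrow> ?\<chi> \<tau> = k"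
    by blast
  show ?thesis
    using k[of 0] k[of 1] by (simp add: l_def f_def)
qed

text \<open>
  Data of the symmetry over the base point \<open>x0\<close>, as functions of \<open>c\<close>: the generating function
  \<open>A p\<close>, the derivative \<open>\<delta> s\<close> of \<open>\<xi>\<close> in direction \<open>s\<close> and the derivative \<open>R p s\<close> of \<open>f\<close> in direction
  \<open>(s, 0, 0)\<close>. All three are affine in \<open>p\<close> or independent of it, unlike \<open>\<pi>\<close>.
\<close>

definition A :: "complex ^ 'n \<Rightarrow> complex \<Rightarrow> complex"
  where "A p c = \<eta> x0 c - bil p (\<xi> x0 c)"

definition \<delta> :: "complex ^ 'n \<Rightarrow> complex \<Rightarrow> complex ^ 'n"
  where "\<delta> s c = fst (X' (x0, c, p0) (s, 0, 0))"

definition R :: "complex ^ 'n \<Rightarrow> complex ^ 'n \<Rightarrow> complex \<Rightarrow> complex"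
  where "R p s c = fst (snd (X' (x0, c, p0) (s, 0, 0))) - bil p (\<delta> s c)"

lemma center: "x0 \<in> ball x0 e" "p0 \<in> ball p0 e" "u0 \<in> ball u0 e"
  using e by simp_all

lemma u_derivative:
  assumes "c \<in> ball u0 e" "p \<in> ball p0 e" "bounded_linear \<Lambda>" "\<And>k v. \<Lambda> (k *\<^sub>C v) = k * \<Lambda> v"
  shows "((\<lambda>c. \<Lambda> (X (x0, c, p))) has_field_derivative \<Lambda> (X' (x0, c, p) (0, 1, 0))) (at c)"
proof -
  have "((\<lambda>c. (x0, c, p)) has_derivative (\<lambda>h. (0, h, 0))) (at c)"
    by (auto intro!: derivative_eq_intros)
  from bounded_linear.has_derivative[OF assms(3) has_derivative_compose[OF this X'[OF center(1) assms(1,2)]]]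
  have D: "((\<lambda>c. \<Lambda> (X (x0, c, p))) has_derivative (\<lambda>h. \<Lambda> (X' (x0, c, p) (0, h, 0)))) (at c)" .
  have lin: "\<Lambda> (X' (x0, c, p) (0, h, 0)) = h * \<Lambda> (X' (x0, c, p) (0, 1, 0))" for h
    using X'_scaleC[OF center(1) assms(1,2), of h "(0, 1, 0)"] assms(4)[of h "X' (x0, c, p) (0, 1, 0)"] by simp
  have "(\<lambda>h. \<Lambda> (X' (x0, c, p) (0, h, 0))) = (*) (\<Lambda> (X' (x0, c, p) (0, 1, 0)))"
    by (rule ext, rule trans[OF lin mult.commute])
  with D show ?thesis
    by (simp add: has_field_derivative_def)
qed

lemma A_derivative:
  assumes "c \<in> ball u0 e"
  shows "(A p has_field_derivative fst (snd (X' (x0, c, p0) (0, 1, 0))) - bil p (fst (X' (x0, c, p0) (0, 1, 0)))) (at c)"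
  unfolding A_def[abs_def]
  by (rule u_derivative[OF assms center(2), of "\<lambda>v. fst (snd v) - bil p (fst v)"])
     (auto intro!: bounded_linear_intros bounded_linear_compose[OF bil.bounded_linear_right] bounded_linear_compose[OF bounded_linear_fst] simp: algebra_simps)

lemma A_holomorphic: "A p holomorphic_on ball u0 e"
  unfolding holomorphic_on_open[OF open_ball] using A_derivative by blast

lemma P_eq:
  assumes c: "c \<in> ball u0 e" and p: "p \<in> ball p0 e"
  shows "bil (P x0 c p) s = R p s c + bil p s * deriv (A p) c"
proof -
  let ?D = "X' (x0, c, p0) (s, bil p s, 0)"
  have D: "?D = X' (x0, c, p0) (s, 0, 0) + bil p s *\<^sub>C X' (x0, c, p0) (0, 1, 0)"
    unfolding X'_scaleC[OF center(1) c center(2), symmetric] X'_add[OF center(1) c center(2), symmetric] by simp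
  have "bil (P x0 c p) s = fst (snd ?D) - bil p (fst ?D)"
    unfolding contact[OF center(1) c p] X'_p_independent[OF center(1) c p] ..
  also have "\<dots> = R p s c + bil p s * deriv (A p) c"
    unfolding DERIV_imp_deriv[OF A_derivative[OF c]] D by (simp add: R_def \<delta>_def bil.add_right algebra_simps)
  finally show ?thesis .
qed

text \<open>
  A derivative of the field in a direction of \<open>x\<close>, as a function of \<open>u\<close>. It is holomorphic in \<open>u\<close> because \<open>P_eq\<close>
  expresses it by the component \<open>\<pi>\<close> of the field and by the derivative of \<open>A p\<close>.
\<close>

lemma R_holomorphic:
  assumes "p \<in> ball p0 e" shows "R p s holomorphic_on ball u0 e"
proof -
  have "((\<lambda>c. bil (P x0 c p) s) has_field_derivative bil (snd (snd (X' (x0, c, p) (0, 1, 0)))) s) (at c)"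
    if "c \<in> ball u0 e" for c
    by (rule u_derivative[OF that assms, of "\<lambda>v. bil (snd (snd v)) s"])
       (auto intro!: bounded_linear_compose[OF bil.bounded_linear_left] bounded_linear_compose[OF bounded_linear_snd] bounded_linear_snd)
  then have "(\<lambda>c. bil (P x0 c p) s) holomorphic_on ball u0 e"
    unfolding holomorphic_on_open[OF open_ball] by blast
  then have "(\<lambda>c. bil (P x0 c p) s - bil p s * deriv (A p) c) holomorphic_on ball u0 e"
    by (intro holomorphic_intros holomorphic_deriv A_holomorphic) auto
  then show ?thesis
    by (rule holomorphic_transform) (simp only: P_eq[OF _ assms] add_diff_cancel_right')
qed

lemma A_affine: "A (p + m *\<^sub>C w) c = A p c + m * (- bil w (\<xi> x0 c))"
  by (simp add: A_def bil.add_left algebra_simps)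

lemma R_affine: "R (p + m *\<^sub>C w) s c = R p s c + m * (- bil w (\<delta> s c))"
  by (simp add: R_def bil.add_left algebra_simps)

text \<open>
  Two expressions for \<open>f\<close> near the base point in the direction \<open>s\<close>: the one of \<open>scalar_rigidity\<close>, and
  one that is affine in \<open>p\<close>.
\<close>

lemma f_on_line:
  assumes u: "u \<in> ball u0 e" and p: "p \<in> ball p0 e"
  shows "\<forall>\<^sub>F t in nhds 0. f (x0 + t *\<^sub>C s, u, p) = A p (u - t * bil p s)
      + t * (R p s (u - t * bil p s) + bil p s * deriv (A p) (u - t * bil p s))
    \<and> f (x0 + t *\<^sub>C s, u, p) = \<eta> (x0 + t *\<^sub>C s) u - bil p (\<xi> (x0 + t *\<^sub>C s) u)"
proof -
  have "open ((\<lambda>t. (x0 + t *\<^sub>C s, u - t * bil p s)) -` (ball x0 e \<times> ball u0 e))"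
    unfolding scaleC_vec_def scaleC_complex by (intro open_vimage open_Times open_ball continuous_intros)
  then have "\<forall>\<^sub>F t in nhds 0. (x0 + t *\<^sub>C s, u - t * bil p s) \<in> ball x0 e \<times> ball u0 e"
    unfolding eventually_nhds using u center
    by (intro exI[of _ "(\<lambda>t. (x0 + t *\<^sub>C s, u - t * bil p s)) -` (ball x0 e \<times> ball u0 e)"]) auto
  then show ?thesis
  proof eventually_elim
    case (elim t)
    then have x: "x0 + t *\<^sub>C s \<in> ball x0 e" and c: "u - t * bil p s \<in> ball u0 e" by auto
    have "f (x0, u - t * bil p s, p) = A p (u - t * bil p s)"
      using f_eq[OF center(1) c p] by (simp add: A_def)
    then show ?case
      using affine_on_planes[of "t *\<^sub>C s" u p] x u c p P_eq[OF c p, of s] f_eq[OF x u p] by simp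
  qed
qed

text \<open>
  \<open>scalar_rigidity\<close> for the slopes \<open>p0 + m w\<close> with \<open>w\<close> a multiple of the \<open>j\<close>-th basis vector. The parameter \<open>q1\<close>
  is \<open>w \<cdot> s\<close>, whence the condition on \<open>s\<close>.
\<close>

lemma rigid:
  assumes s: "s $ j \<noteq> 0" and c: "c \<in> ball u0 e"
  shows "deriv (deriv (\<lambda>c. \<xi> x0 c $ j)) c = 0"
    and "((\<lambda>c. \<delta> s c $ j) has_field_derivative s $ j * deriv (deriv (A p0)) c / 2) (at c)"
    and "deriv (deriv (deriv (A p0))) c = 0"
    and "deriv (deriv (R p0 s)) c = 0"
proof -
  \<comment> \<open>The length \<open>e / 4\<close> keeps \<open>p0 + m w\<close> for \<open>m = 0, 1, 2, 3\<close> in the ball of radius \<open>e\<close>.\<close>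
  let ?S = "ball u0 e" and ?w = "axis j (of_real (e / 4)) :: complex ^ 'n"
  let ?A1 = "\<lambda>c. - bil ?w (\<xi> x0 c)" and ?R1 = "\<lambda>c. - bil ?w (\<delta> s c)"
  have mw: "m *\<^sub>C ?w = axis j (m * of_real (e / 4))" for m
    by (simp add: vec_eq_iff axis_def)
  have pm: "p0 + m *\<^sub>C ?w \<in> ball p0 e" if "norm m \<le> 3" for m
    using that e unfolding mw by (simp add: dist_norm norm_axis norm_mult)
  have p: "p0 + 0 *\<^sub>C ?w \<in> ball p0 e" "p0 + 1 *\<^sub>C ?w \<in> ball p0 e" "p0 + 2 *\<^sub>C ?w \<in> ball p0 e" "p0 + 3 *\<^sub>C ?w \<in> ball p0 e"
    by (rule pm; simp)+
  have "(\<lambda>c. A (p0 + 1 *\<^sub>C ?w) c - A p0 c) holomorphic_on ?S" "(\<lambda>c. R (p0 + 1 *\<^sub>C ?w) s c - R p0 s c) holomorphic_on ?S"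
    by (intro holomorphic_intros A_holomorphic R_holomorphic p center)+
  then have hol1: "?A1 holomorphic_on ?S" "?R1 holomorphic_on ?S"
    unfolding A_affine R_affine by simp_all
  have dA: "deriv (A (p0 + m *\<^sub>C ?w)) c = deriv (A p0) c + m * deriv ?A1 c" if "c \<in> ?S" for m c
  proof -
    have "((\<lambda>c. A p0 c + m * ?A1 c) has_field_derivative deriv (A p0) c + m * deriv ?A1 c) (at c)"
      using holomorphic_derivI[OF A_holomorphic open_ball that, of p0 UNIV] holomorphic_derivI[OF hol1(1) open_ball that, of UNIV]
      by (intro DERIV_add DERIV_cmult) simp_all
    then show ?thesis
      unfolding A_affine[abs_def] by (rule DERIV_imp_deriv)
  qed
  define h where "h m t u = A p0 (u - t * (bil p0 s + m * bil ?w s)) + m * ?A1 (u - t * (bil p0 s + m * bil ?w s))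
      + t * (R p0 s (u - t * (bil p0 s + m * bil ?w s)) + m * ?R1 (u - t * (bil p0 s + m * bil ?w s))
        + (bil p0 s + m * bil ?w s) * (deriv (A p0) (u - t * (bil p0 s + m * bil ?w s))
          + m * deriv ?A1 (u - t * (bil p0 s + m * bil ?w s))))" for m t u
  have h: "\<forall>\<^sub>F t in nhds 0. h m t u = \<eta> (x0 + t *\<^sub>C s) u - bil p0 (\<xi> (x0 + t *\<^sub>C s) u) - m * bil ?w (\<xi> (x0 + t *\<^sub>C s) u)"
    if u: "u \<in> ?S" and m: "p0 + m *\<^sub>C ?w \<in> ball p0 e" for u m
  proof -
    have "open ((\<lambda>t. u - t * bil (p0 + m *\<^sub>C ?w) s) -` ?S)"
      by (intro open_vimage open_ball continuous_intros)
    then have "\<forall>\<^sub>F t in nhds 0. u - t * bil (p0 + m *\<^sub>C ?w) s \<in> ?S"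
      unfolding eventually_nhds using u by (intro exI[of _ "(\<lambda>t. u - t * bil (p0 + m *\<^sub>C ?w) s) -` ?S"]) auto
    then show ?thesis
      using f_on_line[OF u m, of s]
    proof eventually_elim
      case (elim t)
      have q: "bil (p0 + m *\<^sub>C ?w) s = bil p0 s + m * bil ?w s"
        by (simp only: bil.add_left bil_scaleC_left)
      have "h m t u = A (p0 + m *\<^sub>C ?w) (u - t * bil (p0 + m *\<^sub>C ?w) s)
        + t * (R (p0 + m *\<^sub>C ?w) s (u - t * bil (p0 + m *\<^sub>C ?w) s)
          + bil (p0 + m *\<^sub>C ?w) s * deriv (A (p0 + m *\<^sub>C ?w)) (u - t * bil (p0 + m *\<^sub>C ?w) s))"
        unfolding dA[OF elim(1)] unfolding A_affine R_affine q h_def ..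
      also have "\<dots> = \<eta> (x0 + t *\<^sub>C s) u - bil (p0 + m *\<^sub>C ?w) (\<xi> (x0 + t *\<^sub>C s) u)"
        by (rule trans[OF conjunct1[OF elim(2), symmetric] conjunct2[OF elim(2)]])
      finally show ?case
        by (simp only: bil.add_left bil_scaleC_left diff_diff_eq)
    qed
  qed
  have aff: "a = E - k * F \<Longrightarrow> b = E - l * F \<Longrightarrow> c = E - m * F \<Longrightarrow> l = k + 1 \<Longrightarrow> m = k + 2 \<Longrightarrow> a - 2 * b + c = 0"
    for a b c E F k l m :: complex
    by (hypsubst, simp add: algebra_simps)
  have dd0: "\<forall>\<^sub>F t in nhds 0. h 0 t u - 2 * h 1 t u + h 2 t u = 0" if u: "u \<in> ?S" for u
    using h[OF u p(1)] h[OF u p(2)] h[OF u p(3)]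
    by eventually_elim (rule aff, assumption, assumption, assumption, simp_all)
  have dd1: "\<forall>\<^sub>F t in nhds 0. h 1 t u - 2 * h 2 t u + h 3 t u = 0" if u: "u \<in> ?S" for u
    using h[OF u p(2)] h[OF u p(3)] h[OF u p(4)]
    by eventually_elim (rule aff, assumption, assumption, assumption, simp_all)
  have q1: "bil ?w s \<noteq> 0"
    using s e by simp
  note rig = scalar_rigidity[where ?q0.0 = "bil p0 s", OF open_ball A_holomorphic hol1(1) R_holomorphic[OF center(2)] hol1(2) q1, OF dd0[unfolded h_def] dd1[unfolded h_def]]
  show "deriv (deriv (deriv (A p0))) c = 0" "deriv (deriv (R p0 s)) c = 0"
    by (rule rig(3)[OF _ _ c], assumption+, rule rig(4)[OF _ _ c], assumption+)
  have r1: "deriv (deriv ?A1) c = 0"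
    by (rule rig(1)[OF _ _ c])
  have r2: "deriv ?R1 c = - bil ?w s * deriv (deriv (A p0)) c / 2"
    by (rule rig(2)[OF _ _ c])
  let ?k = "complex_of_real (e / 4)"
  have k: "?k \<noteq> 0" using e by simp
  have "(\<lambda>c. - (1 / ?k) * ?A1 c) = (\<lambda>c. \<xi> x0 c $ j)" "(\<lambda>c. - (1 / ?k) * ?R1 c) = (\<lambda>c. \<delta> s c $ j)"
    using k by (auto simp: fun_eq_iff)
  moreover have "deriv (deriv (\<lambda>c. - (1 / ?k) * ?A1 c)) c = - (1 / ?k) * deriv (deriv ?A1) c"
    by (rule deriv2_cmult[OF open_ball hol1(1) c])
  ultimately show "deriv (deriv (\<lambda>c. \<xi> x0 c $ j)) c = 0"
    using r1 by simp
  have "((\<lambda>c. - (1 / ?k) * ?R1 c) has_field_derivative - (1 / ?k) * deriv ?R1 c) (at c)"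
    using holomorphic_derivI[OF hol1(2) open_ball c, of UNIV] by (intro DERIV_cmult) simp
  then show "((\<lambda>c. \<delta> s c $ j) has_field_derivative s $ j * deriv (deriv (A p0)) c / 2) (at c)"
    unfolding r2 using k e by (simp add: field_simps)
qed

end

context local_symmetry
begin

lemma A_quadratic:
  obtains a0 a1 k where "\<And>c. c \<in> ball u0 e \<Longrightarrow> A p0 c = a0 + a1 * c + k * c\<^sup>2"
    and "\<And>c. c \<in> ball u0 e \<Longrightarrow> deriv (deriv (A p0)) c = 2 * k"
proof -
  obtain j :: 'n where True by blast
  have d3: "deriv (deriv (deriv (A p0))) c = 0" if "c \<in> ball u0 e" for c
    using rigid(3)[of "axis j 1" j c] that by (simp add: axis_def)
  obtain a0 a1 where a: "\<And>c. c \<in> ball u0 e \<Longrightarrow> A p0 c = a0 + a1 * c + deriv (deriv (A p0)) u0 / 2 * c\<^sup>2"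
    using deriv3_eq_0_quadratic[OF open_ball convex_ball A_holomorphic d3 center(3)] by blast
  have "\<exists>k. \<forall>c\<in>ball u0 e. deriv (deriv (A p0)) c = k"
    by (rule deriv_eq_0_const[OF open_ball convex_ball _ d3])
       (intro holomorphic_deriv A_holomorphic open_ball)
  then have "deriv (deriv (A p0)) c = 2 * (deriv (deriv (A p0)) u0 / 2)" if "c \<in> ball u0 e" for c
    using that center(3) by auto
  then show ?thesis using that a by blast
qed

lemma \<xi>_affine: "\<exists>b0 b1. \<forall>c\<in>ball u0 e. \<xi> x0 c $ j = b0 + b1 * c"
proof (rule deriv2_eq_0_affine[OF open_ball convex_ball])
  have "((\<lambda>c. fst (X (x0, c, p0)) $ j) has_field_derivative fst (X' (x0, c, p0) (0, 1, 0)) $ j) (at c)"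
    if "c \<in> ball u0 e" for c
    by (rule u_derivative[OF that center(2), of "\<lambda>v. fst v $ j"])
       (auto intro!: bounded_linear_compose[OF bounded_linear_vec_nth] bounded_linear_fst)
  then show "(\<lambda>c. \<xi> x0 c $ j) holomorphic_on ball u0 e"
    unfolding holomorphic_on_open[OF open_ball] by blast
qed (use rigid(1)[of "axis j 1" j] in \<open>simp add: axis_def\<close>)

lemma R_affine_u: "\<exists>r0 r1. \<forall>c\<in>ball u0 e. R p0 (axis i 1) c = r0 + r1 * c"
  by (rule deriv2_eq_0_affine[OF open_ball convex_ball R_holomorphic[OF center(2)]])
     (use rigid(4)[of "axis i 1" i] in \<open>simp add: axis_def\<close>)

text \<open>
  \<open>rigid\<close> determines the \<open>j\<close>-th component of \<open>\<delta> s\<close> up to a constant when \<open>s\<^sub>j \<noteq> 0\<close>. For \<open>s = e\<^sub>i\<close> with \<open>i \<noteq> j\<close>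
  it is applied to \<open>e\<^sub>i + e\<^sub>j\<close> and \<open>e\<^sub>j\<close>, and \<open>\<delta>\<close> is additive in \<open>s\<close>.
\<close>

lemma \<delta>_form:
  assumes k: "\<And>c. c \<in> ball u0 e \<Longrightarrow> deriv (deriv (A p0)) c = 2 * k"
  shows "\<exists>r. \<forall>c\<in>ball u0 e. \<delta> (axis i 1) c $ j = r + (if i = j then k * c else 0)"
proof -
  have nz: "\<exists>r. \<forall>c\<in>ball u0 e. \<delta> s c $ j - s $ j * k * c = r" if "s $ j \<noteq> 0" for s
  proof (rule has_field_derivative_zero_constant[OF convex_ball])
    fix c assume c: "c \<in> ball u0 e"
    have "((\<lambda>c. \<delta> s c $ j - s $ j * k * c) has_field_derivative s $ j * deriv (deriv (A p0)) c / 2 - s $ j * k * 1) (at c)"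
      by (intro DERIV_diff rigid(2)[OF that c] DERIV_cmult DERIV_ident)
    then show "((\<lambda>c. \<delta> s c $ j - s $ j * k * c) has_field_derivative 0) (at c within ball u0 e)"
      using k[OF c] by (auto intro: has_field_derivative_at_within)
  qed
  show ?thesis
  proof (cases "i = j")
    case True
    then obtain r where "\<forall>c\<in>ball u0 e. \<delta> (axis i 1) c $ j - k * c = r"
      using nz[of "axis i 1"] by (auto simp: axis_def)
    then show ?thesis using True by (intro exI[of _ r]) (auto simp: algebra_simps)
  next
    case False
    have add: "\<delta> (axis i 1 + axis j 1) c = \<delta> (axis i 1) c + \<delta> (axis j 1) c" if "c \<in> ball u0 e" for c
      using X'_add[OF center(1) that center(2), of "(axis i 1, 0, 0)" "(axis j 1, 0, 0)"] by (simp add: \<delta>_def)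
    obtain r where r: "\<And>c. c \<in> ball u0 e \<Longrightarrow> \<delta> (axis j 1) c $ j - k * c = r"
      using nz[of "axis j 1"] by (auto simp: axis_def)
    obtain r' where r': "\<And>c. c \<in> ball u0 e \<Longrightarrow> \<delta> (axis i 1 + axis j 1) c $ j - k * c = r'"
      using nz[of "axis i 1 + axis j 1"] False by (auto simp: axis_def)
    have "\<delta> (axis i 1) c $ j = r' - r" if "c \<in> ball u0 e" for c
    proof -
      have "\<delta> (axis i 1) c $ j = (\<delta> (axis i 1 + axis j 1) c $ j - k * c) - (\<delta> (axis j 1) c $ j - k * c)"
        using add[OF that] by simp
      then show ?thesis unfolding r[OF that] r'[OF that] .
    qed
    then show ?thesis using False by auto
  qed
qed

text \<open>
  Substituting the polynomial shapes of \<open>A\<close>, \<open>\<xi>\<close>, \<open>R\<close> and \<open>\<delta>\<close> into \<open>affine_on_planes\<close> gives the normal form of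
  \<open>normal_form_is_gen\<close>. The terms quadratic in \<open>p\<close> cancel, because the same \<open>k\<close> governs
  \<open>A\<close> and \<open>\<delta>\<close>.
\<close>

lemma local_form: "\<exists>M. \<forall>\<^sub>F z in nhds (x0, u0, p0). f z = gen M z"
proof -
  obtain a0 a1 k where A: "\<And>c. c \<in> ball u0 e \<Longrightarrow> A p0 c = a0 + a1 * c + k * c\<^sup>2"
    and k: "\<And>c. c \<in> ball u0 e \<Longrightarrow> deriv (deriv (A p0)) c = 2 * k"
    by (rule A_quadratic) blast
  obtain b0 b1 where b: "\<And>j c. c \<in> ball u0 e \<Longrightarrow> \<xi> x0 c $ j = b0 j + b1 j * c"
    using \<xi>_affine by metis
  obtain r0 r1 where r: "\<And>i c. c \<in> ball u0 e \<Longrightarrow> R p0 (axis i 1) c = r0 i + r1 i * c"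
    using R_affine_u by metis
  obtain d where d: "\<And>i j c. c \<in> ball u0 e \<Longrightarrow> \<delta> (axis i 1) c $ j = d i j + (if i = j then k * c else 0)"
    using \<delta>_form[OF k] by metis
  define \<beta>0 \<beta>1 \<rho>0 \<rho>1 where "\<beta>0 = vec_lambda b0" and "\<beta>1 = vec_lambda b1" and "\<rho>0 = vec_lambda r0" and "\<rho>1 = vec_lambda r1"
  define \<Delta> where "\<Delta> i = vec_lambda (d i)" for i
  have \<xi>: "bil \<pi> (\<xi> x0 c) = bil \<pi> \<beta>0 + c * bil \<pi> \<beta>1" if "c \<in> ball u0 e" for c \<pi>
    by (simp add: bil_def b[OF that] \<beta>0_def \<beta>1_def algebra_simps sum.distrib sum_distrib_left)
  have \<delta>: "bil \<pi> (\<delta> (axis i 1) c) = bil \<pi> (\<Delta> i) + k * c * \<pi> $ i" if "c \<in> ball u0 e" for c \<pi> i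
    by (simp add: bil_def d[OF that] \<Delta>_def algebra_simps sum.distrib if_distrib[of "(*) _"] cong: if_cong)
  have Ap: "A p c = a0 + a1 * c + k * c\<^sup>2 - (bil (p - p0) \<beta>0 + c * bil (p - p0) \<beta>1)" if "c \<in> ball u0 e" for p c
    using A_affine[of p0 1 "p - p0" c] A[OF that] \<xi>[OF that] by (simp add: scaleC_one)
  have Ap': "deriv (A p) c = a1 + 2 * k * c - bil (p - p0) \<beta>1" if "c \<in> ball u0 e" for p c
  proof -
    have "deriv (A p) c = deriv (\<lambda>c. a0 + a1 * c + k * c\<^sup>2 - (bil (p - p0) \<beta>0 + c * bil (p - p0) \<beta>1)) c"
      by (rule deriv_eq_on_open[OF open_ball Ap that])
    also have "\<dots> = a1 + 2 * k * c - bil (p - p0) \<beta>1"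
      by (rule DERIV_imp_deriv) (auto intro!: derivative_eq_intros)
    finally show ?thesis .
  qed
  have Rp: "R p (axis i 1) c = r0 i + r1 i * c - (bil (p - p0) (\<Delta> i) + k * c * (p - p0) $ i)" if "c \<in> ball u0 e" for p i c
    using R_affine[of p0 1 "p - p0" "axis i 1" c] r[OF that] \<delta>[OF that] by (simp add: scaleC_one)
  obtain M where M: "\<And>x u p. gen M (x, u, p) = a0 + a1 * u - bil (p - p0) \<beta>0 - u * bil (p - p0) \<beta>1
    + bil (x - x0) \<rho>0 - (\<Sum>i\<in>UNIV. (x - x0) $ i * bil (p - p0) (\<Delta> i))
    + (u - bil p (x - x0)) * (bil (x - x0) \<rho>1 + k * (u + bil p0 (x - x0)))"
    using normal_form_is_gen by blast
  have eq: "f (x, u, p) = gen M (x, u, p)"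
    if x: "x \<in> ball x0 e" and u: "u \<in> ball u0 e" and p: "p \<in> ball p0 e" and c: "u - bil p (x - x0) \<in> ball u0 e" for x u p
  proof -
    define s where "s = x - x0"
    define c where "c = u - bil p s"
    have c: "c \<in> ball u0 e" using that(4) by (simp add: c_def s_def)
    have "f (x, u, p) = f (x0, c, p) + bil (P x0 c p) s"
      using affine_on_planes[of s u p] x u p c by (simp add: s_def c_def)
    moreover have "f (x0, c, p) = A p c"
      using f_eq[OF center(1) c p] by (simp add: A_def)
    moreover have "bil (P x0 c p) s = (\<Sum>i\<in>UNIV. s $ i * bil (P x0 c p) (axis i 1))"
      by (subst bil_axis) (simp add: bil_def mult.commute)
    moreover have "\<dots> = (\<Sum>i\<in>UNIV. s $ i * (r0 i + r1 i * c - (bil (p - p0) (\<Delta> i) + k * c * (p - p0) $ i)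
        + p $ i * (a1 + 2 * k * c - bil (p - p0) \<beta>1)))"
      unfolding P_eq[OF c p] Rp[OF c] Ap'[OF c] by simp
    moreover have "\<dots> = bil s \<rho>0 + c * bil s \<rho>1 - (\<Sum>i\<in>UNIV. s $ i * bil (p - p0) (\<Delta> i)) - k * c * bil s (p - p0)
        + bil p s * (a1 + 2 * k * c - bil (p - p0) \<beta>1)"
    proof -
      have "(\<Sum>i\<in>UNIV. s $ i * (r0 i + r1 i * c - (D i + kc * (p - p0) $ i) + p $ i * w))
        = bil s \<rho>0 + c * bil s \<rho>1 - (\<Sum>i\<in>UNIV. s $ i * D i) - kc * bil s (p - p0) + bil p s * w" for D kc w
        by (simp add: bil_def \<rho>0_def \<rho>1_def algebra_simps sum.distrib sum_subtractf sum_distrib_left)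
      then show ?thesis .
    qed
    ultimately have f: "f (x, u, p) = a0 + a1 * c + k * c\<^sup>2 - (bil (p - p0) \<beta>0 + c * bil (p - p0) \<beta>1)
        + (bil s \<rho>0 + c * bil s \<rho>1 - (\<Sum>i\<in>UNIV. s $ i * bil (p - p0) (\<Delta> i)) - k * c * bil s (p - p0)
        + bil p s * (a1 + 2 * k * c - bil (p - p0) \<beta>1))"
      unfolding Ap[OF c] by simp
    have sp: "bil s (p - p0) = bil p s - bil p0 s"
      by (simp add: bil.diff_right bil_commute[of s])
    show ?thesis
      unfolding M f s_def[symmetric] sp by (simp add: c_def algebra_simps power2_eq_square)
  qed
  have "open ((\<lambda>z. (fst z, fst (snd z), snd (snd z), fst (snd z) - bil (snd (snd z)) (fst z - x0)))
      -` (ball x0 e \<times> ball u0 e \<times> ball p0 e \<times> ball u0 e))" (is "open ?V")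
    by (intro open_vimage open_Times open_ball continuous_intros bil.continuous_on)
  moreover have "(x0, u0, p0) \<in> ?V"
    using center by simp
  moreover have "f z = gen M z" if "z \<in> ?V" for z
    using eq[of "fst z" "fst (snd z)" "snd (snd z)"] that by simp
  ultimately have "\<forall>\<^sub>F z in nhds (x0, u0, p0). f z = gen M z"
    unfolding eventually_nhds by blast
  then show ?thesis by blast
qed

end

section \<open>Point symmetries come from matrices\<close>

lemma vf_bracket_test:
  assumes "open U" "w \<in> U" "(X has_derivative X') (at w)" "(F has_derivative F') (at w)"
  shows "vf_bracket X (restrict_zero U F) w = F' (X w) - X' (F w)"
  using dir_deriv_eq[OF assms(3)] assms(2)
    dir_deriv_eq[OF restrict_zero_has_derivative[OF has_derivative_at_withinI[OF assms(4)] assms(2)] eventually_line_in_open[OF assms(1,2)]]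
  by (simp add: vf_bracket_def) (simp add: restrict_zero_def)

text \<open>
  The three conditions come from bracketing with three kinds of sections: the constant vertical fields, the total
  derivatives \<open>s\<^sup>i d/dx\<^sup>i\<close> on first jets, and the total derivatives on second jets,
  evaluated on the equation \<open>h = 0\<close>, where the prolongation has no component in \<open>h\<close>.
\<close>

lemma point_symmetry_conditions:
  fixes X :: "'n::finite jet1 \<Rightarrow> 'n jet1"
  assumes U: "open U" and X: "X \<in> point_symmetries U (flat_system U)"
    and z: "(x, u, p) \<in> U" and X': "(X has_derivative X') (at (x, u, p))"
  shows "fst (X' (0, 0, \<pi>)) = 0 \<and> fst (snd (X' (0, 0, \<pi>))) = 0"
    and "bil (snd (snd (X (x, u, p)))) s = fst (snd (X' (s, bil p s, 0))) - bil p (fst (X' (s, bil p s, 0)))"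
    and "snd (snd (X' (s, bil p s, 0))) = 0"
proof -
  let ?z = "(x, u, p)"
  from X have con: "preserves U contact1 X" and vert: "preserves U vertical X"
    by (auto simp: point_symmetries_def contact_vector_field_def)
  obtain X2 where X2: "prolongation U X X2" "\<And>w. w \<in> flat_system U \<Longrightarrow> X2 w \<in> tangent_space (flat_system U) w"
    using X by (auto simp: point_symmetries_def)
  show "fst (X' (0, 0, \<pi>)) = 0 \<and> fst (snd (X' (0, 0, \<pi>))) = 0"
  proof -
    let ?F = "\<lambda>_ :: 'n jet1. (0, 0, \<pi>) :: 'n jet1"
    have "vector_field_on U (restrict_zero U ?F)"
      by (rule vector_field_restrict_zero[OF U cdiff_const])
    then have "vf_bracket X (restrict_zero U ?F) ?z \<in> vertical ?z"
      using vert z by (auto simp: preserves_def restrict_zero_def vertical_def)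
    then have "- X' (0, 0, \<pi>) \<in> vertical ?z"
      using vf_bracket_test[OF U z X' has_derivative_const, of "(0, 0, \<pi>)"] by simp
    then obtain \<pi>' where "- X' (0, 0, \<pi>) = (0, 0, \<pi>')" by (auto simp: vertical_def)
    then have "X' (0, 0, \<pi>) = - (0, 0, \<pi>')" by (metis minus_minus)
    then show ?thesis by simp
  qed
  show "bil (snd (snd (X ?z))) s = fst (snd (X' (s, bil p s, 0))) - bil p (fst (X' (s, bil p s, 0)))"
  proof -
    let ?F = "\<lambda>z :: 'n jet1. (s, bil (snd (snd z)) s, 0) :: 'n jet1"
    have F': "(?F has_derivative (\<lambda>v. (0, bil (snd (snd v)) s, 0))) (at w)" for w
      by (auto intro!: derivative_eq_intros bounded_linear.has_derivative[OF bil.bounded_linear_left])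
    have "cdiff ?F w U" for w
      by (rule cdiffI[OF has_derivative_at_withinI[OF F']]) simp
    then have "vector_field_on U (restrict_zero U ?F)"
      by (intro vector_field_restrict_zero U)
    moreover have "?F w \<in> contact1 w" for w
      by (cases w) (auto simp: contact1_def bil_def)
    ultimately have "vf_bracket X (restrict_zero U ?F) ?z \<in> contact1 ?z"
      using con z by (auto simp: preserves_def restrict_zero_def)
    then have "bil (plane_vec ?z) (d_point_vec ((0, bil (snd (snd (X ?z))) s, 0) - X' (s, bil p s, 0))) = 0"
      using vf_bracket_test[OF U z X' F'] by (simp add: contact1_iff)
    then have *: "bil p (- fst (X' (s, bil p s, 0))) = bil (snd (snd (X ?z))) s - fst (snd (X' (s, bil p s, 0)))"
      by (cases "X' (s, bil p s, 0)") (simp add: bil_plane_d_point)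
    have "fst (snd (X' (s, bil p s, 0))) - bil p (fst (X' (s, bil p s, 0)))
        = fst (snd (X' (s, bil p s, 0))) + bil p (- fst (X' (s, bil p s, 0)))"
      by (simp add: bil.minus_right)
    also have "\<dots> = bil (snd (snd (X ?z))) s" unfolding * by simp
    finally show ?thesis ..
  qed
  show "snd (snd (X' (s, bil p s, 0))) = 0"
  proof -
    let ?J = "jet2_over U" and ?w = "(?z, 0 :: complex ^ 'n ^ 'n)"
    let ?F = "\<lambda>w :: 'n jet2. ((s, bil (snd (snd (fst w))) s, snd w *v s), 0) :: 'n jet2"
    let ?F' = "\<lambda>v :: 'n jet2. ((0, bil (snd (snd (fst v))) s, snd v *v s), 0) :: 'n jet2"
    have t0: "transpose (0 :: complex ^ 'n ^ 'n) = 0"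
      by (simp add: vec_eq_iff transpose_def)
    have w: "?w \<in> ?J" "?w \<in> flat_system U"
      using z t0 by (simp_all add: jet2_over_def flat_system_iff)
    have mv: "bounded_linear (\<lambda>h :: complex ^ 'n ^ 'n. h *v s)"
      unfolding linear_conv_bounded_linear[symmetric]
      by (rule linearI, rule matrix_vector_mult_add_rdistrib) (simp add: vec_eq_iff matrix_vector_mult_def scaleR_sum_right)
    have F': "(?F has_derivative ?F') (at w within S)" for w S
      by (auto intro!: derivative_eq_intros bounded_linear.has_derivative[OF bil.bounded_linear_left] bounded_linear.has_derivative[OF mv])
    have line: "\<forall>\<^sub>F t in nhds (0::real). w + t *\<^sub>R (v, 0) \<in> ?J" if "w \<in> ?J" for w v
    proof (cases w)
      case (Pair z h)
      then show ?thesis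
        using that eventually_line_in_jet2[OF U _ _ t0, of z h v] by (auto simp: jet2_over_def)
    qed
    have vf: "vector_field_on ?J (restrict_zero ?J ?F)"
      unfolding vector_field_on_def holomorphic_map_on_iff_cdiff
    proof (intro conjI ballI allI impI)
      fix w assume w: "w \<in> ?J"
      have "(c *\<^sub>C h) *v s = c *\<^sub>C (h *v s)" for c and h :: "complex ^ 'n ^ 'n"
        by (simp add: vec_eq_iff matrix_vector_mult_def sum_distrib_left mult_ac)
      then have "cdiff ?F w ?J"
        by (intro cdiffI[OF F']) simp
      then show "cdiff (restrict_zero ?J ?F) w ?J" by (rule cdiff_restrict_zero[OF _ w])
      show "restrict_zero ?J ?F w \<in> tangent_space ?J w"
        using w tangent_spaceI[OF line[OF w]] by (simp add: restrict_zero_def)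
    qed (simp add: restrict_zero_def)
    have F2: "?F w \<in> contact2 w" for w
      unfolding contact2_iff by (cases "fst w") (simp add: bil_plane_d_point)
    have "vf_bracket X2 (restrict_zero ?J ?F) ?w \<in> contact2 ?w"
    proof -
      have "preserves ?J contact2 X2" using X2(1) by (simp add: prolongation_def)
      then show ?thesis
        unfolding preserves_def using vf F2 w(1) by (simp add: restrict_zero_def)
    qed
    then have br: "snd (snd (fst (vf_bracket X2 (restrict_zero ?J ?F) ?w))) = 0"
      unfolding contact2_iff by simp
    have X2w: "fst (X2 ?w) = X ?z" "snd (X2 ?w) = 0"
    proof -
      show "fst (X2 ?w) = X ?z" using X2(1) w(1) by (auto simp: prolongation_def)
      show "snd (X2 ?w) = 0"
        by (rule tangent_space_linear[OF X2(2)[OF w(2)] bounded_linear_snd]) (simp add: flat_system_iff)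
    qed
    then have X2w: "X2 ?w = (X ?z, 0)" by (simp add: prod_eq_iff)
    have Fw: "?F ?w = ((s, bil p s, 0), 0)" by simp
    obtain X2' where X2': "(X2 has_derivative X2') (at ?w within ?J)"
      using X2(1) w(1) by (auto simp: prolongation_def vector_field_on_def holomorphic_map_on_def)
    have d1: "((\<lambda>t. fst (X2 (?w + t *\<^sub>R ((s, bil p s, 0), 0)))) has_vector_derivative fst (X2' ((s, bil p s, 0), 0))) (at 0)"
      by (rule bounded_linear.has_vector_derivative[OF bounded_linear_fst line_has_vector_derivative[OF X2' line[OF w(1)]]])
    have d2: "((\<lambda>t. X (?z + t *\<^sub>R (s, bil p s, 0))) has_vector_derivative X' (s, bil p s, 0)) (at 0)"
      by (rule line_has_vector_derivative[OF X']) simp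
    have "fst (X2' ((s, bil p s, 0), 0)) - X' (s, bil p s, 0) = 0"
    proof (rule has_vector_derivative_eventually_zero[OF has_vector_derivative_diff[OF d1 d2]])
      show "\<forall>\<^sub>F t in nhds 0. fst (X2 (?w + t *\<^sub>R ((s, bil p s, 0), 0))) - X (?z + t *\<^sub>R (s, bil p s, 0)) = 0"
        using line[OF w(1), of "(s, bil p s, 0)"]
      proof eventually_elim
        case (elim t)
        then have "fst (X2 (?w + t *\<^sub>R ((s, bil p s, 0), 0))) = X (fst (?w + t *\<^sub>R ((s, bil p s, 0), 0)))"
          using X2(1) unfolding prolongation_def by blast
        then show ?case by simp
      qed
    qed
    moreover have "vf_bracket X2 (restrict_zero ?J ?F) ?w = ?F' (X2 ?w) - X2' (?F ?w)"
      using dir_deriv_eq[OF X2' line[OF w(1), of "(s, bil p s, 0)"]] w(1) X2w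
        dir_deriv_eq[OF restrict_zero_has_derivative[OF F' w(1)] line[OF w(1), of "X ?z"]]
      by (simp add: vf_bracket_def) (simp add: restrict_zero_def)
    ultimately show ?thesis
      using br X2w by (simp add: matrix_vector_mult_0)
  qed
qed

lemma point_symmetry_derivative:
  assumes U: "open U" and X: "X \<in> point_symmetries U E" and z: "z \<in> U"
  shows "\<exists>X'. (X has_derivative X') (at z) \<and> (\<forall>c v. X' (c *\<^sub>C v) = c *\<^sub>C X' v)"
proof -
  have "holomorphic_map_on X U"
    using X by (simp add: point_symmetries_def contact_vector_field_def vector_field_on_def)
  then show ?thesis
    using z unfolding holomorphic_map_on_def at_within_open[OF z U, symmetric] by blast
qed

lemma point_symmetry_local_form:
  fixes X :: "'n::finite jet1 \<Rightarrow> 'n jet1"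
  assumes U: "open U" and X: "X \<in> point_symmetries U (flat_system U)" and z: "z \<in> U"
  shows "\<exists>M\<in>special_linear. \<forall>\<^sub>F z in nhds z. fst (snd (X z)) - bil (snd (snd z)) (fst (X z)) = gen M z"
proof -
  have "\<forall>z\<in>U. \<exists>X'. (X has_derivative X') (at z) \<and> (\<forall>c v. X' (c *\<^sub>C v) = c *\<^sub>C X' v)"
    using point_symmetry_derivative[OF U X] by blast
  from bchoice[OF this] obtain X' where X': "\<And>z. z \<in> U \<Longrightarrow> (X has_derivative X' z) (at z)"
      "\<And>z c v. z \<in> U \<Longrightarrow> X' z (c *\<^sub>C v) = c *\<^sub>C X' z v"
    by blast
  obtain x0 u0 p0 where z0: "z = (x0, u0, p0)" by (cases z)
  obtain A B where AB: "open A" "open B" "x0 \<in> A" "(u0, p0) \<in> B" "A \<times> B \<subseteq> U"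
    using U z unfolding z0 by (rule open_prod_elim) auto
  obtain C D where CD: "open C" "open D" "u0 \<in> C" "p0 \<in> D" "C \<times> D \<subseteq> B"
    using AB(2,4) by (rule open_prod_elim) auto
  obtain ea eb ec where e: "ea > 0" "ball x0 ea \<subseteq> A" "eb > 0" "ball u0 eb \<subseteq> C" "ec > 0" "ball p0 ec \<subseteq> D"
    using AB(1,3) CD(1-4) by (meson open_contains_ball)
  define e where "e = min ea (min eb ec)"
  have box: "(x, u, p) \<in> U" if "x \<in> ball x0 e" "u \<in> ball u0 e" "p \<in> ball p0 e" for x u p
  proof -
    have "x \<in> ball x0 ea" "u \<in> ball u0 eb" "p \<in> ball p0 ec" using that by (auto simp: e_def)
    then show ?thesis using e AB(5) CD(5) by blast
  qed
  interpret local_symmetry X X' x0 u0 p0 e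
  proof
    show "e > 0" using e by (simp add: e_def)
  next
    fix x u p assume b: "x \<in> ball x0 e" "u \<in> ball u0 e" "p \<in> ball p0 e"
    show "(X has_derivative X' (x, u, p)) (at (x, u, p))" by (rule X'(1)[OF box[OF b]])
    show "X' (x, u, p) (c *\<^sub>C v) = c *\<^sub>C X' (x, u, p) v" for c v by (rule X'(2)[OF box[OF b]])
    show "fst (X' (x, u, p) (0, 0, \<pi>)) = 0 \<and> fst (snd (X' (x, u, p) (0, 0, \<pi>))) = 0" for \<pi>
      by (rule point_symmetry_conditions(1)[OF U X box[OF b] X'(1)[OF box[OF b]]])
    show "bil (snd (snd (X (x, u, p)))) s = fst (snd (X' (x, u, p) (s, bil p s, 0))) - bil p (fst (X' (x, u, p) (s, bil p s, 0)))"
      and "snd (snd (X' (x, u, p) (s, bil p s, 0))) = 0" for s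
      by (rule point_symmetry_conditions(2,3)[OF U X box[OF b] X'(1)[OF box[OF b]]])+
  qed
  obtain M where "\<forall>\<^sub>F z in nhds (x0, u0, p0). f z = gen M z"
    using local_form by blast
  then show ?thesis
    using tracefree_in[of M] by (intro bexI[of _ "tracefree M"]) (simp_all add: f_def z0)
qed

text \<open>
  The local matrices agree on overlaps, since trace-free matrices are determined by their functions
  on open sets; so on the connected set \<open>U\<close> they are one matrix. The field is then recovered from
  its generating function: \<open>\<xi>\<close> and \<open>\<pi>\<close> are derivatives of \<open>f\<close> by the conditions on a point symmetry, and \<open>\<eta> = f + p \<cdot> \<xi>\<close>.
\<close>

lemma point_symmetry_global_form:
  fixes X :: "'n::finite jet1 \<Rightarrow> 'n jet1"
  assumes U: "open U" "connected U" "U \<noteq> {}" and X: "X \<in> point_symmetries U (flat_system U)"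
  shows "\<exists>M\<in>special_linear. X = restrict_zero U (matrix_field M)"
proof -
  let ?f = "\<lambda>z. fst (snd (X z)) - bil (snd (snd z)) (fst (X z))"
  have "\<forall>z\<in>U. \<exists>M. M \<in> special_linear \<and> (\<forall>\<^sub>F z' in nhds z. ?f z' = gen M z')"
    using point_symmetry_local_form[OF U(1) X] by blast
  from bchoice[OF this] obtain g
    where g: "\<And>z. z \<in> U \<Longrightarrow> g z \<in> special_linear" "\<And>z. z \<in> U \<Longrightarrow> \<forall>\<^sub>F z' in nhds z. ?f z' = gen (g z) z'"
    by blast
  have const: "g z = g z'" if "z \<in> U" "z' \<in> U" for z z'
  proof (rule connected_local_const[OF U(2) that], rule ballI)
    fix a assume a: "a \<in> U"
    have "\<forall>\<^sub>F b in nhds a. \<forall>\<^sub>F z' in nhds b. ?f z' = gen (g a) z'"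
      using g(2)[OF a] by (simp add: eventually_eventually)
    moreover have "\<forall>\<^sub>F b in nhds a. b \<in> U"
      using U(1) a eventually_nhds by blast
    ultimately have "\<forall>\<^sub>F b in nhds a. g a = g b"
    proof eventually_elim
      case (elim b)
      have "\<forall>\<^sub>F z' in nhds b. gen (g a) z' = gen (g b) z'"
        by (rule eventually_mono[OF eventually_conj[OF elim(1) g(2)[OF elim(2)]]], elim conjE, rule trans[OF sym])
      then obtain N where "open N" "b \<in> N" "\<forall>z\<in>N. gen (g a) z = gen (g b) z"
        unfolding eventually_nhds by blast
      then show ?case
        using gen_eq_on_open[of N b "g a" "g b"] g(1)[OF a] g(1)[OF elim(2)] by blast
    qed
    then show "\<forall>\<^sub>F b in at a within U. g a = g b"
      by (simp add: eventually_at_filter eventually_mono)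
  qed
  obtain z0 where z0: "z0 \<in> U" using U(3) by blast
  let ?M = "g z0"
  have ev: "\<forall>\<^sub>F z' in nhds z. ?f z' = gen ?M z'" if "z \<in> U" for z
    using g(2)[OF that] const[OF that z0] by simp
  have "X z = matrix_field ?M z" if z: "z \<in> U" for z
  proof -
    obtain x u p where zz: "z = (x, u, p)" by (cases z)
    obtain X' where X': "(X has_derivative X') (at z)"
      using point_symmetry_derivative[OF U(1) X z] by blast
    note cond = point_symmetry_conditions[OF U(1) X z[unfolded zz] X'[unfolded zz]]
    define G where "G v = bil (d_plane_vec z v) (?M *v point_vec z) + bil (plane_vec z) (?M *v d_point_vec v)" for v
    have "(?f has_derivative (\<lambda>v. fst (snd (X' v)) - (bil (snd (snd z)) (fst (X' v)) + bil (snd (snd v)) (fst (X z))))) (at z)"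
      by (intro has_derivative_diff bil.FDERIV has_derivative_fst has_derivative_snd X' has_derivative_ident)
    moreover have "(?f has_derivative G) (at z)"
    proof (rule has_derivative_transform_eventually[OF gen_has_derivative[of ?M z UNIV, folded G_def[abs_def]]])
      show "\<forall>\<^sub>F x' in at z. gen ?M x' = ?f x'"
        using ev[OF z] by (simp add: eventually_at_filter eq_commute eventually_mono)
      show "gen ?M z = ?f z"
        using eventually_nhds_x_imp_x[OF ev[OF z]] by simp
    qed simp
    ultimately have G: "G v = fst (snd (X' v)) - (bil p (fst (X' v)) + bil (snd (snd v)) (fst (X z)))" for v
      using has_derivative_unique by (fastforce simp: zz fun_eq_iff)
    have dirG: "dir_deriv (gen ?M) z v = G v" for v
      by (simp add: dir_deriv_gen G_def)
    have \<xi>: "fst (X z) $ i = - d_p i (gen ?M) z" for i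
      unfolding d_p_def dirG G using cond(1)[of "axis i 1"] by simp
    have linG: "G (v + w) = G v + G w" "G (c *\<^sub>C v) = c * G v" for v w c
      unfolding G_def by (simp_all add: linear_add[OF bounded_linear.linear[OF bounded_linear_d_plane_vec]]
          linear_add[OF bounded_linear.linear[OF bounded_linear_d_point_vec]] bil.add_left bil.add_right
          matrix_vector_right_distrib matrix_vector_scaleC algebra_simps)
    have \<pi>: "snd (snd (X z)) $ i = d_total i (gen ?M) z" for i
    proof -
      have "d_total i (gen ?M) z = G (axis i 1, 0, 0) + p $ i * G (0, 1, 0)"
        by (simp add: d_total_def d_u_def zz dirG[unfolded zz])
      also have "\<dots> = G ((axis i 1, 0, 0) + p $ i *\<^sub>C (0, 1, 0))"
        unfolding linG ..
      also have "\<dots> = G (axis i 1, bil p (axis i 1), 0)" by simp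
      also have "\<dots> = snd (snd (X z)) $ i"
        unfolding G using cond(2)[of "axis i 1"] by (simp add: zz)
      finally show ?thesis ..
    qed
    have "fst (snd (X z)) = gen ?M z + bil p (fst (X z))"
      using eventually_nhds_x_imp_x[OF ev[OF z]] by (simp add: zz algebra_simps)
    also have "\<dots> = gen ?M z - (\<Sum>i\<in>UNIV. p $ i * d_p i (gen ?M) z)"
      by (simp add: bil_def \<xi> sum_negf)
    finally have "X z = generated_field (gen ?M) z"
      using \<xi> \<pi> by (simp add: generated_field_def zz prod_eq_iff vec_eq_iff)
    then show ?thesis by (simp add: generated_field_gen)
  qed
  moreover have "X z = 0" if "z \<notin> U" for z
    using X that by (cases z) (simp add: point_symmetries_def contact_vector_field_def vector_field_on_def)
  ultimately have "X = restrict_zero U (matrix_field ?M)"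
    by (auto simp: fun_eq_iff restrict_zero_def)
  then show ?thesis using g(1)[OF z0] by blast
qed

section \<open>The isomorphisms\<close>

lemma matrix_field_add: "matrix_field (M + N) = matrix_field M + matrix_field N"
  and matrix_field_scaleC: "matrix_field (c *\<^sub>C M) = c *\<^sub>C matrix_field M"
proof -
  have "point_velocity (M + N) z = point_velocity M z + point_velocity N z" "plane_velocity (M + N) z = plane_velocity M z + plane_velocity N z"
    "point_velocity (c *\<^sub>C M) z = c *\<^sub>C point_velocity M z" "plane_velocity (c *\<^sub>C M) z = c *\<^sub>C plane_velocity M z" for z
    by (simp_all add: point_velocity_def plane_velocity_def vec_eq_iff matrix_vector_mult_def vector_matrix_mult_def
        sum.distrib sum_distrib_left algebra_simps)
  then show "matrix_field (M + N) = matrix_field M + matrix_field N" "matrix_field (c *\<^sub>C M) = c *\<^sub>C matrix_field M"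
    by (simp_all add: fun_eq_iff matrix_field_def)
qed

text \<open>
  The generating function is the contact form evaluated on the field.
\<close>

lemma gen_from_matrix_field: "gen M z = - bil (plane_vec z) (d_point_vec (matrix_field M z))"
  by (simp add: d_point_vec_matrix_field point_velocity_def bil.diff_right gen_def)

lemma restrict_zero_linear: "restrict_zero U (F + G) = restrict_zero U F + restrict_zero U G"
  "restrict_zero U (c *\<^sub>C F) = c *\<^sub>C restrict_zero U F" for F G :: "'a \<Rightarrow> 'b::complex_vector"
  by (auto simp: fun_eq_iff restrict_zero_def)

lemma point_symmetries_eq:
  assumes "open U" "connected U" "U \<noteq> {}"
  shows "point_symmetries U (flat_system U) = (\<lambda>M. restrict_zero U (matrix_field M)) ` special_linear"
  using point_symmetry_global_form[OF assms] matrix_field_point_symmetry[OF assms(1)] by blast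

lemma lie_isomorphism_matrix_field:
  fixes U :: "'n::finite jet1 set"
  assumes "open U" "connected U" "U \<noteq> {}"
  shows "lie_isomorphism commutator special_linear vf_bracket (point_symmetries U (flat_system U))
    (\<lambda>M. restrict_zero U (matrix_field M))"
  unfolding point_symmetries_eq[OF assms]
proof (rule lie_isomorphism_image[OF lie_algebra_special_linear])
  obtain w where w: "w \<in> U" using assms(3) by blast
  show "inj_on (\<lambda>M. restrict_zero U (matrix_field M)) special_linear"
  proof (rule inj_onI)
    fix M N :: "complex ^ ('n + 2) ^ ('n + 2)"
    assume M: "M \<in> special_linear" "N \<in> special_linear" and eq: "restrict_zero U (matrix_field M) = restrict_zero U (matrix_field N)"
    show "M = N"
    proof (rule gen_eq_on_open[OF assms(1) w _ M])
      fix z assume "z \<in> U"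
      then have "matrix_field M z = matrix_field N z" using fun_cong[OF eq, of z] by (simp add: restrict_zero_def)
      then show "gen M z = gen N z" by (simp add: gen_from_matrix_field)
    qed
  qed
  show "restrict_zero U (matrix_field (commutator M N)) = vf_bracket (restrict_zero U (matrix_field M)) (restrict_zero U (matrix_field N))"
    for M N :: "complex ^ ('n + 2) ^ ('n + 2)"
    unfolding vf_bracket_restrict_zero[OF assms(1) matrix_field_has_derivative matrix_field_has_derivative]
    by (simp add: fun_eq_iff restrict_zero_def vf_bracket_matrix_field)
qed (simp_all add: matrix_field_add matrix_field_scaleC restrict_zero_linear)

lemma lie_isomorphism_gen:
  "lie_isomorphism commutator special_linear lagrange_bracket (generator_span :: ('n::finite jet1 \<Rightarrow> complex) set) gen"
  unfolding generator_span_eq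
  by (rule lie_isomorphism_image[OF lie_algebra_special_linear])
     (auto intro!: inj_onI gen_inj simp: gen_add gen_scaleC lagrange_bracket_gen)

lemma lie_isomorphism_generated_field:
  fixes U :: "'n::finite jet1 set"
  assumes "open U" "connected U" "U \<noteq> {}"
  shows "lie_isomorphism lagrange_bracket (generator_span :: ('n jet1 \<Rightarrow> complex) set)
    vf_bracket (point_symmetries U (flat_system U)) (\<lambda>f. restrict_zero U (generated_field f))"
proof -
  let ?\<Phi> = "\<lambda>f :: 'n jet1 \<Rightarrow> complex. restrict_zero U (generated_field f)"
  note iso = lie_isomorphism_matrix_field[OF assms, unfolded lie_isomorphism_def]
  have img: "point_symmetries U (flat_system U) = ?\<Phi> ` generator_span"
    unfolding point_symmetries_eq[OF assms] generator_span_eq image_image generated_field_gen ..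
  have "inj_on ?\<Phi> generator_span"
    using iso unfolding bij_betw_def generator_span_eq inj_on_def by (auto simp: generated_field_gen)
  moreover have "lie_algebra lagrange_bracket (generator_span :: ('n jet1 \<Rightarrow> complex) set)"
    using lie_isomorphism_gen[where 'n = 'n] by (simp add: lie_isomorphism_def)
  moreover have "?\<Phi> (f + g) = ?\<Phi> f + ?\<Phi> g" if "f \<in> generator_span" "g \<in> generator_span" for f g
    using that unfolding generator_span_eq by (auto simp: generated_field_gen matrix_field_add restrict_zero_linear simp flip: gen_add)
  moreover have "?\<Phi> (c *\<^sub>C f) = c *\<^sub>C ?\<Phi> f" if "f \<in> generator_span" for c f
    using that unfolding generator_span_eq by (auto simp: generated_field_gen matrix_field_scaleC restrict_zero_linear simp flip: gen_scaleC)
  moreover have "?\<Phi> (lagrange_bracket f g) = vf_bracket (?\<Phi> f) (?\<Phi> g)" if "f \<in> generator_span" "g \<in> generator_span" for f g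
    using that iso unfolding generator_span_eq by (auto simp: generated_field_gen lagrange_bracket_gen)
  ultimately show ?thesis
    unfolding img by (intro lie_isomorphism_image)
qed

theorem proposition3p15:
  fixes U :: "'n::finite jet1 set"
  assumes "open U" and "connected U" and "U \<noteq> {}"
  shows "(\<exists>\<phi>. lie_isomorphism
             vf_bracket (point_symmetries U (flat_system U))
             commutator (special_linear :: (complex ^ ('n + 2) ^ ('n + 2)) set) \<phi>)
    \<and> lie_isomorphism
             lagrange_bracket (generator_span :: ('n jet1 \<Rightarrow> complex) set)
             vf_bracket (point_symmetries U (flat_system U))
             (\<lambda>f. restrict_zero U (generated_field f))
    \<and> bigrading lagrange_bracket (generator_span :: ('n jet1 \<Rightarrow> complex) set) bigraded_part
    \<and> is_direct_sum (graded_part (-1) :: ('n jet1 \<Rightarrow> complex) set) (bigraded_part (-1) 0) (bigraded_part 0 (-1))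
    \<and> is_direct_sum (graded_part 1 :: ('n jet1 \<Rightarrow> complex) set) (bigraded_part 1 0) (bigraded_part 0 1)
    \<and> (graded_part (-2) :: ('n jet1 \<Rightarrow> complex) set) = bigraded_part (-1) (-1)
    \<and> (graded_part 0 :: ('n jet1 \<Rightarrow> complex) set) = bigraded_part 0 0
    \<and> (graded_part 2 :: ('n jet1 \<Rightarrow> complex) set) = bigraded_part 1 1
    \<and> Z_1 \<in> (generator_span :: ('n jet1 \<Rightarrow> complex) set)
    \<and> Z_n1 \<in> (generator_span :: ('n jet1 \<Rightarrow> complex) set)
    \<and> (Z :: 'n jet1 \<Rightarrow> complex) = Z_1 + Z_n1
    \<and> (\<forall>a b. \<forall>g \<in> (bigraded_part a b :: ('n jet1 \<Rightarrow> complex) set).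
          lagrange_bracket Z_1 g = of_int a *\<^sub>C g \<and> lagrange_bracket Z_n1 g = of_int b *\<^sub>C g)"
proof (intro conjI allI ballI)
  show "\<exists>\<phi>. lie_isomorphism
             vf_bracket (point_symmetries U (flat_system U))
             commutator (special_linear :: (complex ^ ('n + 2) ^ ('n + 2)) set) \<phi>"
    using lie_isomorphism_inv[OF lie_isomorphism_matrix_field[OF assms]] by blast
  show "Z_1 \<in> (generator_span :: ('n jet1 \<Rightarrow> complex) set)" "Z_n1 \<in> (generator_span :: ('n jet1 \<Rightarrow> complex) set)"
    unfolding Z_eq_gen by (rule gen_in_generator_span)+
  show "(Z :: 'n jet1 \<Rightarrow> complex) = Z_1 + Z_n1"
    by (simp add: fun_eq_iff Z_def Z_1_def Z_n1_def)
qed (intro lie_isomorphism_generated_field[OF assms] bigrading_generators graded_parts Z_action; assumption)+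

end
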